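(* There exist linear maps $T^{(n)}:\mathcal{F}\to\mathcal{F}$, one for each $n\in\mathbb{N}$, such that each $T^{(n)}$ is a projection ($(T^{(n)})^2=T^{(n)}$), $T^{(n)}(\mathcal{F})\subseteq V^{(n)}$, $T^{(m)}(\mathcal{F})\perp T^{(n)}(\mathcal{F})$ with respect to $\langle\cdot,\cdot\rangle$ for all $m\neq n$, and \[\mathcal{F}=\bigoplus_{n=1}^\infty T^{(n)}(\mathcal{F}).\]
   Context: Fix an algebraic closure $\overline{\mathbb{Q}}$ of $\mathbb{Q}$. Let $Y$ be the set of places of $\overline{\mathbb{Q}}$; for a number field $K$ and a place $v$ of $K$ let $Y(K,v)=\{y\in Y: y\mid v\}$. $Y$ carries the (Allcock–Vaaler) totally disconnected locally compact Hausdorff topology in which the sets $Y(K,v)$ are compact open and form a basis, and the Borel measure $\lambda$ with $\lambda(Y(K,v))=[K_v:\mathbb{Q}_v]/[K:\mathbb{Q}]$. For $y\in Y$ let $\|\cdot\|_y$ be the absolute value at $y$ extending the usual $p$-adic or archimedean absolute value of $\mathbb{Q}$. For $\alpha\in\overline{\mathbb{Q}}^\times$ put $f_\alpha(y)=\log\|\alpha\|_y$; $\mathcal{F}=\{f_\alpha:\alpha\in\overline{\mathbb{Q}}^\times\}$ (the algebraic numbers modulo torsion, written additively) is a $\mathbb{Q}$-vector space of functions on $Y$, with inner product $\langle f,g\rangle=\int_Y fg\,d\lambda$. For a number field $K$, $V_K$ is the $\mathbb{Q}$-span of $\{f_\alpha:\alpha\in K^\times\}$, and $V^{(n)}=\sum_{K:\,[K:\mathbb{Q}]\le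 n}V_K$, the sum over all number fields $K\subset\overline{\mathbb{Q}}$ of degree at most $n$. *)

theory Defs
  imports
    "HOL-Analysis.Analysis"
    "HOL-Algebra.Algebraic_Closure_Type"
    "HOL-Library.Function_Algebras"
begin

text \<open>
  The algebraic closure of the rationals is modelled by a type of characteristic 0 in class
  \<^class>\<open>alg_closed_field\<close>, all of whose elements are \<^const>\<open>algebraic\<close>
  (for instance \<^typ>\<open>rat alg_closure\<close>). Degrees of field extensions are those of
  \<open>HOL-Algebra\<close>, taken in the ring \<^term>\<open>ring_of_type_algebra\<close>.
\<close>

definition number_field :: "'a :: field_char_0 set \<Rightarrow> bool" where
  "number_field K \<longleftrightarrow>
     subfield K ring_of_type_algebra \<and> ring.finite_dimension ring_of_type_algebra \<rat> K"

definition field_degree :: "'a :: field_char_0 set \<Rightarrow> nat" where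
  "field_degree K = ring.dim ring_of_type_algebra \<rat> K"


section \<open>Places\<close>

text \<open>
  Absolute values on a subfield \<open>K\<close> are \<^const>\<open>extensional\<close> functions, so that
  equality of functions is equality on \<open>K\<close>.
\<close>

definition absolute_value :: "'a :: field set \<Rightarrow> ('a \<Rightarrow> real) \<Rightarrow> bool" where
  "absolute_value K a \<longleftrightarrow>
     a \<in> extensional K \<and>
     (\<forall>x\<in>K. a x \<ge> 0) \<and>
     (\<forall>x\<in>K. a x = 0 \<longleftrightarrow> x = 0) \<and>
     (\<forall>x\<in>K. \<forall>y\<in>K. a (x * y) = a x * a y) \<and>
     (\<forall>x\<in>K. \<forall>y\<in>K. a (x + y) \<le> a x + a y)"

definition nontrivial_absolute_value :: "'a :: field set \<Rightarrow> ('a \<Rightarrow> real) \<Rightarrow> bool" where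
  "nontrivial_absolute_value K a \<longleftrightarrow> absolute_value K a \<and> (\<exists>x\<in>K. x \<noteq> 0 \<and> a x \<noteq> 1)"

definition equivalent_absolute_values ::
    "'a :: field set \<Rightarrow> ('a \<Rightarrow> real) \<Rightarrow> ('a \<Rightarrow> real) \<Rightarrow> bool" where
  "equivalent_absolute_values K a b \<longleftrightarrow> (\<exists>s>0. \<forall>x\<in>K. b x = a x powr s)"

type_synonym 'a place = "('a \<Rightarrow> real) set"

definition places :: "'a :: field set \<Rightarrow> 'a place set" where
  "places K = {{b. absolute_value K b \<and> equivalent_absolute_values K a b} | a.
                 nontrivial_absolute_value K a}"

abbreviation places_Qbar :: "'a :: field place set" where
  "places_Qbar \<equiv> places UNIV"

definition lies_above :: "'a :: field place \<Rightarrow> 'a set \<Rightarrow> 'a place \<Rightarrow> bool" where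
  "lies_above y K v \<longleftrightarrow> (\<forall>a\<in>y. restrict a K \<in> v)"

definition places_above :: "'a :: field set \<Rightarrow> 'a place \<Rightarrow> 'a place set" where
  "places_above K v = {y \<in> places_Qbar. lies_above y K v}"

definition padic_abs :: "nat \<Rightarrow> rat \<Rightarrow> real" where
  "padic_abs p r =
     (if r = 0 then 0
      else real p powi (int (multiplicity (int p) (snd (quotient_of r)))
                        - int (multiplicity (int p) (fst (quotient_of r)))))"

definition extends_usual_abs :: "('a :: field_char_0 \<Rightarrow> real) \<Rightarrow> bool" where
  "extends_usual_abs a \<longleftrightarrow>
     (\<forall>r. a (of_rat r) = \<bar>of_rat r\<bar>) \<or>
     (\<exists>p. Factorial_Ring.prime p \<and> (\<forall>r. a (of_rat r) = padic_abs p r))"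

definition place_abs :: "'a :: field_char_0 place \<Rightarrow> 'a \<Rightarrow> real" where
  "place_abs y = (THE a. a \<in> y \<and> extends_usual_abs a)"


section \<open>Completions and local degrees\<close>

text \<open>
  The completion of \<open>K\<close> at \<open>v\<close> is the ring of \<open>v\<close>-Cauchy sequences in \<open>K\<close> modulo the null
  sequences. The closure of the rationals in it (the classes of rational Cauchy sequences) is the
  completion of the rationals at the place below \<open>v\<close>. Equivalent absolute values have the same
  Cauchy and null sequences, so it is immaterial which elements of \<open>v\<close> are used.
\<close>

definition cauchy_at :: "'a :: field place \<Rightarrow> (nat \<Rightarrow> 'a) \<Rightarrow> bool" where
  "cauchy_at v s \<longleftrightarrow> (\<forall>a\<in>v. \<forall>e>0. \<exists>N. \<forall>m\<ge>N. \<forall>n\<ge>N. a (s m - s n) < e)"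

definition null_at :: "'a :: field place \<Rightarrow> (nat \<Rightarrow> 'a) \<Rightarrow> bool" where
  "null_at v s \<longleftrightarrow> (\<forall>a\<in>v. (\<lambda>n. a (s n)) \<longlonglongrightarrow> 0)"

definition cauchy_ring :: "'a :: field set \<Rightarrow> 'a place \<Rightarrow> (nat \<Rightarrow> 'a) ring" where
  "cauchy_ring K v =
     \<lparr>carrier = {s. range s \<subseteq> K \<and> cauchy_at v s},
      mult = (\<lambda>s t n. s n * t n), one = (\<lambda>n. 1),
      zero = (\<lambda>n. 0), add = (\<lambda>s t n. s n + t n)\<rparr>"

definition null_ideal :: "'a :: field set \<Rightarrow> 'a place \<Rightarrow> (nat \<Rightarrow> 'a) set" where
  "null_ideal K v = {s \<in> carrier (cauchy_ring K v). null_at v s}"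

definition completion :: "'a :: field set \<Rightarrow> 'a place \<Rightarrow> (nat \<Rightarrow> 'a) set ring" where
  "completion K v = cauchy_ring K v Quot null_ideal K v"

definition rat_completion :: "'a :: field_char_0 set \<Rightarrow> 'a place \<Rightarrow> (nat \<Rightarrow> 'a) set set" where
  "rat_completion K v =
     {null_ideal K v +>\<^bsub>cauchy_ring K v\<^esub> s | s. s \<in> carrier (cauchy_ring K v) \<and> range s \<subseteq> \<rat>}"

definition local_degree :: "'a :: field_char_0 set \<Rightarrow> 'a place \<Rightarrow> nat" where
  "local_degree K v =
     ring.dim (completion K v) (rat_completion K v) (carrier (completion K v))"


section \<open>Topology and measure on the set of places\<close>

definition place_topology :: "'a :: field_char_0 place topology" where
  "place_topology =
     topology_generated_by {places_above K v | K v. number_field K \<and> v \<in> places K}"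

definition place_measure :: "'a :: field_char_0 place measure \<Rightarrow> bool" where
  "place_measure \<mu> \<longleftrightarrow>
     space \<mu> = places_Qbar \<and>
     sets \<mu> = sigma_sets places_Qbar {U. openin place_topology U} \<and>
     (\<forall>K v. number_field K \<longrightarrow> v \<in> places K \<longrightarrow>
        emeasure \<mu> (places_above K v) =
          ennreal (real (local_degree K v) / real (field_degree K)))"


section \<open>The space of algebraic numbers modulo torsion\<close>

text \<open>
  Functions on the set of places are represented by functions on the type
  \<^typ>\<open>'a place\<close> that vanish outside \<^term>\<open>places_Qbar\<close>.
\<close>

definition log_fun :: "'a :: field_char_0 \<Rightarrow> 'a place \<Rightarrow> real" where
  "log_fun \<alpha> = (\<lambda>y. if y \<in> places_Qbar then ln (place_abs y \<alpha>) else 0)"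

definition log_space :: "('a :: field_char_0 place \<Rightarrow> real) set" where
  "log_space = {log_fun \<alpha> | \<alpha>. \<alpha> \<noteq> 0}"

definition place_inner ::
    "'a place measure \<Rightarrow> ('a place \<Rightarrow> real) \<Rightarrow> ('a place \<Rightarrow> real) \<Rightarrow> real" where
  "place_inner \<mu> f g = (\<integral>y. f y * g y \<partial>\<mu>)"

definition rat_scale :: "rat \<Rightarrow> ('b \<Rightarrow> real) \<Rightarrow> 'b \<Rightarrow> real" where
  "rat_scale q f = (\<lambda>y. of_rat q * f y)"

interpretation rat_fun: vector_space "rat_scale :: rat \<Rightarrow> ('b \<Rightarrow> real) \<Rightarrow> 'b \<Rightarrow> real"
  by unfold_locales (auto simp: rat_scale_def fun_eq_iff of_rat_add of_rat_mult algebra_simps)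

definition V_field :: "'a :: field_char_0 set \<Rightarrow> ('a place \<Rightarrow> real) set" where
  "V_field K = rat_fun.span {log_fun \<alpha> | \<alpha>. \<alpha> \<in> K \<and> \<alpha> \<noteq> 0}"

definition V_degree :: "nat \<Rightarrow> ('a :: field_char_0 place \<Rightarrow> real) set" where
  "V_degree n = rat_fun.span (\<Union>K\<in>{K. number_field K \<and> field_degree K \<le> n}. V_field K)"

definition rat_linear_on :: "('b \<Rightarrow> real) set \<Rightarrow> (('b \<Rightarrow> real) \<Rightarrow> ('b \<Rightarrow> real)) \<Rightarrow> bool" where
  "rat_linear_on V T \<longleftrightarrow>
     (\<forall>f\<in>V. \<forall>g\<in>V. T (f + g) = T f + T g) \<and>
     (\<forall>q. \<forall>f\<in>V. T (rat_scale q f) = rat_scale q (T f))"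

definition internal_direct_sum ::
    "('b \<Rightarrow> real) set \<Rightarrow> 'i set \<Rightarrow> ('i \<Rightarrow> ('b \<Rightarrow> real) set) \<Rightarrow> bool" where
  "internal_direct_sum V I W \<longleftrightarrow>
     (\<forall>i\<in>I. rat_fun.subspace (W i)) \<and>
     V = {\<Sum>i\<in>J. w i | J w. finite J \<and> J \<subseteq> I \<and> (\<forall>i\<in>J. w i \<in> W i)} \<and>
     (\<forall>J w. finite J \<longrightarrow> J \<subseteq> I \<longrightarrow> (\<forall>i\<in>J. w i \<in> W i) \<longrightarrow> (\<Sum>i\<in>J. w i) = 0 \<longrightarrow>
        (\<forall>i\<in>J. w i = 0))"

end

theory Submission
  imports Defs
begin

text \<open>
  The automorphism group \<open>G\<close> of the algebraic closure permutes the places, hence acts on the space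
  of functions \<open>f\<^sub>\<alpha>\<close> with finite orbits, and it preserves the inner product because local
  degrees are invariant under conjugation. The space \<open>V_degree n\<close> is spanned by the functions
  with at most \<open>n\<close> conjugates. An infinite-dimensional rational space with a real inner product need not
  admit orthogonal projections, but here they exist already on the level of permutation modules: for
  a finite orbit \<open>Z\<close> the standard form on the rational functions on \<open>Z\<close> is rational valued, and
  projecting there to the span of the indicators of the subsets of \<open>Z\<close> with at most \<open>n\<close> translates
  yields projections that are orthogonal with respect to every \<open>G\<close>-invariant bilinear form. The
  differences of consecutive projections are the required maps.
\<close>

text \<open>Projecting to a rational subspace means solving normal equations over the rationals, but
  for the inner product their coefficients are sums of products of logarithms, so rational solutions
  cannot be expected. On a finite orbit the Gram matrix is rational, and the projection found there
  is mapped to the function space. The maps must also be independent of the orbit and of the choices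
  made. This uniqueness comes from further invariant forms besides the integral: for each place
  \<open>y\<close>, the average at \<open>y\<close> of the product over its orbit. If all averages
  of the square of a function vanish, the function is zero. The measure is known only through its
  values on the basic sets. Its inner product is therefore written as a finite sum over the absolute
  values of a number field containing both numbers, and this sum is compared with the one for the
  conjugate field. Ostrowski's theorem, the finiteness of the places where a number has absolute
  value different from 1, and the transport of completions along automorphisms all serve this
  comparison.\<close>

hide_const (open) up_ring.coeff up_ring.monom module.smult Polynomials.degree
  Polynomials.lead_coeff Divisibility.prime

section \<open>Orthogonal layers in a space of permuted functions\<close>

text \<open>The map \<open>\<psi>\<close> factors through \<open>\<phi>\<close> on \<open>A\<close>.
  In the applications \<open>A\<close> is a group and equal values of \<open>\<phi>\<close> mean
  equal cosets of a stabilizer, so the number of translates of one object bounds that of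
  another.\<close>

lemma card_image_le_if_factors:
  assumes "finite (\<phi> ` A)" and "\<And>s t. s \<in> A \<Longrightarrow> t \<in> A \<Longrightarrow> \<phi> s = \<phi> t \<Longrightarrow> \<psi> s = \<psi> t"
  shows "card (\<psi> ` A) \<le> card (\<phi> ` A)"
proof -
  have "\<psi> s = \<psi> (SOME t. t \<in> A \<and> \<phi> t = \<phi> s)" if "s \<in> A" for s
  proof -
    have "(SOME t. t \<in> A \<and> \<phi> t = \<phi> s) \<in> A \<and> \<phi> (SOME t. t \<in> A \<and> \<phi> t = \<phi> s) = \<phi> s"
      by (rule someI[of _ s]) (use that in simp)
    then show ?thesis using assms(2) that by metis
  qed
  then have "\<psi> ` A = (\<lambda>z. \<psi> (SOME t. t \<in> A \<and> \<phi> t = z)) ` (\<phi> ` A)"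
    by (auto simp: image_image)
  then show ?thesis by (metis assms(1) card_image_le)
qed

text \<open>Gram-Schmidt over the rationals: the standard form on functions on \<open>Z\<close> is
  rational valued and positive definite, so the one division stays rational. The vectors may be
  dependent, as indicators of subsets usually are.\<close>

lemma rational_orthogonal_projection:
  fixes v :: "'i \<Rightarrow> 'x \<Rightarrow> rat"
  assumes "finite Z" "finite A"
  shows "\<exists>a. \<forall>i\<in>A. (\<Sum>x\<in>Z. v i x * (c x - (\<Sum>j\<in>A. a j * v j x))) = 0"
  using assms(2)
proof (induction A arbitrary: c)
  case empty
  then show ?case by simp
next
  case (insert k A)
  \<comment> \<open>The induction hypothesis serves twice, for the target \<open>c\<close> and for
    the new vector \<open>v k\<close>. Both residuals \<open>w\<close> and \<open>z\<close> are
    orthogonal to the old vectors, so it remains to project \<open>w\<close> along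
    \<open>z\<close>.\<close>
  obtain a where a: "\<forall>i\<in>A. (\<Sum>x\<in>Z. v i x * (c x - (\<Sum>j\<in>A. a j * v j x))) = 0"
    using insert.IH by blast
  obtain b where b: "\<forall>i\<in>A. (\<Sum>x\<in>Z. v i x * (v k x - (\<Sum>j\<in>A. b j * v j x))) = 0"
    using insert.IH by blast
  define w where "w = (\<lambda>x. c x - (\<Sum>j\<in>A. a j * v j x))"
  define z where "z = (\<lambda>x. v k x - (\<Sum>j\<in>A. b j * v j x))"
  \<comment> \<open>if \<open>z\<close> vanishes on \<open>Z\<close>, the junk value \<open>l = 0\<close> is the right one\<close>
  define l where "l = (\<Sum>x\<in>Z. z x * w x) / (\<Sum>x\<in>Z. z x * z x)"
  have zr: "(\<Sum>x\<in>Z. z x * (w x - l * z x)) = 0"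
  proof (cases "(\<Sum>x\<in>Z. z x * z x) = 0")
    case True
    then have "\<forall>x\<in>Z. z x * z x = 0"
      using assms(1) by (subst (asm) sum_nonneg_eq_0_iff) auto
    then show ?thesis by simp
  next
    case False
    have "(\<Sum>x\<in>Z. z x * (w x - l * z x)) = (\<Sum>x\<in>Z. z x * w x) - l * (\<Sum>x\<in>Z. z x * z x)"
      by (simp add: algebra_simps sum_subtractf sum_distrib_left)
    then show ?thesis using False by (simp add: l_def)
  qed
  have vr: "(\<Sum>x\<in>Z. v i x * (w x - l * z x)) = 0" if "i \<in> A" for i
  proof -
    have "(\<Sum>x\<in>Z. v i x * (w x - l * z x)) = (\<Sum>x\<in>Z. v i x * w x) - l * (\<Sum>x\<in>Z. v i x * z x)"
      by (simp add: algebra_simps sum_subtractf sum_distrib_left)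
    then show ?thesis using a b that by (simp add: w_def z_def)
  qed
  have vk: "(\<Sum>x\<in>Z. v k x * (w x - l * z x)) = 0"
  proof -
    have "(\<Sum>x\<in>Z. v k x * (w x - l * z x))
        = (\<Sum>x\<in>Z. z x * (w x - l * z x) + (\<Sum>j\<in>A. b j * (v j x * (w x - l * z x))))"
    proof (intro sum.cong refl)
      fix x
      have "v k x = z x + (\<Sum>j\<in>A. b j * v j x)" by (simp add: z_def)
      then show "v k x * (w x - l * z x)
          = z x * (w x - l * z x) + (\<Sum>j\<in>A. b j * (v j x * (w x - l * z x)))"
        by (simp add: distrib_right sum_distrib_right mult.assoc)
    qed
    also have "\<dots> = (\<Sum>j\<in>A. b j * (\<Sum>x\<in>Z. v j x * (w x - l * z x)))"
      by (simp add: sum.distrib zr sum_distrib_left sum.swap[of _ Z])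
    finally show ?thesis by (simp add: vr)
  qed
  define a' where "a' = (\<lambda>j. if j = k then l else a j - l * b j)"
  have "c x - (\<Sum>j\<in>insert k A. a' j * v j x) = w x - l * z x" for x
  proof -
    have "(\<Sum>j\<in>A. a' j * v j x) = (\<Sum>j\<in>A. (a j - l * b j) * v j x)"
      using insert.hyps by (intro sum.cong) (auto simp: a'_def)
    then show ?thesis using insert.hyps
      by (simp add: a'_def w_def z_def algebra_simps sum_subtractf sum_distrib_left)
  qed
  then have "\<forall>i\<in>insert k A. (\<Sum>x\<in>Z. v i x * (c x - (\<Sum>j\<in>insert k A. a' j * v j x))) = 0"
    using vr vk by simp
  then show ?case by blast
qed

lemma rat_scale_eq: "rat_scale q f y = of_rat q * f y"
  by (simp add: rat_scale_def)

lemma sum_fun_apply: "(\<Sum>i\<in>A. F i) y = (\<Sum>i\<in>A. F i y)" for F :: "'i \<Rightarrow> 'b \<Rightarrow> real"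
  by (induction A rule: infinite_finite_induct) auto

lemma sum_fun_comp: "(\<Sum>i\<in>A. F i) \<circ> s = (\<Sum>i\<in>A. F i \<circ> s)" for F :: "'i \<Rightarrow> 'b \<Rightarrow> real"
  by (simp add: fun_eq_iff sum_fun_apply)

section \<open>Functions permuted by a group with finite orbits, and averages over orbits\<close>

locale permuted_functions =
  fixes S :: "('b \<Rightarrow> 'b) set" and V :: "('b \<Rightarrow> real) set"
  assumes id_mem: "id \<in> S"
    and comp_mem: "s \<in> S \<Longrightarrow> t \<in> S \<Longrightarrow> s \<circ> t \<in> S"
    and inv_mem: "s \<in> S \<Longrightarrow> \<exists>t\<in>S. s \<circ> t = id \<and> t \<circ> s = id"
    and V_subspace: "rat_fun.subspace V"
    and V_comp: "f \<in> V \<Longrightarrow> s \<in> S \<Longrightarrow> f \<circ> s \<in> V"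
    and V_orbit: "f \<in> V \<Longrightarrow> finite ((\<lambda>s. f \<circ> s) ` S)"
begin

text \<open>The value type is free so that pairs of functions have orbits too: the orbit of a pair
  lies above the orbits of its components, of their sum and of their product.\<close>

definition orb :: "('b \<Rightarrow> 'c) \<Rightarrow> ('b \<Rightarrow> 'c) set" where
  "orb F = (\<lambda>s. F \<circ> s) ` S"

lemma orb_self: "F \<in> orb F"
  unfolding orb_def using id_mem by (intro image_eqI[of _ _ id]) auto

lemma orb_comp: "s \<in> S \<Longrightarrow> orb (F \<circ> s) = orb F"
proof -
  assume s: "s \<in> S"
  then obtain t where t: "t \<in> S" "s \<circ> t = id" using inv_mem by blast
  have "F \<circ> u \<in> orb (F \<circ> s)" if "u \<in> S" for u
  proof -
    have "F \<circ> u = (F \<circ> s) \<circ> (t \<circ> u)" using t by (metis comp_assoc id_comp)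
    then show ?thesis using comp_mem t that unfolding orb_def by blast
  qed
  then show ?thesis
    using comp_mem[OF s] by (auto simp: orb_def comp_assoc)
qed

lemma orb_closed: "F' \<in> orb F \<Longrightarrow> s \<in> S \<Longrightarrow> F' \<circ> s \<in> orb F"
  using comp_mem by (auto simp: orb_def comp_assoc)

lemma orb_map: "orb (\<lambda>y. p (F y)) = (\<lambda>F'. p \<circ> F') ` orb F"
  by (auto simp: orb_def comp_def)

lemma comp_cancel: "s \<in> S \<Longrightarrow> F \<circ> s = F' \<circ> s \<Longrightarrow> F = F'"
  by (metis comp_assoc comp_id inv_mem)

lemma orb_pair_finite:
  assumes "finite (orb F)" "finite (orb G)"
  shows "finite (orb (\<lambda>y. (F y, G y)))"
proof (rule finite_subset)
  show "orb (\<lambda>y. (F y, G y)) \<subseteq> (\<lambda>(F, G) y. (F y, G y)) ` (orb F \<times> orb G)"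
    by (force simp: orb_def fun_eq_iff)
qed (use assms in simp)

definition mean :: "'b \<Rightarrow> ('b \<Rightarrow> real) \<Rightarrow> real" where
  "mean y h = (\<Sum>h'\<in>orb h. h' y) / card (orb h)"

text \<open>The fibres of the equivariant map \<open>orb F \<rightarrow> orb (p \<circ> F)\<close> all have the same size, so
  averages may be taken over any finite orbit lying above.\<close>

lemma mean_lift:
  assumes fin: "finite (orb F)"
  shows "mean y (\<lambda>y. p (F y)) = (\<Sum>F'\<in>orb F. p (F' y)) / card (orb F)"
proof -
  define h where "h = p \<circ> F"
  have orbh: "orb h = (\<lambda>F'. p \<circ> F') ` orb F"
    using orb_map[of p F] by (simp add: h_def comp_def)
  define c where "c = card {F' \<in> orb F. p \<circ> F' = h}"
  have fibre: "card {F' \<in> orb F. p \<circ> F' = h'} = c" if h': "h' \<in> orb h" for h'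
  proof -
    obtain s where s: "s \<in> S" "h' = h \<circ> s" using h' unfolding orb_def by blast
    obtain t where t: "t \<in> S" "t \<circ> s = id" "s \<circ> t = id" using inv_mem s(1) by blast
    \<comment> \<open>Composition with \<open>s\<close> on the right commutes with \<open>p\<close>
      on the left, so it carries the fibre over \<open>h\<close> to the fibre over the translate of
      \<open>h\<close>.\<close>
    have "bij_betw (\<lambda>F'. F' \<circ> s) {F' \<in> orb F. p \<circ> F' = h} {F' \<in> orb F. p \<circ> F' = h'}"
    proof (rule bij_betw_byWitness[where f' = "\<lambda>F'. F' \<circ> t"])
      show "\<forall>F'\<in>{F' \<in> orb F. p \<circ> F' = h}. F' \<circ> s \<circ> t = F'"
           "\<forall>F'\<in>{F' \<in> orb F. p \<circ> F' = h'}. F' \<circ> t \<circ> s = F'"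
        using t by (simp_all add: comp_assoc)
      show "(\<lambda>F'. F' \<circ> s) ` {F' \<in> orb F. p \<circ> F' = h} \<subseteq> {F' \<in> orb F. p \<circ> F' = h'}"
        using s orb_closed by (auto simp flip: comp_assoc)
      have "p \<circ> (F' \<circ> t) = h" if "p \<circ> F' = h'" for F'
        using that s t by (metis comp_assoc comp_id)
      then show "(\<lambda>F'. F' \<circ> t) ` {F' \<in> orb F. p \<circ> F' = h'} \<subseteq> {F' \<in> orb F. p \<circ> F' = h}"
        using t orb_closed by auto
    qed
    from bij_betw_same_card[OF this] show ?thesis by (simp add: c_def)
  qed
  have "c > 0"
    unfolding c_def using fin orb_self[of F] by (auto simp: card_gt_0_iff h_def)
  have "(\<Sum>F'\<in>orb F. p (F' y)) = (\<Sum>h'\<in>orb h. \<Sum>F'\<in>{F' \<in> orb F. p \<circ> F' = h'}. p (F' y))"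
    unfolding orbh by (rule sum.image_gen[OF fin])
  also have "\<dots> = (\<Sum>h'\<in>orb h. c * h' y)"
  proof (rule sum.cong[OF refl])
    fix h' assume h': "h' \<in> orb h"
    have "(\<Sum>F'\<in>{F' \<in> orb F. p \<circ> F' = h'}. p (F' y)) = (\<Sum>F'\<in>{F' \<in> orb F. p \<circ> F' = h'}. h' y)"
      by (rule sum.cong) auto
    then show "(\<Sum>F'\<in>{F' \<in> orb F. p \<circ> F' = h'}. p (F' y)) = c * h' y"
      using fibre[OF h'] by simp
  qed
  finally have num: "(\<Sum>F'\<in>orb F. p (F' y)) = c * (\<Sum>h'\<in>orb h. h' y)"
    by (simp add: sum_distrib_left)
  have "card (orb F) = (\<Sum>F'\<in>orb F. 1)" by simp
  also have "\<dots> = (\<Sum>h'\<in>orb h. \<Sum>F'\<in>{F' \<in> orb F. p \<circ> F' = h'}. 1)"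
    unfolding orbh by (rule sum.image_gen[OF fin])
  also have "\<dots> = card (orb h) * c" using fibre by simp
  finally have "real (card (orb F)) = c * card (orb h)" by simp
  with num \<open>c > 0\<close> show ?thesis by (simp add: mean_def h_def comp_def)
qed

text \<open>The orbits of \<open>f\<close>, \<open>g\<close> and their sum may have different sizes.
  All three are images of the orbit of the pair, and averages taken there are visibly
  additive.\<close>

lemma mean_add:
  assumes "finite (orb f)" "finite (orb g)"
  shows "mean y (\<lambda>y. f y + g y) = mean y f + mean y g"
proof -
  let ?F = "\<lambda>y. (f y, g y)"
  have "mean y (\<lambda>y. (\<lambda>(a, b). a + b) (?F y)) = mean y (\<lambda>y. fst (?F y)) + mean y (\<lambda>y. snd (?F y))"
    unfolding mean_lift[OF orb_pair_finite[OF assms]]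
    by (simp add: sum.distrib add_divide_distrib case_prod_beta)
  then show ?thesis by simp
qed

lemma mean_scale: "finite (orb f) \<Longrightarrow> mean y (\<lambda>y. c * f y) = c * mean y f"
  using mean_lift[of f y "\<lambda>a. c * a"] by (simp add: mean_def sum_distrib_left)

lemma mean_comp: "s \<in> S \<Longrightarrow> mean y (h \<circ> s) = mean y h"
  by (simp add: mean_def orb_comp)

text \<open>A function belongs to its own orbit, and squares cannot cancel.\<close>

lemma mean_square_eq_0:
  assumes "finite (orb f)" "mean y (\<lambda>y. f y * f y) = 0"
  shows "f y = 0"
proof -
  have "(\<Sum>f'\<in>orb f. f' y * f' y) = 0"
    using assms orb_self[of f] by (auto simp: mean_lift[of f y "\<lambda>a. a * a"])
  then have "\<forall>f'\<in>orb f. f' y * f' y = 0"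
    using assms(1) by (subst (asm) sum_nonneg_eq_0_iff) auto
  then show ?thesis using orb_self[of f] by auto
qed

section \<open>Invariant forms and the two complementary subspaces\<close>

text \<open>Values are real and positivity is not demanded. The class thus contains the integral
  inner product as well as the average at each single point.\<close>

definition invariant_form :: "(('b \<Rightarrow> real) \<Rightarrow> ('b \<Rightarrow> real) \<Rightarrow> real) \<Rightarrow> bool" where
  "invariant_form B \<longleftrightarrow>
     (\<forall>f\<in>V. \<forall>g\<in>V. B f g = B g f) \<and>
     (\<forall>f\<in>V. \<forall>g\<in>V. \<forall>h\<in>V. B (f + g) h = B f h + B g h) \<and>
     (\<forall>q. \<forall>f\<in>V. \<forall>h\<in>V. B (rat_scale q f) h = of_rat q * B f h) \<and>
     (\<forall>s\<in>S. \<forall>f\<in>V. \<forall>h\<in>V. B (f \<circ> s) (h \<circ> s) = B f h)"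

lemma V_orb: "f \<in> V \<Longrightarrow> finite (orb f)"
  using V_orbit by (simp add: orb_def)

lemmas V_zero = rat_fun.subspace_0[OF V_subspace]
  and V_add = rat_fun.subspace_add[OF V_subspace]
  and V_scale = rat_fun.subspace_scale[OF V_subspace]
  and V_diff = rat_fun.subspace_diff[OF V_subspace]
  and V_sum = rat_fun.subspace_sum[OF V_subspace]

lemma orb_mult_finite: "f \<in> V \<Longrightarrow> g \<in> V \<Longrightarrow> finite (orb (\<lambda>y. f y * g y))"
  using orb_map[of "\<lambda>(a, b). a * b" "\<lambda>y. (f y, g y)"] orb_pair_finite[of f g] V_orb by simp

text \<open>These pointwise forms are separately only semidefinite, but together they detect every
  nonzero function; this is what makes the projections unique.\<close>

lemma invariant_form_mean: "invariant_form (\<lambda>f g. mean y (\<lambda>y. f y * g y))"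
  unfolding invariant_form_def
proof (intro conjI ballI allI)
  fix f g h assume V: "f \<in> V" "g \<in> V" "h \<in> V"
  have "mean y (\<lambda>y. f y * h y + g y * h y) = mean y (\<lambda>y. f y * h y) + mean y (\<lambda>y. g y * h y)"
    by (intro mean_add orb_mult_finite V)
  then show "mean y (\<lambda>y. (f + g) y * h y) = mean y (\<lambda>y. f y * h y) + mean y (\<lambda>y. g y * h y)"
    by (simp add: algebra_simps)
next
  fix q f h assume V: "f \<in> V" "h \<in> V"
  show "mean y (\<lambda>y. rat_scale q f y * h y) = of_rat q * mean y (\<lambda>y. f y * h y)"
    using mean_scale[OF orb_mult_finite[OF V], of y "of_rat q"] by (simp add: rat_scale_eq mult.assoc)
next
  fix s f h assume "s \<in> S" "f \<in> V" "h \<in> V"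
  then show "mean y (\<lambda>y. (f \<circ> s) y * (h \<circ> s) y) = mean y (\<lambda>y. f y * h y)"
    using mean_comp[of s y "\<lambda>y. f y * h y"] by (simp add: comp_def)
qed (simp add: mult.commute)

lemma form_scale_right:
  "invariant_form B \<Longrightarrow> f \<in> V \<Longrightarrow> g \<in> V \<Longrightarrow> B f (rat_scale q g) = of_rat q * B f g"
  unfolding invariant_form_def using V_scale by metis

lemma form_add_right:
  "invariant_form B \<Longrightarrow> f \<in> V \<Longrightarrow> g \<in> V \<Longrightarrow> h \<in> V \<Longrightarrow> B h (f + g) = B h f + B h g"
  unfolding invariant_form_def using V_add by metis

lemma form_zero: 
  assumes "invariant_form B" "h \<in> V" shows "B 0 h = 0"
proof -
  have "B (0 + 0) h = B 0 h + B 0 h"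
    using assms V_zero unfolding invariant_form_def by blast
  then show ?thesis by simp
qed

lemma form_sum:
  assumes "invariant_form B" "h \<in> V" "\<And>x. x \<in> Z \<Longrightarrow> f x \<in> V"
  shows "B (\<Sum>x\<in>Z. rat_scale (d x) (f x)) h = (\<Sum>x\<in>Z. of_rat (d x) * B (f x) h)"
  using assms(3)
proof (induction Z rule: infinite_finite_induct)
  case (insert x Z)
  have "(\<Sum>x\<in>Z. rat_scale (d x) (f x)) \<in> V" "rat_scale (d x) (f x) \<in> V"
    using insert.prems by (auto intro!: V_sum V_scale)
  then have "B (rat_scale (d x) (f x) + (\<Sum>x\<in>Z. rat_scale (d x) (f x))) h
      = B (rat_scale (d x) (f x)) h + B (\<Sum>x\<in>Z. rat_scale (d x) (f x)) h"
    using assms(1,2) unfolding invariant_form_def by blast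
  moreover have "B (rat_scale (d x) (f x)) h = of_rat (d x) * B (f x) h"
    using assms(1,2) insert.prems unfolding invariant_form_def by blast
  moreover have "B (\<Sum>x\<in>Z. rat_scale (d x) (f x)) h = (\<Sum>x\<in>Z. of_rat (d x) * B (f x) h)"
    by (rule insert.IH) (use insert.prems in blast)
  ultimately show ?case
    unfolding sum.insert[OF insert.hyps] by (simp only:)
qed (simp_all only: sum.infinite sum.empty not_False_eq_True form_zero[OF assms(1,2)])

definition small :: "nat \<Rightarrow> ('b \<Rightarrow> real) set" where
  "small n = {f \<in> V. card (orb f) \<le> n}"

definition low :: "nat \<Rightarrow> ('b \<Rightarrow> real) set" where
  "low n = rat_fun.span (small n)"

text \<open>Orthogonality is required for all invariant forms at once, so the complement of
  \<open>low n\<close> does not depend on a chosen inner product.\<close>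

definition high :: "nat \<Rightarrow> ('b \<Rightarrow> real) set" where
  "high n = {f \<in> V. \<forall>B g. invariant_form B \<longrightarrow> g \<in> small n \<longrightarrow> B f g = 0}"

lemma low_subset: "low n \<subseteq> V"
  unfolding low_def by (rule rat_fun.span_minimal[OF _ V_subspace]) (auto simp: small_def)

lemma low_subspace: "rat_fun.subspace (low n)"
  by (simp add: low_def)

lemma high_subspace: "rat_fun.subspace (high n)"
proof (rule rat_fun.subspaceI)
  show "0 \<in> high n" using V_zero form_zero by (auto simp: high_def small_def)
  show "f + g \<in> high n" if "f \<in> high n" "g \<in> high n" for f g
  proof -
    have "B (f + g) h = B f h + B g h" if "invariant_form B" "h \<in> small n" for B h
      using that \<open>f \<in> high n\<close> \<open>g \<in> high n\<close> unfolding invariant_form_def high_def small_def by blast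
    then show ?thesis using that V_add unfolding high_def by fastforce
  qed
  show "rat_scale q f \<in> high n" if "f \<in> high n" for q f
  proof -
    have "B (rat_scale q f) h = of_rat q * B f h" if "invariant_form B" "h \<in> small n" for B h
      using that \<open>f \<in> high n\<close> unfolding invariant_form_def high_def small_def by blast
    then show ?thesis using that V_scale unfolding high_def by fastforce
  qed
qed

lemma high_low_orthogonal:
  assumes B: "invariant_form B" and f: "f \<in> high n" and g: "g \<in> low n"
  shows "B f g = 0"
proof -
  have fV: "f \<in> V" using f by (simp add: high_def)
  have "g \<in> V \<and> B f g = 0"
    using g unfolding low_def
  proof (induction rule: rat_fun.span_induct_alt)
    case base
    then show ?case
      using form_zero[OF B fV] B V_zero fV unfolding invariant_form_def by metis
  next
    case (step q x y)
    then have "x \<in> V" "B f x = 0" using f B by (auto simp: small_def high_def)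
    then show ?case
      using step form_scale_right[OF B fV] form_add_right[OF B _ _ fV] V_add V_scale
      by (metis add_0 mult_zero_right)
  qed
  then show ?thesis by simp
qed

text \<open>Such an \<open>f\<close> is orthogonal to itself for the average at every point
  \<open>y\<close>, so the orbit average of its square vanishes there.\<close>

lemma low_high_trivial:
  assumes "f \<in> low n" "f \<in> high n"
  shows "f = 0"
proof
  fix y
  have "mean y (\<lambda>y. f y * f y) = 0"
    using high_low_orthogonal[OF invariant_form_mean assms(2,1)] .
  then show "f y = 0 y"
    using mean_square_eq_0 V_orb assms(2) by (simp add: high_def)
qed

text \<open>On the permutation module of the finite orbit \<open>Z\<close> of \<open>f\<close>, subtract from \<open>f\<close> its rational
  orthogonal projection to the span of the indicators of those subsets of \<open>Z\<close> that have at most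
  \<open>n\<close> translates. For \<open>g \<in> small n\<close> the function \<open>x \<mapsto> B x g\<close> is constant on the orbits of the
  stabilizer of \<open>g\<close>, and these orbits have at most \<open>n\<close> translates.\<close>

lemma low_high_decomposition:
  assumes f: "f \<in> V"
  shows "\<exists>u\<in>low n. f - u \<in> high n"
proof -
  define Z where "Z = orb f"
  have finZ: "finite Z" using V_orb f by (simp add: Z_def)
  have ZV: "Z \<subseteq> V" using V_comp f by (auto simp: Z_def orb_def)
  have Z_closed: "x \<circ> s \<in> Z" if "x \<in> Z" "s \<in> S" for x s
    using orb_closed that by (simp add: Z_def)
  \<comment> \<open>The bound on translates is the counterpart, for subsets of \<open>Z\<close>, of
    the bound on the orbit in \<open>small n\<close>.\<close>
  define A where "A = {P. P \<subseteq> Z \<and> card ((\<lambda>s. (\<lambda>x. x \<circ> s) ` P) ` S) \<le> n}"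
  have finA: "finite A" using finZ by (simp add: A_def)
  define c where "c = (\<lambda>x. if x = f then 1 else 0 :: rat)"
  obtain a where a: "\<forall>P\<in>A. (\<Sum>x\<in>Z. of_bool (x \<in> P) * (c x - (\<Sum>Q\<in>A. a Q * of_bool (x \<in> Q)))) = 0"
    using rational_orthogonal_projection[OF finZ finA, of "\<lambda>P x. of_bool (x \<in> P)" c] by blast
  define d where "d = (\<lambda>x. c x - (\<Sum>Q\<in>A. a Q * of_bool (x \<in> Q)))"
  have dsum: "(\<Sum>x\<in>P. d x) = 0" if "P \<in> A" for P
  proof -
    have "(\<Sum>x\<in>P. d x) = (\<Sum>x\<in>Z. of_bool (x \<in> P) * d x)"
      using that finZ by (intro sum.mono_neutral_cong_left) (auto simp: A_def)
    then show ?thesis using a that by (simp add: d_def)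
  qed
  \<comment> \<open>The image of the projection under the linear map to \<open>V\<close> that sends
    the point mass at \<open>x\<close> to the function \<open>x\<close> itself. The point mass at
    \<open>f\<close> goes to \<open>f\<close>.\<close>
  define u where "u = (\<Sum>Q\<in>A. rat_scale (a Q) (\<Sum>x\<in>Q. x))"
  have small: "(\<Sum>x\<in>Q. x) \<in> small n" if Q: "Q \<in> A" for Q
  proof -
    \<comment> \<open>Translating the sum over \<open>Q\<close> gives the sum over the translate of
      \<open>Q\<close>, so the sum has at most as many translates as the subset.\<close>
    have "(\<Sum>x\<in>Q. x) \<circ> s = (\<Sum>x\<in>(\<lambda>x. x \<circ> s) ` Q. x)" if "s \<in> S" for s
    proof -
      have "inj_on (\<lambda>x. x \<circ> s) Q" by (rule inj_onI) (use comp_cancel that in blast)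
      then show ?thesis by (simp add: sum_fun_comp sum.reindex)
    qed
    then have "orb (\<Sum>x\<in>Q. x) = (\<lambda>R. \<Sum>x\<in>R. x) ` ((\<lambda>s. (\<lambda>x. x \<circ> s) ` Q) ` S)"
      by (simp add: orb_def image_image)
    moreover have "finite ((\<lambda>s. (\<lambda>x. x \<circ> s) ` Q) ` S)"
      by (rule finite_subset[of _ "Pow Z"]) (use Q Z_closed finZ in \<open>auto simp: A_def\<close>)
    ultimately have "card (orb (\<Sum>x\<in>Q. x)) \<le> card ((\<lambda>s. (\<lambda>x. x \<circ> s) ` Q) ` S)"
      by (metis card_image_le)
    moreover have "(\<Sum>x\<in>Q. x) \<in> V" using Q ZV by (intro V_sum) (auto simp: A_def)
    ultimately show ?thesis using Q by (simp add: small_def A_def)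
  qed
  have u: "u \<in> low n"
    unfolding u_def low_def
    by (intro rat_fun.span_sum rat_fun.span_scale rat_fun.span_base small)
  have fu: "f - u = (\<Sum>x\<in>Z. rat_scale (d x) x)"
  proof (rule ext)
    fix y
    have "u y = (\<Sum>Q\<in>A. \<Sum>x\<in>Z. of_rat (a Q) * (of_bool (x \<in> Q) * x y))"
    proof -
      have "(\<Sum>x\<in>Q. x y) = (\<Sum>x\<in>Z. of_bool (x \<in> Q) * x y)" if "Q \<in> A" for Q
        using finZ that by (intro sum.mono_neutral_cong_left) (auto simp: A_def)
      then show ?thesis
        by (simp add: u_def sum_fun_apply rat_scale_eq flip: sum_distrib_left)
    qed
    also have "\<dots> = (\<Sum>x\<in>Z. of_rat (\<Sum>Q\<in>A. a Q * of_bool (x \<in> Q)) * x y)"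
      by (subst sum.swap)
        (intro sum.cong refl, simp add: of_rat_sum of_rat_mult sum_distrib_right mult.assoc of_bool_def,
          auto intro!: sum.cong)
    finally have uy: "u y = (\<Sum>x\<in>Z. of_rat (\<Sum>Q\<in>A. a Q * of_bool (x \<in> Q)) * x y)" .
    have "f y = (\<Sum>x\<in>Z. of_rat (c x) * x y)"
      using finZ orb_self[of f] by (simp add: c_def Z_def if_distrib if_distribR cong: if_cong)
    with uy show "(f - u) y = (\<Sum>x\<in>Z. rat_scale (d x) x) y"
      by (simp add: sum_fun_apply rat_scale_eq d_def of_rat_diff algebra_simps sum_subtractf)
  qed
  have "B (f - u) g = 0" if B: "invariant_form B" and g: "g \<in> small n" for B g
  proof -
    have gV: "g \<in> V" using g by (simp add: small_def)
    \<comment> \<open>The stabilizer of \<open>g\<close>; \<open>O' x\<close> is the orbit of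
      \<open>x\<close> under it, and these orbits partition \<open>Z\<close>.\<close>
    define Hs where "Hs = {s \<in> S. g \<circ> s = g}"
    define O' where "O' = (\<lambda>x :: 'b \<Rightarrow> real. (\<lambda>s. x \<circ> s) ` Hs)"
    have Hs_comp: "s \<circ> t \<in> Hs" if "s \<in> Hs" "t \<in> Hs" for s t
      using that comp_mem by (auto simp: Hs_def simp flip: comp_assoc)
    have Hs_inv: "\<exists>t\<in>Hs. s \<circ> t = id \<and> t \<circ> s = id" if s: "s \<in> Hs" for s
    proof -
      obtain t where t: "t \<in> S" "s \<circ> t = id \<and> t \<circ> s = id" using inv_mem s by (auto simp: Hs_def)
      then have "g \<circ> t = g" using s by (metis (mono_tags, lifting) Hs_def comp_assoc comp_id mem_Collect_eq)
      with t show ?thesis by (auto simp: Hs_def)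
    qed
    have O'_eq: "O' (x \<circ> s) = O' x" if s: "s \<in> Hs" for x s
    proof -
      obtain t where t: "t \<in> Hs" "s \<circ> t = id" using Hs_inv s by blast
      have "x \<circ> r \<in> O' (x \<circ> s)" if "r \<in> Hs" for r
      proof -
        have "x \<circ> r = x \<circ> s \<circ> (t \<circ> r)" using t by (metis comp_assoc id_comp)
        then show ?thesis using Hs_comp t(1) that unfolding O'_def by blast
      qed
      then show ?thesis using Hs_comp s by (auto simp: O'_def comp_assoc)
    qed
    have O'_self: "x \<in> O' x" for x
      unfolding O'_def using id_mem by (intro image_eqI[of _ _ id]) (auto simp: Hs_def)
    have fibre: "{x \<in> Z. O' x = O' z} = O' z" if "z \<in> Z" for z
    proof
      show "{x \<in> Z. O' x = O' z} \<subseteq> O' z" using O'_self by blast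
      show "O' z \<subseteq> {x \<in> Z. O' x = O' z}"
      proof
        fix x assume "x \<in> O' z"
        then obtain s where "s \<in> Hs" "x = z \<circ> s" unfolding O'_def by blast
        then show "x \<in> {x \<in> Z. O' x = O' z}"
          using that O'_eq Z_closed by (simp add: Hs_def)
      qed
    qed
    \<comment> \<open>The translate of \<open>O' z\<close> by \<open>s\<close> depends only on
      \<open>g \<circ> s\<close>, because two such \<open>s\<close> differ by an element of the
      stabilizer. Hence \<open>O' z\<close> has no more translates than \<open>g\<close>.\<close>
    have O'A: "O' z \<in> A" if "z \<in> Z" for z
    proof -
      have "(\<lambda>x. x \<circ> s) ` O' z = (\<lambda>x. x \<circ> t) ` O' z" if st: "s \<in> S" "t \<in> S" "g \<circ> s = g \<circ> t" for s t
      proof -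
        have sub: "(\<lambda>x. x \<circ> s) ` O' z \<subseteq> (\<lambda>x. x \<circ> t) ` O' z"
          if st: "s \<in> S" "t \<in> S" "g \<circ> s = g \<circ> t" for s t
        proof -
          obtain r where r: "r \<in> S" "t \<circ> r = id" "r \<circ> t = id" using inv_mem st by blast
          have "g \<circ> (s \<circ> r) = g" using st r by (metis comp_assoc comp_id)
          then have sr: "s \<circ> r \<in> Hs" using comp_mem st r by (simp add: Hs_def)
          have "z \<circ> h \<circ> s = z \<circ> (h \<circ> (s \<circ> r)) \<circ> t" for h
            using r by (simp add: comp_assoc)
          then show ?thesis using Hs_comp[OF _ sr] by (auto simp: O'_def image_image)
        qed
        show ?thesis using sub[OF st] sub[of t s] st by auto
      qed
      then have "card ((\<lambda>s. (\<lambda>x. x \<circ> s) ` O' z) ` S) \<le> card ((\<lambda>s. g \<circ> s) ` S)"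
        by (rule card_image_le_if_factors[OF V_orbit[OF gV]])
      moreover have "O' z \<subseteq> Z" using that Z_closed by (auto simp: O'_def Hs_def)
      ultimately show ?thesis using g by (simp add: A_def small_def orb_def)
    qed
    have "B (f - u) g = (\<Sum>x\<in>Z. of_rat (d x) * B x g)"
      unfolding fu by (rule form_sum[OF B gV]) (use ZV in auto)
    \<comment> \<open>Grouping by stabilizer orbits: \<open>B x g\<close> is constant on each of
      them, since moving \<open>x\<close> by an element that fixes \<open>g\<close> does not change
      the form, and the coefficients \<open>d\<close> sum to zero there by
      \<open>dsum\<close>.\<close>
    also have "\<dots> = (\<Sum>P\<in>O' ` Z. \<Sum>x\<in>{x \<in> Z. O' x = P}. of_rat (d x) * B x g)"
      by (rule sum.image_gen[OF finZ])
    also have "\<dots> = 0"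
    proof (rule sum.neutral, rule ballI)
      fix P assume "P \<in> O' ` Z"
      then obtain z where z: "z \<in> Z" "P = O' z" by blast
      have "B x g = B z g" if x: "x \<in> O' z" for x
      proof -
        obtain s where "s \<in> S" "g \<circ> s = g" "x = z \<circ> s" using x by (auto simp: O'_def Hs_def)
        then show ?thesis using B z ZV gV unfolding invariant_form_def by (metis subsetD)
      qed
      then have "(\<Sum>x\<in>{x \<in> Z. O' x = P}. of_rat (d x) * B x g) = (\<Sum>x\<in>O' z. of_rat (d x) * B z g)"
        unfolding z(2) fibre[OF z(1)] by (intro sum.cong) auto
      also have "\<dots> = of_rat (\<Sum>x\<in>O' z. d x) * B z g"
        by (simp add: of_rat_sum sum_distrib_right)
      finally show "(\<Sum>x\<in>{x \<in> Z. O' x = P}. of_rat (d x) * B x g) = 0"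
        using dsum[OF O'A[OF z(1)]] by simp
    qed
    finally show ?thesis .
  qed
  moreover have "f - u \<in> V" using f u low_subset V_diff by blast
  ultimately show ?thesis using u by (auto simp: high_def)
qed

section \<open>Projections onto the filtration\<close>

definition proj :: "nat \<Rightarrow> ('b \<Rightarrow> real) \<Rightarrow> 'b \<Rightarrow> real" where
  "proj n f = (SOME u. u \<in> low n \<and> f - u \<in> high n)"

lemma proj:
  assumes "f \<in> V" shows "proj n f \<in> low n" "f - proj n f \<in> high n"
proof -
  have "\<exists>u. u \<in> low n \<and> f - u \<in> high n" using low_high_decomposition[OF assms] by blast
  then have "proj n f \<in> low n \<and> f - proj n f \<in> high n" unfolding proj_def by (rule someI_ex)
  then show "proj n f \<in> low n" "f - proj n f \<in> high n" by blast+
qed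

text \<open>Two decompositions differ by an element of both \<open>low n\<close> and
  \<open>high n\<close>, hence by zero. The algebraic rules for \<open>proj\<close> follow by
  exhibiting decompositions.\<close>

lemma proj_unique:
  assumes "u \<in> low n" "f - u \<in> high n"
  shows "proj n f = u"
proof -
  have f: "f \<in> V" using assms low_subset V_add[of u "f - u"] by (simp add: high_def subset_iff)
  have "u - proj n f = 0"
  proof (rule low_high_trivial)
    show "u - proj n f \<in> low n" by (intro rat_fun.subspace_diff[OF low_subspace] assms proj f)
    have "(f - proj n f) - (f - u) \<in> high n"
      by (intro rat_fun.subspace_diff[OF high_subspace] assms proj f)
    then show "u - proj n f \<in> high n" by simp
  qed
  then show ?thesis by simp
qed

lemma proj_add: "f \<in> V \<Longrightarrow> g \<in> V \<Longrightarrow> proj n (f + g) = proj n f + proj n g"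
proof (rule proj_unique)
  assume V: "f \<in> V" "g \<in> V"
  show "proj n f + proj n g \<in> low n"
    by (intro rat_fun.subspace_add[OF low_subspace] proj V)
  have "(f - proj n f) + (g - proj n g) \<in> high n"
    by (intro rat_fun.subspace_add[OF high_subspace] proj V)
  then show "f + g - (proj n f + proj n g) \<in> high n" by (simp add: algebra_simps)
qed

lemma proj_scale: "f \<in> V \<Longrightarrow> proj n (rat_scale q f) = rat_scale q (proj n f)"
proof (rule proj_unique)
  assume V: "f \<in> V"
  show "rat_scale q (proj n f) \<in> low n"
    by (intro rat_fun.subspace_scale[OF low_subspace] proj V)
  have "rat_scale q (f - proj n f) \<in> high n"
    by (intro rat_fun.subspace_scale[OF high_subspace] proj V)
  then show "rat_scale q f - rat_scale q (proj n f) \<in> high n"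
    by (simp add: rat_fun.scale_right_diff_distrib)
qed

lemma low_mono: "m \<le> n \<Longrightarrow> low m \<subseteq> low n"
  unfolding low_def by (rule rat_fun.span_mono) (auto simp: small_def)

lemma high_mono: "m \<le> n \<Longrightarrow> high n \<subseteq> high m"
  by (auto simp: high_def small_def)

lemma proj_low: "f \<in> low n \<Longrightarrow> proj n f = f"
  by (rule proj_unique) (use high_subspace rat_fun.subspace_0 in \<open>auto simp: fun_eq_iff\<close>)

lemma proj_high: "f \<in> high n \<Longrightarrow> proj n f = 0"
  by (rule proj_unique) (use rat_fun.subspace_0[OF low_subspace] in auto)

lemma proj_V: "f \<in> V \<Longrightarrow> proj n f \<in> V"
  using proj(1) low_subset by blast

lemma proj_diff: "f \<in> V \<Longrightarrow> g \<in> V \<Longrightarrow> proj n (f - g) = proj n f - proj n g"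
  using proj_add[of "f - g" g n] V_diff by (simp add: algebra_simps)

text \<open>With growing index \<open>low\<close> increases and \<open>high\<close> decreases. For
  \<open>m \<le> n\<close> the remainder \<open>f - proj n f\<close> is still in
  \<open>high m\<close> and is killed by \<open>proj m\<close>; for \<open>m > n\<close> the value
  \<open>proj n f\<close> already lies in \<open>low m\<close>.\<close>

lemma proj_proj: "f \<in> V \<Longrightarrow> proj m (proj n f) = proj (min m n) f"
proof (cases "m \<le> n")
  case True
  assume f: "f \<in> V"
  have "proj m (f - proj n f) = 0" using proj_high proj(2)[OF f] high_mono[OF True] by blast
  then show ?thesis using True f proj_diff proj_V by (simp add: min_def)
next
  case False
  assume f: "f \<in> V"
  have "proj n f \<in> low m" using proj(1)[OF f] low_mono[of n m] False by auto
  then show ?thesis using False by (simp add: proj_low min_def)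
qed

text \<open>Every function lies in its own finite orbit, so \<open>small 0\<close> is empty and
  spans only zero. This anchors the telescoping sum of the layers.\<close>

lemma proj_0: "f \<in> V \<Longrightarrow> proj 0 f = 0"
proof -
  assume f: "f \<in> V"
  have "small 0 = {}"
    using V_orb orb_self by (fastforce simp: small_def)
  then show ?thesis using proj(1)[OF f, of 0] by (simp add: low_def)
qed

section \<open>Layers as differences of consecutive projections\<close>

definition layer :: "nat \<Rightarrow> ('b \<Rightarrow> real) \<Rightarrow> 'b \<Rightarrow> real" where
  "layer n f = proj n f - proj (n - 1) f"

lemma layer_V: "f \<in> V \<Longrightarrow> layer n f \<in> V"
  by (simp add: layer_def V_diff proj_V)

lemma layer_low: "f \<in> V \<Longrightarrow> layer n f \<in> low n"
  unfolding layer_def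
  by (rule rat_fun.subspace_diff[OF low_subspace])
    (use proj(1)[of f n] proj(1)[of f "n - 1"] low_mono[of "n - 1" n] in auto)

text \<open>Both remainders, at \<open>n - 1\<close> and at \<open>n\<close>, lie in
  \<open>high m\<close> because \<open>m \<le> n - 1\<close>, and the layer is their difference.
  Together with \<open>layer_low\<close> this gives orthogonality of different layers.\<close>

lemma layer_high:
  assumes "f \<in> V" "m < n" shows "layer n f \<in> high m"
proof -
  have "f - proj k f \<in> high m" if "m \<le> k" for k
    using proj(2)[OF assms(1)] high_mono[OF that] by blast
  then have "f - proj (n - 1) f \<in> high m" "f - proj n f \<in> high m"
    using assms(2) by simp_all
  then have "(f - proj (n - 1) f) - (f - proj n f) \<in> high m"
    by (rule rat_fun.subspace_diff[OF high_subspace])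
  then show ?thesis by (simp add: layer_def)
qed

lemma layer_layer:
  assumes "f \<in> V" "n \<ge> 1" "m \<ge> 1"
  shows "layer m (layer n f) = (if m = n then layer n f else 0)"
proof -
  have *: "proj k (layer n f) = proj (min k n) f - proj (min k (n - 1)) f" for k
    using assms by (simp add: layer_def proj_diff proj_V proj_proj)
  consider "m = n" | "m < n" | "m > n" by linarith
  then show ?thesis
  proof cases
    case 1
    have "layer n (layer n f) = proj n (layer n f) - proj (n - 1) (layer n f)"
      by (simp only: layer_def[of n "layer n f"])
    also have "\<dots> = layer n f"
      unfolding * using 1 assms(3) by (simp add: layer_def min.absorb1 min.absorb2)
    finally show ?thesis using 1 by simp
  next
    case 2
    then have "min m n = m" "min m (n - 1) = m" "min (m - 1) n = m - 1" "min (m - 1) (n - 1) = m - 1"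
      by auto
    then show ?thesis using 2 by (simp add: layer_def[of m "layer n f"] *)
  next
    case 3
    then have "min m n = n" "min m (n - 1) = n - 1" "min (m - 1) n = n" "min (m - 1) (n - 1) = n - 1"
      by auto
    then show ?thesis using 3 by (simp add: layer_def[of m "layer n f"] *)
  qed
qed

lemma rat_linear_layer: "rat_linear_on V (layer n)"
  unfolding rat_linear_on_def
proof (intro conjI ballI allI)
  fix f g assume V: "f \<in> V" "g \<in> V"
  show "layer n (f + g) = layer n f + layer n g"
    unfolding layer_def proj_add[OF V] by (rule add_diff_add)
next
  fix q f assume V: "f \<in> V"
  show "layer n (rat_scale q f) = rat_scale q (layer n f)"
    unfolding layer_def proj_scale[OF V] rat_fun.scale_right_diff_distrib ..
qed

lemma rat_linear_sum:
  assumes "rat_linear_on V T" "\<And>i. i \<in> J \<Longrightarrow> w i \<in> V"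
  shows "T (\<Sum>i\<in>J. w i) = (\<Sum>i\<in>J. T (w i))"
proof -
  have T0: "T 0 = 0"
  proof -
    have "T (0 + 0) = T 0 + T 0" using assms(1) V_zero unfolding rat_linear_on_def by blast
    then show ?thesis by simp
  qed
  show ?thesis using assms(2)
  proof (induction J rule: infinite_finite_induct)
    case (insert i J)
    have "w i \<in> V" "(\<Sum>i\<in>J. w i) \<in> V"
      using insert.prems by (auto intro!: V_sum)
    then have "T (w i + (\<Sum>i\<in>J. w i)) = T (w i) + T (\<Sum>i\<in>J. w i)"
      using assms(1) unfolding rat_linear_on_def by blast
    moreover have "T (\<Sum>i\<in>J. w i) = (\<Sum>i\<in>J. T (w i))"
      by (rule insert.IH) (use insert.prems in blast)
    ultimately show ?case unfolding sum.insert[OF insert.hyps] by (simp only:)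
  qed (use T0 in \<open>simp_all\<close>)
qed

lemma layer_orthogonal:
  assumes "invariant_form B" "m \<noteq> n" "f \<in> V" "g \<in> V"
  shows "B (layer m f) (layer n g) = 0"
proof (cases "m < n")
  case True
  then have "B (layer n g) (layer m f) = 0"
    using high_low_orthogonal assms layer_low layer_high by blast
  then show ?thesis using assms layer_V unfolding invariant_form_def by metis
next
  case False
  then show ?thesis
    using high_low_orthogonal assms layer_low layer_high by (metis linorder_neqE_nat)
qed

lemma layer_direct_sum: "internal_direct_sum V {1..} (\<lambda>n. layer n ` V)"
  unfolding internal_direct_sum_def
proof (intro conjI ballI allI impI)
  fix n :: nat
  show "rat_fun.subspace (layer n ` V)"
  proof (rule rat_fun.subspaceI)
    show "0 \<in> layer n ` V"
      using rat_linear_sum[OF rat_linear_layer, of "{}" "\<lambda>_. 0" n] V_zero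
      by (intro image_eqI[of _ _ 0]) simp_all
    show "f + g \<in> layer n ` V" if fg: "f \<in> layer n ` V" "g \<in> layer n ` V" for f g
    proof -
      obtain f' g' where "f' \<in> V" "g' \<in> V" "f = layer n f'" "g = layer n g'" using fg by blast
      then have "f + g = layer n (f' + g')" "f' + g' \<in> V"
        using rat_linear_layer[of n] V_add unfolding rat_linear_on_def by (simp_all only:)
      then show ?thesis by blast
    qed
    show "rat_scale q f \<in> layer n ` V" if f: "f \<in> layer n ` V" for q f
    proof -
      obtain f' where "f' \<in> V" "f = layer n f'" using f by blast
      then have "rat_scale q f = layer n (rat_scale q f')" "rat_scale q f' \<in> V"
        using rat_linear_layer[of n] V_scale unfolding rat_linear_on_def by (simp_all only:)
      then show ?thesis by blast
    qed
  qed
next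
  show "V = {\<Sum>i\<in>J. w i |J w. finite J \<and> J \<subseteq> {1..} \<and> (\<forall>i\<in>J. w i \<in> layer i ` V)}"
  proof (intro equalityI subsetI)
    fix f assume f: "f \<in> V"
    \<comment> \<open>Each \<open>f\<close> lies in the step of the filtration given by its own
      orbit size, so the telescoping sum stops there and the decomposition is finite.\<close>
    define n where "n = card (orb f)"
    have "f \<in> low n" unfolding low_def n_def using f by (intro rat_fun.span_base) (simp add: small_def)
    then have "proj n f = f" by (rule proj_low)
    moreover have "(\<Sum>i\<in>{1..n}. layer i f) = proj n f - proj 0 f" for n
      by (induction n) (auto simp: layer_def)
    ultimately have "f = (\<Sum>i\<in>{1..n}. layer i f)" using f by (simp add: proj_0)
    then show "f \<in> {\<Sum>i\<in>J. w i |J w. finite J \<and> J \<subseteq> {1..} \<and> (\<forall>i\<in>J. w i \<in> layer i ` V)}"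
      using f by (intro CollectI exI[of _ "{1..n}"] exI[of _ "\<lambda>i. layer i f"]) auto
  next
    fix f assume "f \<in> {\<Sum>i\<in>J. w i |J w. finite J \<and> J \<subseteq> {1..} \<and> (\<forall>i\<in>J. w i \<in> layer i ` V)}"
    then show "f \<in> V" using layer_V by (auto intro!: V_sum)
  qed
next
  fix J :: "nat set" and w :: "nat \<Rightarrow> 'b \<Rightarrow> real" and j
  assume J: "finite J" "J \<subseteq> {1..}" and w: "\<forall>i\<in>J. w i \<in> layer i ` V"
    and sum: "(\<Sum>i\<in>J. w i) = 0" and j: "j \<in> J"
  \<comment> \<open>Different layers annihilate each other, so applying \<open>layer j\<close> to
    the relation isolates the summand \<open>w j\<close>.\<close>
  have "layer j (w i) = (if i = j then w j else 0)" if "i \<in> J" for i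
    using w that j J(2) layer_layer[of _ i j] by (auto simp: subset_iff)
  then have "(\<Sum>i\<in>J. layer j (w i)) = (\<Sum>i\<in>J. if i = j then w j else 0)"
    by (intro sum.cong) auto
  then have "w j = (\<Sum>i\<in>J. layer j (w i))" using J(1) j by simp
  also have "\<dots> = layer j (\<Sum>i\<in>J. w i)"
    using w layer_V by (intro rat_linear_sum[OF rat_linear_layer, symmetric]) auto
  also have "\<dots> = 0"
    unfolding sum using rat_linear_sum[OF rat_linear_layer, of "{}" "\<lambda>_. 0" j] by simp
  finally show "w j = 0" .
qed

text \<open>The maps are chosen before the form: one family is orthogonal for every invariant
  \<open>B\<close>. The span is written out so that it can be compared with \<open>V_degree\<close>
  outside the locale.\<close>

lemma orthogonal_layers:
  "\<exists>T. (\<forall>n\<ge>1. T n ` V \<subseteq> V \<and> rat_linear_on V (T n) \<and> (\<forall>f\<in>V. T n (T n f) = T n f) \<and>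
           T n ` V \<subseteq> rat_fun.span {f \<in> V. card ((\<lambda>s. f \<circ> s) ` S) \<le> n}) \<and>
       (\<forall>m\<ge>1. \<forall>n\<ge>1. m \<noteq> n \<longrightarrow>
          (\<forall>f \<in> T m ` V. \<forall>g \<in> T n ` V. \<forall>B. invariant_form B \<longrightarrow> B f g = 0)) \<and>
       internal_direct_sum V {1..} (\<lambda>n. T n ` V)"
proof (intro exI[of _ layer] conjI allI impI ballI)
  fix n
  show "layer n ` V \<subseteq> V" using layer_V by blast
  show "layer n ` V \<subseteq> rat_fun.span {f \<in> V. card ((\<lambda>s. f \<circ> s) ` S) \<le> n}"
    using layer_low[of _ n] by (auto simp: low_def small_def orb_def)
  show "layer n (layer n f) = layer n f" if "1 \<le> n" "f \<in> V" for f
    using layer_layer[OF that(2,1,1)] by simp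
next
  fix m n :: nat and f g B assume "m \<noteq> n" "f \<in> layer m ` V" "g \<in> layer n ` V" "invariant_form B"
  then show "B f g = 0" using layer_orthogonal by blast
qed (use rat_linear_layer layer_direct_sum in blast)+

end

section \<open>Automorphisms of an algebraically closed field\<close>

definition field_automorphism :: "('a :: field \<Rightarrow> 'a) \<Rightarrow> bool" where
  "field_automorphism \<sigma> \<longleftrightarrow> bij \<sigma> \<and> (\<forall>x y. \<sigma> (x + y) = \<sigma> x + \<sigma> y) \<and> (\<forall>x y. \<sigma> (x * y) = \<sigma> x * \<sigma> y)"

section \<open>Partial homomorphisms and their extension to automorphisms\<close>

definition rational_poly :: "'a :: field_char_0 poly \<Rightarrow> bool" where
  "rational_poly p \<longleftrightarrow> (\<forall>i. coeff p i \<in> \<rat>)"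

text \<open>A ring homomorphism defined on a subring containing the rationals, given by its graph.\<close>

definition hom_graph :: "('a :: field_char_0 \<times> 'a) set \<Rightarrow> bool" where
  "hom_graph R \<longleftrightarrow>
     (\<forall>r\<in>\<rat>. (r, r) \<in> R) \<and>
     (\<forall>a b c d. (a, b) \<in> R \<longrightarrow> (c, d) \<in> R \<longrightarrow> (a + c, b + d) \<in> R \<and> (a * c, b * d) \<in> R) \<and>
     (\<forall>y. (0, y) \<in> R \<longrightarrow> y = 0)"

text \<open>The polynomial \<open>q\<close> is \<open>p\<close> with the partial homomorphism
  applied to its coefficients.\<close>

definition graph_poly :: "('a :: field_char_0 \<times> 'a) set \<Rightarrow> 'a poly \<Rightarrow> 'a poly \<Rightarrow> bool" where
  "graph_poly R p q \<longleftrightarrow> (\<forall>i. (coeff p i, coeff q i) \<in> R)"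

context
  fixes R :: "('a :: field_char_0 \<times> 'a) set"
  assumes R: "hom_graph R"
begin

lemma hg_rat: "r \<in> \<rat> \<Longrightarrow> (r, r) \<in> R"
  and hg_add: "(a, b) \<in> R \<Longrightarrow> (c, d) \<in> R \<Longrightarrow> (a + c, b + d) \<in> R"
  and hg_mult: "(a, b) \<in> R \<Longrightarrow> (c, d) \<in> R \<Longrightarrow> (a * c, b * d) \<in> R"
  and hg_zero: "(0, y) \<in> R \<Longrightarrow> y = 0"
  using R by (auto simp: hom_graph_def)

lemma hg_diff: "(a, b) \<in> R \<Longrightarrow> (c, d) \<in> R \<Longrightarrow> (a - c, b - d) \<in> R"
  using hg_add[of a b "-1 * c" "-1 * d"] hg_mult[of "-1" "-1" c d] hg_rat[of "-1"] by simp

lemma hg_unique: "(x, y) \<in> R \<Longrightarrow> (x, y') \<in> R \<Longrightarrow> y = y'"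
  using hg_diff[of x y x y'] hg_zero[of "y - y'"] by simp

lemma hg_sum: "(\<And>i. i \<in> I \<Longrightarrow> (f i, g i) \<in> R) \<Longrightarrow> (\<Sum>i\<in>I. f i, \<Sum>i\<in>I. g i) \<in> R"
  by (induction I rule: infinite_finite_induct) (auto intro!: hg_rat hg_add)

lemma hg_power: "(a, b) \<in> R \<Longrightarrow> (a ^ n, b ^ n) \<in> R"
  by (induction n) (auto intro!: hg_rat hg_mult)

lemma hg_poly_rat: 
  assumes "(a, b) \<in> R" "rational_poly h"
  shows "(poly h a, poly h b) \<in> R"
  unfolding poly_altdef
  by (intro hg_sum hg_mult hg_power hg_rat) (use assms in \<open>auto simp: rational_poly_def\<close>)

lemma gp_add: "graph_poly R p q \<Longrightarrow> graph_poly R r s \<Longrightarrow> graph_poly R (p + r) (q + s)"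
  by (simp add: graph_poly_def hg_add)

lemma gp_diff: "graph_poly R p q \<Longrightarrow> graph_poly R r s \<Longrightarrow> graph_poly R (p - r) (q - s)"
  by (simp add: graph_poly_def hg_diff)

lemma gp_mult: "graph_poly R p q \<Longrightarrow> graph_poly R r s \<Longrightarrow> graph_poly R (p * r) (q * s)"
  by (simp add: graph_poly_def coeff_mult hg_sum hg_mult)

lemma gp_monom: "(a, b) \<in> R \<Longrightarrow> graph_poly R (monom a n) (monom b n)"
  by (simp add: graph_poly_def hg_rat)

lemma gp_rat: "rational_poly p \<Longrightarrow> graph_poly R p p"
  by (simp add: graph_poly_def rational_poly_def hg_rat)

lemma gp_zero: "graph_poly R 0 q \<Longrightarrow> q = 0"
  by (intro poly_eqI) (simp add: graph_poly_def hg_zero)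

text \<open>The graph is single valued and relates 1 only to 1 and 0 only to 0. For a nonconstant
  monic \<open>p\<close> the transported polynomial is thus nonconstant and has a root to which a
  root of \<open>p\<close> can be sent.\<close>

lemma gp_monic:
  assumes pq: "graph_poly R p q" and p: "lead_coeff p = 1"
  shows "degree q = degree p" "lead_coeff q = 1"
proof -
  have 1: "coeff q (degree p) = 1"
    using pq p hg_unique[of 1 _ 1] hg_rat[of 1] by (metis Rats_1 graph_poly_def)
  have "coeff q i = 0" if "i > degree p" for i
    using pq that hg_zero by (metis graph_poly_def coeff_eq_0)
  then have "degree q \<le> degree p" by (intro degree_le) auto
  moreover have "degree q \<ge> degree p" using 1 by (intro le_degree) auto
  ultimately show "degree q = degree p" by simp
  with 1 show "lead_coeff q = 1" by simp
qed

text \<open>The long divisions by \<open>p\<close> and by \<open>q\<close> run in parallel, each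
  step subtracting related multiples. As \<open>p\<close> is monic, no inverse of a coefficient is
  taken, and the remainders stay related.\<close>

lemma gp_division:
  assumes pq: "graph_poly R p q" and p: "lead_coeff p = 1" "degree p > 0"
    and "graph_poly R f g"
  shows "\<exists>s t r u. graph_poly R r u \<and> f = p * s + r \<and> g = q * t + u \<and> degree r < degree p"
  using assms(4)
proof (induction "degree f" arbitrary: f g rule: less_induct)
  case less
  show ?case
  proof (cases "degree f < degree p")
    case True
    then show ?thesis using less.prems by (intro exI[of _ 0] exI[of _ f] exI[of _ g]) auto
  next
    case False
    define m where "m = degree f - degree p"
    \<comment> \<open>The second monomial uses the coefficient of \<open>g\<close> at the degree of
      \<open>f\<close>: this is the one related to \<open>lead_coeff f\<close>, whatever the degree
      of \<open>g\<close> is.\<close>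
    define a b where "a = monom (lead_coeff f) m" and "b = monom (coeff g (degree f)) m"
    have ab: "graph_poly R a b"
      unfolding a_def b_def using less.prems by (intro gp_monom) (simp add: graph_poly_def)
    have "f - p * a = 0 \<or> degree (f - p * a) < degree f"
    proof (rule eq_zero_or_degree_less)
      have "degree (p * a) \<le> degree p + m"
        by (intro order.trans[OF degree_mult_le]) (simp add: a_def b_def degree_monom_le)
      then show "degree (f - p * a) \<le> degree f"
        using False by (intro degree_diff_le) (auto simp: m_def)
      have "coeff (p * a) (degree f) = lead_coeff f"
        using False p by (simp add: a_def b_def m_def mult.commute[of p] coeff_monom_mult)
      then show "coeff (f - p * a) (degree f) = 0" by simp
    qed
    then have "degree (f - p * a) < degree f" using False p by auto
    from less.hyps[OF this gp_diff[OF less.prems gp_mult[OF pq ab]]]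
    obtain s t r u where
      *: "graph_poly R r u" "f - p * a = p * s + r" "g - q * b = q * t + u" "degree r < degree p"
      by blast
    then show ?thesis
      by (intro exI[of _ "a + s"] exI[of _ "b + t"] exI[of _ r] exI[of _ u])
        (auto simp: algebra_simps)
  qed
qed

text \<open>The new graph evaluates related polynomials at \<open>\<gamma>\<close> and
  \<open>\<delta>\<close>. It is single valued because, if \<open>f\<close> vanishes at
  \<open>\<gamma>\<close>, so does its remainder modulo \<open>p\<close>; minimality of the degree,
  in place of irreducibility, makes the remainder zero, and then \<open>g\<close> is a multiple of
  \<open>q\<close>.\<close>

lemma extend_hom_graph:
  assumes pq: "graph_poly R p q" and p: "lead_coeff p = 1" "degree p > 0"
    and minimal: "\<forall>f g. graph_poly R f g \<longrightarrow> f \<noteq> 0 \<longrightarrow> poly f \<gamma> = 0 \<longrightarrow> degree p \<le> degree f"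
    and root: "poly p \<gamma> = 0" "poly q \<delta> = 0"
  shows "\<exists>R'. hom_graph R' \<and> R \<subseteq> R' \<and> (\<gamma>, \<delta>) \<in> R'"
proof (intro exI conjI)
  let ?R = "{(poly f \<gamma>, poly g \<delta>) | f g. graph_poly R f g}"
  show "hom_graph ?R"
    unfolding hom_graph_def
  proof (intro conjI allI impI ballI)
    fix r :: 'a assume "r \<in> \<rat>"
    then show "(r, r) \<in> ?R"
      using gp_monom[OF hg_rat, of r 0] by (force simp: poly_monom)
  next
    fix a b c d assume "(a, b) \<in> ?R" "(c, d) \<in> ?R"
    then obtain f g f' g' where *: "graph_poly R f g" "graph_poly R f' g'"
      "a = poly f \<gamma>" "b = poly g \<delta>" "c = poly f' \<gamma>" "d = poly g' \<delta>" by auto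
    then show "(a + c, b + d) \<in> ?R" "(a * c, b * d) \<in> ?R"
      using gp_add[OF *(1,2)] gp_mult[OF *(1,2)] by (force simp flip: poly_add poly_mult)+
  next
    fix y assume "(0, y) \<in> ?R"
    then obtain f g where fg: "graph_poly R f g" "poly f \<gamma> = 0" "y = poly g \<delta>" by auto
    obtain s t r u where *: "graph_poly R r u" "f = p * s + r" "g = q * t + u" "degree r < degree p"
      using gp_division[OF pq p fg(1)] by blast
    have "poly r \<gamma> = 0" using fg(2) *(2) root by simp
    then have "r = 0" using minimal *(1,4) by force
    then show "y = 0" using gp_zero[of u] *(1,3) fg(3) root by simp
  qed
  show "R \<subseteq> ?R"
    using gp_monom[of _ _ 0] by (force simp: poly_monom)
  show "(\<gamma>, \<delta>) \<in> ?R"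
    using gp_monom[OF hg_rat, of 1 1] by (force simp: poly_monom)
qed

context
  assumes alg: "\<forall>x :: 'a. algebraic x"
begin

text \<open>An integer polynomial with nonzero constant term that kills \<open>z\<close> expresses
  \<open>inverse z\<close> as a rational polynomial in \<open>z\<close>. The domain of the graph, a
  priori only a ring, therefore contains inverses.\<close>

lemma hg_inverse:
  assumes zw: "(z, w) \<in> R" and z: "z \<noteq> 0"
  shows "\<exists>w'. (inverse z, w') \<in> R"
proof -
  obtain h where h: "coeff h 0 \<noteq> 0" "poly (map_poly of_int h) z = 0"
    using algebraicE'_nonzero[of z] alg z by blast
  obtain c :: 'a and h' where ch: "map_poly of_int h = pCons c h'" by (rule pCons_cases)
  have "coeff (map_poly of_int h :: 'a poly) i \<in> \<rat>" for i by (simp add: coeff_map_poly)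
  then have rat: "c \<in> \<rat>" "rational_poly h'"
    unfolding ch rational_poly_def by (metis coeff_pCons_0, metis coeff_pCons_Suc)
  have c: "c \<noteq> 0" using h(1) ch by (metis coeff_map_poly coeff_pCons_0 of_int_0 of_int_eq_0_iff)
  have "c + z * poly h' z = 0" using h(2) ch by simp
  then have "z * (poly h' z * (- inverse c)) = 1"
    using c by (simp add: field_simps neg_eq_iff_add_eq_0)
  then have "poly h' z * (- inverse c) = inverse z"
    by (metis inverse_unique)
  then show ?thesis
    using hg_mult[OF hg_poly_rat[OF zw rat(2)] hg_rat[of "- inverse c"]] rat(1) by auto
qed

lemma minimal_graph_poly:
  "\<exists>p q. graph_poly R p q \<and> lead_coeff p = 1 \<and> degree p > 0 \<and> poly p \<gamma> = 0 \<and>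
     (\<forall>f g. graph_poly R f g \<longrightarrow> f \<noteq> 0 \<longrightarrow> poly f \<gamma> = 0 \<longrightarrow> degree p \<le> degree f)"
proof -
  let ?P = "\<lambda>n. \<exists>f g. graph_poly R f g \<and> f \<noteq> 0 \<and> poly f \<gamma> = 0 \<and> degree f = n"
  obtain f where "rational_poly f" "f \<noteq> 0" "poly f \<gamma> = 0"
    using alg unfolding algebraic_altdef rational_poly_def by blast
  then have ex: "?P (degree f)" using gp_rat by blast
  define n where "n = (LEAST n. ?P n)"
  have least: "n \<le> degree f" if "graph_poly R f g" "f \<noteq> 0" "poly f \<gamma> = 0" for f g
    unfolding n_def using that by (intro Least_le) blast
  obtain p q where p: "graph_poly R p q" "p \<noteq> 0" "poly p \<gamma> = 0" "degree p = n"
    using LeastI[of ?P, OF ex] unfolding n_def by blast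
  obtain w where w: "(inverse (lead_coeff p), w) \<in> R"
    using hg_inverse[of "lead_coeff p" "coeff q (degree p)"] p by (auto simp: graph_poly_def)
  \<comment> \<open>Scaling to a monic polynomial stays within the graph because the inverse of the
    leading coefficient is in its domain.\<close>
  have "graph_poly R (smult (inverse (lead_coeff p)) p) (smult w q)"
    using hg_mult[OF w] p(1) by (simp add: graph_poly_def)
  moreover have "degree p > 0"
    using p(2,3) by (metis degree_eq_zeroE gr0I pCons_0_0 poly_const_conv)
  ultimately show ?thesis
    using p least
    by (intro exI[of _ "smult (inverse (lead_coeff p)) p"] exI[of _ "smult w q"]) auto
qed

end

end

lemma hom_graph_Union:
  assumes "chain\<^sub>\<subseteq> C" "C \<noteq> {}" "\<And>R. R \<in> C \<Longrightarrow> hom_graph R"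
  shows "hom_graph (\<Union>C)"
proof -
  have "(a + c, b + d) \<in> \<Union>C \<and> (a * c, b * d) \<in> \<Union>C" if abcd: "(a, b) \<in> \<Union>C" "(c, d) \<in> \<Union>C" for a b c d
  proof -
    obtain R1 R2 where R12: "R1 \<in> C" "(a, b) \<in> R1" "R2 \<in> C" "(c, d) \<in> R2"
      using abcd by (meson UnionE)
    then have "R1 \<subseteq> R2 \<or> R2 \<subseteq> R1" using assms(1) by (simp add: chain_subset_def)
    then obtain R where "R \<in> C" "(a, b) \<in> R" "(c, d) \<in> R"
      using R12 by (metis subsetD)
    then show ?thesis
      using hg_add[OF assms(3), of R a b c d] hg_mult[OF assms(3), of R a b c d] by blast
  qed
  moreover have "(r, r) \<in> \<Union>C" if "r \<in> \<rat>" for r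
  proof -
    obtain R where "R \<in> C" using assms(2) by blast
    then show ?thesis using hg_rat[OF assms(3) that] by blast
  qed
  moreover have "y = 0" if "(0, y) \<in> \<Union>C" for y
    using that hg_zero[OF assms(3)] by blast
  ultimately show ?thesis unfolding hom_graph_def by simp
qed

text \<open>A graph that is maximal by Zorn's lemma is total, since a root of the transported
  minimal polynomial exists in the algebraically closed field. The resulting map is injective
  because it preserves inverses.\<close>

lemma hom_graph_extends_to_automorphism:
  fixes R :: "('a :: {alg_closed_field, field_char_0} \<times> 'a) set"
  assumes alg: "\<forall>x :: 'a. algebraic x" and R: "hom_graph R"
  shows "\<exists>\<sigma>. field_automorphism \<sigma> \<and> (\<forall>(x, y)\<in>R. \<sigma> x = y)"
proof -
  let ?A = "{R'. hom_graph R' \<and> R \<subseteq> R'}"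
  have "\<exists>M\<in>?A. \<forall>M'\<in>?A. M \<subseteq> M' \<longrightarrow> M' = M"
  proof (rule subset_Zorn_nonempty)
    show "?A \<noteq> {}" using R by blast
    show "\<Union>C \<in> ?A" if "C \<noteq> {}" "subset.chain ?A C" for C
      using that hom_graph_Union[of C] unfolding subset_chain_def chain_subset_def by blast
  qed
  then obtain M where M: "hom_graph M" "R \<subseteq> M"
    and max: "\<And>M'. hom_graph M' \<Longrightarrow> M \<subseteq> M' \<Longrightarrow> M' = M" by auto
  have "\<exists>y. (x, y) \<in> M" for x
  proof -
    obtain p q where pq: "graph_poly M p q" "lead_coeff p = 1" "degree p > 0" "poly p x = 0"
      and min: "\<forall>f g. graph_poly M f g \<longrightarrow> f \<noteq> 0 \<longrightarrow> poly f x = 0 \<longrightarrow> degree p \<le> degree f"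
      using minimal_graph_poly[OF M(1) alg, of x] by blast
    obtain y where "poly q y = 0"
      using alg_closed_imp_poly_has_root[of q] gp_monic[OF M(1) pq(1,2)] pq(3) by auto
    then show ?thesis
      using extend_hom_graph[OF M(1) pq(1-3) min pq(4)] max by blast
  qed
  then obtain \<sigma> where \<sigma>: "\<And>x. (x, \<sigma> x) \<in> M" by metis
  have eq: "\<sigma> x = y" if "(x, y) \<in> M" for x y
    using hg_unique[OF M(1)] \<sigma> that by blast
  have add: "\<sigma> (x + y) = \<sigma> x + \<sigma> y" and mult: "\<sigma> (x * y) = \<sigma> x * \<sigma> y" for x y
    using \<sigma> by (blast intro: eq hg_add[OF M(1)] hg_mult[OF M(1)])+
  have rat: "\<sigma> r = r" if "r \<in> \<rat>" for r using eq hg_rat[OF M(1) that] by blast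
  have inj: "inj \<sigma>"
  proof (rule injI)
    fix x y assume "\<sigma> x = \<sigma> y"
    then have 0: "\<sigma> (x - y) = 0" using add[of "x - y" y] by simp
    show "x = y"
    proof (rule ccontr)
      assume "x \<noteq> y"
      then have "\<sigma> (x - y) * \<sigma> (inverse (x - y)) = 1" using rat[of 1] by (simp flip: mult)
      with 0 show False by simp
    qed
  qed
  have "\<exists>x. \<sigma> x = y" for y
  proof -
    obtain f where f: "rational_poly f" "f \<noteq> 0" "poly f y = 0"
      using alg unfolding algebraic_altdef rational_poly_def by blast
    \<comment> \<open>Surjectivity: \<open>\<sigma>\<close> maps the finite root set of a rational
      polynomial injectively to itself, hence onto itself.\<close>
    have "\<sigma> ` {x. poly f x = 0} \<subseteq> {x. poly f x = 0}"
      using hg_poly_rat[OF M(1) \<sigma> f(1)] hg_zero[OF M(1)] by (auto, metis)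
    then have "\<sigma> ` {x. poly f x = 0} = {x. poly f x = 0}"
      using inj poly_roots_finite[OF f(2)] by (intro endo_inj_surj) (auto intro: inj_on_subset)
    moreover have "y \<in> {x. poly f x = 0}" using f(3) by simp
    ultimately have "y \<in> \<sigma> ` {x. poly f x = 0}" by (simp only:)
    then show ?thesis by blast
  qed
  then have "field_automorphism \<sigma>"
    using inj add mult unfolding field_automorphism_def bij_def surj_def by metis
  then show ?thesis using eq M(2) by blast
qed

text \<open>The minimal polynomial over the rationals has degree above 1, hence a second root
  \<open>\<beta>\<close>. Sending \<open>\<alpha>\<close> to \<open>\<beta>\<close> extends the
  identity graph on the rationals, and then extends to an automorphism.\<close>

lemma nonrational_moved:
  fixes \<alpha> :: "'a :: {alg_closed_field, field_char_0}"
  assumes alg: "\<forall>x :: 'a. algebraic x" and \<alpha>: "\<alpha> \<notin> \<rat>"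
  shows "\<exists>\<sigma>. field_automorphism \<sigma> \<and> \<sigma> \<alpha> \<noteq> \<alpha>"
proof -
  let ?R = "{(r, r) | r :: 'a. r \<in> \<rat>}"
  have R: "hom_graph ?R" by (auto simp: hom_graph_def)
  obtain p q where pq: "graph_poly ?R p q" "lead_coeff p = 1" "degree p > 0" "poly p \<alpha> = 0"
    and min: "\<forall>f g. graph_poly ?R f g \<longrightarrow> f \<noteq> 0 \<longrightarrow> poly f \<alpha> = 0 \<longrightarrow> degree p \<le> degree f"
    using minimal_graph_poly[OF R alg, of \<alpha>] by blast
  have qp: "q = p" using pq(1) by (intro poly_eqI) (auto simp: graph_poly_def)
  have rat: "coeff p i \<in> \<rat>" for i using pq(1) by (auto simp: graph_poly_def)
  obtain k where k: "p = [:- \<alpha>, 1:] * k" using pq(4) by (auto simp: poly_eq_0_iff_dvd)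
  have "degree p = Suc (degree k)" using pq(3) unfolding k by (subst degree_mult_eq) auto
  moreover have "degree p \<noteq> 1"
  proof
    assume "degree p = 1"
    then have "coeff p 0 + \<alpha> = 0" using pq(2,4) by (simp add: poly_altdef)
    then have "\<alpha> = - coeff p 0" by (simp add: eq_neg_iff_add_eq_0 add.commute)
    then show False using rat[of 0] \<alpha> by simp
  qed
  ultimately obtain \<beta> where \<beta>: "poly k \<beta> = 0"
    using alg_closed_imp_poly_has_root[of k] by auto
  \<comment> \<open>A double root would also be a root of the derivative, which in characteristic 0
    is nonzero and has smaller degree than \<open>p\<close>.\<close>
  have "\<beta> \<noteq> \<alpha>"
  proof
    assume "\<beta> = \<alpha>"
    then have "poly (pderiv p) \<alpha> = 0"
      unfolding k pderiv_mult using \<beta> by (simp add: pderiv_pCons)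
    moreover have "graph_poly ?R (pderiv p) (pderiv p)"
      using rat by (intro gp_rat[OF R]) (simp add: rational_poly_def coeff_pderiv)
    moreover have "pderiv p \<noteq> 0" using pq(3) by (simp add: pderiv_eq_0_iff)
    ultimately have "degree p \<le> degree (pderiv p)" using min by blast
    then show False using pq(3) by (simp add: degree_pderiv)
  qed
  obtain R' where R': "hom_graph R'" "(\<alpha>, \<beta>) \<in> R'"
    using extend_hom_graph[OF R pq(1-3) min pq(4), of \<beta>] qp k \<beta> by auto
  obtain \<sigma> where "field_automorphism \<sigma>" "\<forall>(x, y)\<in>R'. \<sigma> x = y"
    using hom_graph_extends_to_automorphism[OF alg R'(1)] by blast
  moreover from this have "\<sigma> \<alpha> = \<beta>" using R'(2) by fast
  ultimately show ?thesis using \<open>\<beta> \<noteq> \<alpha>\<close> by blast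
qed

section \<open>Field automorphisms and conjugates\<close>

context
  fixes \<sigma> :: "'a :: field_char_0 \<Rightarrow> 'a"
  assumes \<sigma>: "field_automorphism \<sigma>"
begin

lemma aut_add: "\<sigma> (x + y) = \<sigma> x + \<sigma> y"
  and aut_mult: "\<sigma> (x * y) = \<sigma> x * \<sigma> y"
  and aut_bij: "bij \<sigma>"
  using \<sigma> by (auto simp: field_automorphism_def)

lemma aut_0: "\<sigma> 0 = 0" using aut_add[of 0 0] by simp

lemma aut_inj: "\<sigma> x = \<sigma> y \<longleftrightarrow> x = y" using aut_bij by (metis bij_pointE)

lemma aut_eq_0: "\<sigma> x = 0 \<longleftrightarrow> x = 0" using aut_inj[of x 0] aut_0 by simp

lemma aut_1: "\<sigma> 1 = 1" using aut_mult[of 1 1] aut_eq_0[of 1] by simp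

lemma aut_uminus: "\<sigma> (- x) = - \<sigma> x"
  using aut_add[of x "-x"] aut_0 by (simp add: add_eq_0_iff)

lemma aut_diff: "\<sigma> (x - y) = \<sigma> x - \<sigma> y"
  using aut_add[of x "-y"] aut_uminus by simp

lemma aut_inverse: "\<sigma> (inverse x) = inverse (\<sigma> x)"
proof (cases "x = 0")
  case False
  then have "\<sigma> x * \<sigma> (inverse x) = 1" by (simp flip: aut_mult add: aut_1)
  then show ?thesis by (metis inverse_unique)
qed (simp add: aut_0)

lemma aut_sum: "\<sigma> (\<Sum>i\<in>I. f i) = (\<Sum>i\<in>I. \<sigma> (f i))"
  by (induction I rule: infinite_finite_induct) (auto simp: aut_0 aut_add)

lemma aut_prod: "\<sigma> (\<Prod>i\<in>I. f i) = (\<Prod>i\<in>I. \<sigma> (f i))"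
  by (induction I rule: infinite_finite_induct) (auto simp: aut_1 aut_mult)

lemma aut_of_nat: "\<sigma> (of_nat n) = of_nat n"
  by (induction n) (auto simp: aut_0 aut_1 aut_add)

lemma aut_of_int: "\<sigma> (of_int n) = of_int n"
  by (cases n rule: int_cases2) (simp_all add: aut_of_nat aut_uminus)

lemma aut_of_rat: "\<sigma> (of_rat r) = of_rat r"
  by (cases r) (simp add: of_rat_rat divide_inverse aut_mult aut_inverse aut_of_int)

lemma aut_power: "\<sigma> (x ^ n) = \<sigma> x ^ n"
  by (induction n) (auto simp: aut_1 aut_mult)

lemma aut_Rats: "r \<in> \<rat> \<Longrightarrow> \<sigma> r = r"
  by (auto elim!: Rats_cases simp: aut_of_rat)

lemma aut_rational_poly: "rational_poly p \<Longrightarrow> \<sigma> (poly p x) = poly p (\<sigma> x)"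
  by (simp add: poly_altdef aut_sum aut_mult aut_power rational_poly_def aut_Rats)

lemma aut_map_poly_mult: "map_poly \<sigma> (p * q) = map_poly \<sigma> p * map_poly \<sigma> q"
  by (intro poly_eqI) (simp add: coeff_map_poly aut_0 coeff_mult aut_sum aut_mult)

lemma aut_map_poly_prod: "map_poly \<sigma> (\<Prod>i\<in>I. f i) = (\<Prod>i\<in>I. map_poly \<sigma> (f i))"
  by (induction I rule: infinite_finite_induct) (auto simp: aut_1 aut_map_poly_mult)

end

lemma aut_id: "field_automorphism id"
  by (simp add: field_automorphism_def)

lemma aut_comp: "field_automorphism \<sigma> \<Longrightarrow> field_automorphism \<tau> \<Longrightarrow> field_automorphism (\<sigma> \<circ> \<tau>)"
  by (auto simp: field_automorphism_def bij_comp)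

lemma aut_inv: "field_automorphism \<sigma> \<Longrightarrow> field_automorphism (inv_into UNIV \<sigma>)"
  unfolding field_automorphism_def
  by (metis (no_types, opaque_lifting) bij_imp_bij_inv bij_inv_eq_iff)

definition conjugates :: "'a :: field \<Rightarrow> 'a set" where
  "conjugates x = {\<sigma> x | \<sigma>. field_automorphism \<sigma>}"

lemma conjugates_finite:
  assumes "algebraic (x :: 'a :: field_char_0)"
  shows "finite (conjugates x)"
proof -
  obtain f where f: "rational_poly f" "f \<noteq> 0" "poly f x = 0"
    using assms unfolding algebraic_altdef rational_poly_def by blast
  have "poly f (\<sigma> x) = 0" if "field_automorphism \<sigma>" for \<sigma>
    using aut_rational_poly[OF that f(1), of x] aut_0[OF that] f(3) by simp
  then have "conjugates x \<subseteq> {y. poly f y = 0}"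
    by (auto simp: conjugates_def)
  then show ?thesis using poly_roots_finite[OF f(2)] finite_subset by blast
qed

lemma conjugates_image:
  assumes \<sigma>: "field_automorphism (\<sigma> :: 'a \<Rightarrow> 'a :: field)"
  shows "\<sigma> ` conjugates x = conjugates x"
proof
  show "\<sigma> ` conjugates x \<subseteq> conjugates x"
    using aut_comp[OF \<sigma>] by (auto simp: conjugates_def) (metis comp_apply)
  have "\<tau> x = \<sigma> ((inv_into UNIV \<sigma> \<circ> \<tau>) x)" for \<tau>
    using \<sigma> by (simp add: field_automorphism_def bij_is_surj surj_f_inv_f)
  moreover have "(inv_into UNIV \<sigma> \<circ> \<tau>) x \<in> conjugates x" if "field_automorphism \<tau>" for \<tau>
    unfolding conjugates_def using aut_comp[OF aut_inv[OF \<sigma>] that] by blast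
  ultimately show "conjugates x \<subseteq> \<sigma> ` conjugates x"
    by (smt (verit, best) conjugates_def image_iff mem_Collect_eq subsetI)
qed

text \<open>Automorphisms permute the linear factors of the product over all conjugates, so its
  coefficients are fixed by every automorphism and are rational by
  \<open>nonrational_moved\<close>.\<close>

lemma rational_poly_of_conjugates:
  fixes x :: "'a :: {alg_closed_field, field_char_0}"
  assumes alg: "\<forall>x :: 'a. algebraic x"
  shows "\<exists>p. rational_poly p \<and> p \<noteq> 0 \<and> degree p = card (conjugates x) \<and> poly p x = 0"
proof -
  let ?p = "\<Prod>y\<in>conjugates x. [:- y, 1:]"
  have fin: "finite (conjugates x)" using conjugates_finite alg by blast
  have x: "x \<in> conjugates x" unfolding conjugates_def using aut_id by (metis (mono_tags) id_apply mem_Collect_eq)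
  have "coeff ?p i \<in> \<rat>" for i
  proof (rule ccontr)
    assume "coeff ?p i \<notin> \<rat>"
    then obtain \<sigma> where \<sigma>: "field_automorphism \<sigma>" "\<sigma> (coeff ?p i) \<noteq> coeff ?p i"
      using nonrational_moved[OF alg] by blast
    have "map_poly \<sigma> ?p = (\<Prod>y\<in>conjugates x. [:- \<sigma> y, 1:])"
      by (simp add: aut_map_poly_prod[OF \<sigma>(1)] map_poly_pCons aut_0[OF \<sigma>(1)] aut_1[OF \<sigma>(1)] aut_uminus[OF \<sigma>(1)])
    also have "\<dots> = (\<Prod>y\<in>\<sigma> ` conjugates x. [:- y, 1:])"
      using aut_bij[OF \<sigma>(1)] by (subst prod.reindex) (auto simp: bij_def inj_on_def)
    finally have "map_poly \<sigma> ?p = ?p" by (simp add: conjugates_image[OF \<sigma>(1)])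
    moreover have "coeff (map_poly \<sigma> ?p) i = \<sigma> (coeff ?p i)"
      by (rule coeff_map_poly) (rule aut_0[OF \<sigma>(1)])
    ultimately show False using \<sigma>(2) by simp
  qed
  moreover have "poly ?p x = 0" using fin x by (auto simp: poly_prod)
  moreover have "degree ?p = card (conjugates x)" by (simp add: degree_prod_eq_sum_degree)
  moreover have "?p \<noteq> 0" using fin by simp
  ultimately show ?thesis unfolding rational_poly_def by blast
qed

section \<open>Number fields\<close>

abbreviation Rg :: "'a :: field_char_0 ring" where "Rg \<equiv> ring_of_type_algebra"

lemma Rg_simps:
  "carrier (Rg :: 'a :: field_char_0 ring) = UNIV"
  "x \<otimes>\<^bsub>Rg\<^esub> y = x * (y :: 'a)" "x \<oplus>\<^bsub>Rg\<^esub> y = x + (y :: 'a)"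
  "\<one>\<^bsub>Rg\<^esub> = (1 :: 'a)" "\<zero>\<^bsub>Rg\<^esub> = (0 :: 'a)"
  by (simp_all add: ring_of_type_algebra_def)

lemma Rg_field: "Ring.field (Rg :: 'a :: field_char_0 ring)"
  by (rule field_from_type_algebra)

lemma Rg_ring: "Ring.ring (Rg :: 'a :: field_char_0 ring)"
  by (rule ring_from_type_algebra)

lemma Rg_uminus: "\<ominus>\<^bsub>Rg\<^esub> x = - (x :: 'a :: field_char_0)"
proof -
  interpret R: Ring.field "Rg :: 'a ring" by (rule Rg_field)
  show ?thesis
    by (rule R.minus_equality) (simp_all add: Rg_simps)
qed

lemma Rg_inv:
  assumes "x \<noteq> (0 :: 'a :: field_char_0)"
  shows "inv\<^bsub>Rg\<^esub> x = inverse x"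
proof -
  interpret R: Ring.field "Rg :: 'a ring" by (rule Rg_field)
  show ?thesis
    by (rule R.inv_unique'[symmetric]) (use assms in \<open>simp_all add: Rg_simps\<close>)
qed

lemma Rg_pow: "x [^]\<^bsub>Rg\<^esub> (n :: nat) = (x :: 'a :: field_char_0) ^ n"
  by (induction n) (simp_all add: nat_pow_def Rg_simps mult.commute)

text \<open>Translates the record-based notion into closure under the class operations. As
  \<open>inverse 0 = 0\<close>, closure under inverses can be stated without excluding 0.\<close>

lemma subfield_Rg_iff:
  "subfield K (Rg :: 'a :: field_char_0 ring) \<longleftrightarrow>
     1 \<in> K \<and> (\<forall>x\<in>K. \<forall>y\<in>K. x + y \<in> K \<and> x * y \<in> K) \<and> (\<forall>x\<in>K. - x \<in> K \<and> inverse x \<in> K)"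
  (is "?L = ?R")
proof
  interpret R: Ring.field "Rg :: 'a ring" by (rule Rg_field)
  assume K: ?L
  have "inverse x \<in> K" if "x \<in> K" for x
  proof (cases "x = 0")
    case False
    then show ?thesis using R.subfield_m_inv(1)[OF K, of x] that by (simp add: Rg_simps Rg_inv)
  qed (use that in simp)
  then show ?R
    using R.subring_props[OF K] by (simp add: Rg_simps Rg_uminus)
next
  interpret R: Ring.field "Rg :: 'a ring" by (rule Rg_field)
  assume K: ?R
  show ?L
  proof (rule R.subfieldI'[OF R.subringI])
    show "inv\<^bsub>Rg\<^esub> k \<in> K" if "k \<in> K - {\<zero>\<^bsub>Rg\<^esub>}" for k
      using K that by (auto simp: Rg_simps Rg_inv)
  qed (use K in \<open>auto simp: Rg_simps Rg_uminus\<close>)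
qed

lemma subfield_Rats: "subfield \<rat> (Rg :: 'a :: field_char_0 ring)"
  by (simp add: subfield_Rg_iff)

lemma number_field_subfield: "number_field K \<Longrightarrow> subfield K Rg"
  by (simp add: number_field_def)

context
  fixes K :: "'a :: field_char_0 set"
  assumes K: "subfield K Rg"
begin

lemma sf_1: "1 \<in> K" and sf_add: "x \<in> K \<Longrightarrow> y \<in> K \<Longrightarrow> x + y \<in> K"
  and sf_mult: "x \<in> K \<Longrightarrow> y \<in> K \<Longrightarrow> x * y \<in> K" and sf_uminus: "x \<in> K \<Longrightarrow> - x \<in> K"
  and sf_inverse: "x \<in> K \<Longrightarrow> inverse x \<in> K"
  using K by (auto simp: subfield_Rg_iff)

lemma sf_diff: "x \<in> K \<Longrightarrow> y \<in> K \<Longrightarrow> x - y \<in> K"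
  using sf_add[of x "-y"] sf_uminus by simp

lemma sf_0: "0 \<in> K" using sf_diff[OF sf_1 sf_1] by simp

lemma sf_divide: "x \<in> K \<Longrightarrow> y \<in> K \<Longrightarrow> x / y \<in> K"
  by (simp add: divide_inverse sf_mult sf_inverse)

lemma sf_power: "x \<in> K \<Longrightarrow> x ^ n \<in> K"
  by (induction n) (auto simp: sf_1 sf_mult)

lemma sf_of_nat: "of_nat n \<in> K"
  by (induction n) (auto simp: sf_0 sf_1 sf_add)

lemma sf_of_int: "of_int n \<in> K"
  by (cases n rule: int_cases2) (auto simp: sf_of_nat sf_uminus)

lemma sf_of_rat: "of_rat r \<in> K"
  by (cases r) (simp add: of_rat_rat sf_divide sf_of_int)

lemma sf_Rats: "\<rat> \<subseteq> K"
  by (auto elim!: Rats_cases simp: sf_of_rat)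

lemma sf_sum: "(\<And>i. i \<in> I \<Longrightarrow> f i \<in> K) \<Longrightarrow> sum f I \<in> K"
  by (induction I rule: infinite_finite_induct) (auto simp: sf_0 sf_add)

end

section \<open>Polynomials as coefficient lists, and finite extensions of the rationals\<close>

text \<open>Coefficient lists in the algebra library start with the leading coefficient, hence the
  descending exponent here and the reversal of \<open>coeffs\<close> below.\<close>

lemma Rg_eval: "ring.eval Rg ps x = (\<Sum>i<length ps. ps ! i * x ^ (length ps - 1 - i))"
  for x :: "'a :: field_char_0"
proof -
  interpret R: Ring.field "Rg :: 'a ring" by (rule Rg_field)
  show ?thesis
  proof (induction ps)
    case (Cons a ps)
    then show ?case
      by (simp add: Rg_simps Rg_pow sum.lessThan_Suc_shift del: sum.lessThan_Suc)
  qed (simp add: Rg_simps)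
qed

lemma Rg_poly_list:
  fixes p :: "'a :: field_char_0 poly"
  assumes "rational_poly p" "p \<noteq> 0"
  defines "ps \<equiv> rev (coeffs p)"
  shows "ps \<in> carrier (\<rat>[X]\<^bsub>Rg\<^esub>)" "ps \<noteq> []" "length ps = Suc (degree p)" "ring.eval Rg ps x = poly p x"
proof -
  have len: "length ps = Suc (degree p)" using assms by (simp add: length_coeffs)
  then show "ps \<noteq> []" "length ps = Suc (degree p)" by auto
  have nth: "ps ! i = coeff p (degree p - i)" if "i \<le> degree p" for i
    using that assms by (simp add: rev_nth length_coeffs coeffs_nth)
  have "set ps \<subseteq> \<rat>"
    using assms unfolding ps_def rational_poly_def by (auto simp: coeffs_def)
  moreover have "hd ps \<noteq> 0"
    using assms by (simp add: hd_rev last_coeffs_eq_coeff_degree)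
  ultimately show "ps \<in> carrier (\<rat>[X]\<^bsub>Rg\<^esub>)"
    by (simp add: univ_poly_def polynomial_def Rg_simps)
  have "ring.eval Rg ps x = (\<Sum>i\<le>degree p. coeff p (degree p - i) * x ^ (degree p - i))"
    unfolding Rg_eval len by (simp add: lessThan_Suc_atMost nth)
  also have "\<dots> = (\<Sum>i\<le>degree p. coeff p i * x ^ i)"
    by (rule sum.reindex_bij_witness[of _ "\<lambda>i. degree p - i" "\<lambda>i. degree p - i"]) auto
  finally show "ring.eval Rg ps x = poly p x" by (simp add: poly_altdef)
qed

lemma Rg_algebraic:
  assumes "algebraic (x :: 'a :: field_char_0)"
  shows "((ring.algebraic Rg) over \<rat>) x"
proof -
  interpret R: Ring.field "Rg :: 'a ring" by (rule Rg_field)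
  obtain p where p: "rational_poly p" "p \<noteq> 0" "poly p x = 0"
    using assms unfolding algebraic_altdef rational_poly_def by blast
  then show ?thesis
    unfolding over_def using Rg_poly_list[OF p(1,2)] R.algebraicI[of "rev (coeffs p)" \<rat> x]
    by (simp add: Rg_simps over_def)
qed

text \<open>The field is the simple extension by \<open>x\<close>. Its degree is that of the
  irreducible polynomial of \<open>x\<close>, which divides \<open>p\<close>.\<close>

lemma number_field_of_degree:
  fixes x :: "'a :: field_char_0"
  assumes p: "rational_poly p" "p \<noteq> 0" "poly p x = 0"
  shows "\<exists>K. number_field K \<and> field_degree K \<le> degree p \<and> x \<in> K"
proof (intro exI conjI)
  interpret R: Ring.field "Rg :: 'a ring" by (rule Rg_field)
  let ?K = "ring.simple_extension Rg \<rat> x"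
  have x: "x \<in> carrier Rg" by (simp add: Rg_simps)
  have "algebraic x" using p unfolding algebraic_altdef rational_poly_def by blast
  note alg = Rg_algebraic[OF this]
  show "number_field ?K"
    unfolding number_field_def
    using R.simple_extension_is_subfield[OF subfield_Rats x] alg
      R.finite_dimension_simple_extension[OF subfield_Rats x] by blast
  show "x \<in> ?K"
    by (rule R.simple_extension_mem[OF subfieldE(1)[OF subfield_Rats] x])
  note ps = Rg_poly_list[OF p(1,2)]
  have "field_degree ?K = length (R.Irr \<rat> x) - 1"
    using R.simple_extension_dim[OF subfield_Rats x alg] by (simp add: field_degree_def over_def)
  also have "\<dots> \<le> length (rev (coeffs p)) - 1"
    using R.Irr_minimal[OF subfield_Rats x alg ps(1)] ps(4)[of x] p(3)
      R.pdivides_imp_degree_le[OF subfieldE(1)[OF subfield_Rats] R.IrrE(1)[OF subfield_Rats x alg] ps(1,2)]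
    by (simp add: Rg_simps)
  finally show "field_degree ?K \<le> degree p" using ps(3) by simp
qed

lemma number_field_containing:
  fixes x y :: "'a :: field_char_0"
  assumes "algebraic x" "algebraic y"
  shows "\<exists>K. number_field K \<and> x \<in> K \<and> y \<in> K"
proof -
  interpret R: Ring.field "Rg :: 'a ring" by (rule Rg_field)
  have xy: "set [x, y] \<subseteq> carrier Rg" by (simp add: Rg_simps)
  have alg: "(R.algebraic over \<rat>) z" if "z \<in> set [x, y]" for z
    using that assms Rg_algebraic by auto
  have "number_field (R.finite_extension \<rat> [x, y])"
    unfolding number_field_def
    using R.finite_extension_is_subfield[OF subfield_Rats xy alg]
      R.finite_extension_finite_dimension(1)[OF subfield_Rats xy alg] by blast
  moreover have "set [x, y] \<subseteq> R.finite_extension \<rat> [x, y]"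
    by (rule R.finite_extension_mem[OF subfieldE(1)[OF subfield_Rats] xy])
  ultimately show ?thesis by auto
qed

text \<open>The finiteness of the degree in the form in which it later bounds the number of absolute
  values: no family longer than \<open>d\<close> is independent.\<close>

lemma number_field_independent_bound:
  assumes K: "number_field (K :: 'a :: field_char_0 set)"
  shows "\<exists>d. \<forall>n. \<forall>x :: nat \<Rightarrow> 'a. (\<forall>i<n. x i \<in> K) \<longrightarrow>
     (\<forall>c. (\<forall>i<n. c i \<in> \<rat>) \<longrightarrow> (\<Sum>i<n. c i * x i) = 0 \<longrightarrow> (\<forall>i<n. c i = 0)) \<longrightarrow> n \<le> d"
proof -
  interpret R: Ring.field "Rg :: 'a ring" by (rule Rg_field)
  obtain d where d: "R.dimension d \<rat> K"
    using K by (auto simp: number_field_def R.finite_dimension_def)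
  have "n \<le> d" if x: "\<forall>i<n. x i \<in> K"
    and ind: "\<forall>c. (\<forall>i<n. c i \<in> \<rat>) \<longrightarrow> (\<Sum>i<n. c i * x i) = 0 \<longrightarrow> (\<forall>i<n. c i = 0)"
    for n and x :: "nat \<Rightarrow> 'a"
  proof -
    let ?Us = "map x [0..<n]"
    have comb: "R.combine Ks Us = (\<Sum>i<length Us. Ks ! i * Us ! i)" if "length Ks = length Us" for Ks Us
      using that
      by (induction Ks Us rule: R.combine.induct)
        (simp_all add: Rg_simps sum.lessThan_Suc_shift del: sum.lessThan_Suc)
    have "R.independent \<rat> ?Us"
    proof (rule R.trivial_combine_imp_independent[OF subfield_Rats])
      fix Ks assume Ks: "set Ks \<subseteq> \<rat>" "R.combine Ks ?Us = \<zero>\<^bsub>Rg\<^esub>"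
      \<comment> \<open>\<open>combine\<close> drops surplus entries and treats missing ones as
        zero, so cutting and padding \<open>Ks\<close> to length \<open>n\<close> does not change
        the value.\<close>
      define Ls where "Ls = take n Ks @ replicate (n - length Ks) 0"
      have Ls: "length Ls = n" "set Ls \<subseteq> \<rat>" using Ks(1) by (auto simp: Ls_def dest: in_set_takeD)
      have "R.combine Ls ?Us = R.combine (take n Ks) ?Us"
        unfolding Ls_def using R.combine_append_replicate[of ?Us "take n Ks" "n - length Ks"]
        by (simp add: Rg_simps)
      also have "\<dots> = 0" using Ks(2) R.combine_take[of ?Us Ks] by (simp add: Rg_simps)
      finally have "(\<Sum>i<n. Ls ! i * x i) = 0" using comb[of Ls ?Us] Ls(1) by simp
      then have "\<forall>i<n. Ls ! i = 0" using ind Ls by (metis nth_mem subsetD)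
      then have "set Ls \<subseteq> {0}" using Ls(1) by (auto simp: in_set_conv_nth)
      then show "set (take (length ?Us) Ks) \<subseteq> {\<zero>\<^bsub>Rg\<^esub>}" by (simp add: Ls_def Rg_simps)
    qed (simp add: Rg_simps)
    from R.independent_length_le_dimension[OF subfield_Rats d this]
    show "n \<le> d" using x by (simp add: image_subset_iff)
  qed
  then show ?thesis by blast
qed

section \<open>Absolute values and Ostrowski's theorem\<close>

text \<open>If \<open>c > d > 0\<close>, dividing by \<open>d ^ n\<close> would bound an exponential
  with base above 1 by a linear function. This removes the linear factors left by sums with
  \<open>n + 1\<close> terms.\<close>

lemma exponential_growth_comparison:
  fixes c d A B :: real
  assumes le: "\<And>n. c ^ n \<le> (A * real n + B) * d ^ n" and c: "c \<ge> 0" and d: "d \<ge> 0"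
  shows "c \<le> d"
proof (rule ccontr)
  assume "\<not> c \<le> d"
  then have cd: "c > d" "c > 0" using d by auto
  show False
  proof (cases "d = 0")
    case True
    then show False using le[of 1] cd by simp
  next
    case False
    define x where "x = c / d"
    have x: "x > 1" using False cd d by (simp add: x_def)
    have "(\<lambda>n. A * (real n / x ^ n) + B * (1 / x ^ n)) \<longlonglongrightarrow> A * 0 + B * 0"
      using x by (intro tendsto_intros lim_n_over_pown LIMSEQ_divide_realpow_zero) auto
    then have "eventually (\<lambda>n. A * (real n / x ^ n) + B * (1 / x ^ n) < 1) sequentially"
      by (intro order_tendstoD(2)[of _ "A * 0 + B * 0"]) auto
    then obtain n where n: "A * (real n / x ^ n) + B * (1 / x ^ n) < 1"
      by (auto simp: eventually_sequentially)
    have "x ^ n \<le> A * real n + B"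
      using le[of n] False d by (simp add: x_def power_divide divide_le_eq)
    moreover have "A * real n + B < x ^ n" using n x by (simp add: field_simps)
    ultimately show False by simp
  qed
qed

section \<open>Absolute values and binomial estimates\<close>

context
  fixes K :: "'a :: field_char_0 set" and v :: "'a \<Rightarrow> real"
  assumes K: "subfield K Rg" and v: "absolute_value K v"
begin

lemma av_nonneg: "x \<in> K \<Longrightarrow> v x \<ge> 0"
  and av_eq_0: "x \<in> K \<Longrightarrow> v x = 0 \<longleftrightarrow> x = 0"
  and av_mult: "x \<in> K \<Longrightarrow> y \<in> K \<Longrightarrow> v (x * y) = v x * v y"
  and av_add: "x \<in> K \<Longrightarrow> y \<in> K \<Longrightarrow> v (x + y) \<le> v x + v y"
  using v by (auto simp: absolute_value_def)

lemma av_0: "v 0 = 0" using av_eq_0[OF sf_0[OF K]] by simp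

lemma av_1: "v 1 = 1" using av_mult[OF sf_1[OF K] sf_1[OF K]] av_eq_0[OF sf_1[OF K]] by simp

lemma av_uminus: "x \<in> K \<Longrightarrow> v (- x) = v x"
proof -
  assume x: "x \<in> K"
  have m: "-1 \<in> K" using sf_1[OF K] sf_uminus[OF K] by blast
  then have "v (-1) * v (-1) = 1" using av_mult[OF m m] av_1 by simp
  then have "v (-1) = 1" using av_nonneg[OF m] by (simp add: square_eq_1_iff)
  then show ?thesis using av_mult[OF m x] by simp
qed

lemma av_power: "x \<in> K \<Longrightarrow> v (x ^ n) = v x ^ n"
  by (induction n) (auto simp: av_1 av_mult sf_power[OF K])

lemma av_pos: "x \<in> K \<Longrightarrow> x \<noteq> 0 \<Longrightarrow> v x > 0"
  using av_nonneg av_eq_0 by (metis less_eq_real_def)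

lemma av_inverse: "x \<in> K \<Longrightarrow> v (inverse x) = inverse (v x)"
proof (cases "x = 0")
  case False
  assume x: "x \<in> K"
  then have "v x * v (inverse x) = 1"
    using False by (simp flip: av_mult add: sf_inverse[OF K] av_1)
  then show ?thesis by (metis inverse_unique)
qed (simp add: av_0)

lemma av_divide: "x \<in> K \<Longrightarrow> y \<in> K \<Longrightarrow> v (x / y) = v x / v y"
  by (simp add: divide_inverse av_mult av_inverse sf_inverse[OF K])

lemma av_sum: "(\<And>i. i \<in> I \<Longrightarrow> f i \<in> K) \<Longrightarrow> v (sum f I) \<le> (\<Sum>i\<in>I. v (f i))"
proof (induction I rule: infinite_finite_induct)
  case (insert i I)
  then have "v (sum f I) \<le> (\<Sum>i\<in>I. v (f i))" by simp
  moreover have "v (f i + sum f I) \<le> v (f i) + v (sum f I)"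
    using insert by (intro av_add sf_sum[OF K]) auto
  ultimately show ?case using insert by simp
qed (simp_all add: av_0)

lemma av_of_nat_le: "v (of_nat n) \<le> real n"
proof (induction n)
  case (Suc n)
  have "v (of_nat n + 1) \<le> v (of_nat n) + v 1" by (intro av_add sf_of_nat sf_1 K)
  then show ?case using Suc av_1 by (simp add: add.commute)
qed (simp add: av_0)

text \<open>A bound on the terms of the binomial expansions of all powers of \<open>x + y\<close> bounds \<open>v (x + y)\<close>,
  because the number of terms grows only linearly.\<close>

lemma av_binomial:
  assumes x: "x \<in> K" "y \<in> K" and M: "M \<ge> 0"
    and le: "\<And>n k. k \<le> n \<Longrightarrow> v (of_nat (n choose k)) * v x ^ k * v y ^ (n - k) \<le> M ^ n"
  shows "v (x + y) \<le> M"
proof -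
  have "v (x + y) ^ n \<le> (1 * real n + 1) * M ^ n" for n
  proof -
    have "v (x + y) ^ n = v ((x + y) ^ n)" using x by (simp add: av_power sf_add[OF K])
    also have "\<dots> = v (\<Sum>k\<le>n. of_nat (n choose k) * x ^ k * y ^ (n - k))"
      by (simp add: binomial_ring)
    also have "\<dots> \<le> (\<Sum>k\<le>n. v (of_nat (n choose k) * x ^ k * y ^ (n - k)))"
      using x by (intro av_sum sf_mult[OF K] sf_power[OF K] sf_of_nat[OF K])
    also have "\<dots> \<le> (\<Sum>k\<le>n. M ^ n)"
      using x le by (intro sum_mono)
        (simp add: av_mult av_power sf_mult[OF K] sf_power[OF K] sf_of_nat[OF K])
    finally show ?thesis by (simp add: add.commute)
  qed
  then show ?thesis
    by (rule exponential_growth_comparison) (use x M in \<open>auto intro!: av_nonneg sf_add[OF K]\<close>)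
qed

text \<open>With \<open>v x\<close> and \<open>v y\<close> written as \<open>p powr s\<close> and
  \<open>q powr s\<close>, each binomial term has size at most the \<open>s\<close>-th power of a
  term in the expansion of \<open>(p + q) ^ n\<close>.\<close>

lemma av_powr_subadditive:
  assumes x: "x \<in> K" "y \<in> K" and b: "s > 0" "\<And>n. v (of_nat n) \<le> real n powr s"
  shows "v (x + y) \<le> (v x powr (1/s) + v y powr (1/s)) powr s"
proof -
  define p q where "p = v x powr (1/s)" and "q = v y powr (1/s)"
  have nonneg: "p \<ge> 0" "q \<ge> 0" by (auto simp: p_def q_def)
  have pw: "v x = p powr s" "v y = q powr s"
    using av_nonneg x b(1) by (auto simp: p_def q_def powr_powr)
  have pwn: "(u powr s) ^ k = (u ^ k) powr s" if "u \<ge> 0" for u k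
  proof (cases "u = 0")
    case False
    then have "u > 0" using that by simp
    then show ?thesis by (simp add: powr_realpow[symmetric] powr_powr mult.commute)
  qed (cases k, auto)
  have "v (x + y) \<le> (p + q) powr s"
  proof (rule av_binomial[OF x])
    fix n k :: nat assume k: "k \<le> n"
    have "v (of_nat (n choose k)) * v x ^ k * v y ^ (n - k)
        \<le> real (n choose k) powr s * (p ^ k) powr s * (q ^ (n - k)) powr s"
      using nonneg b(2) by (simp add: pw pwn mult_right_mono)
    also have "\<dots> = (real (n choose k) * p ^ k * q ^ (n - k)) powr s"
      using nonneg by (simp add: powr_mult)
    also have "\<dots> \<le> ((p + q) ^ n) powr s"
    proof (rule powr_mono2)
      have "real (n choose k) * p ^ k * q ^ (n - k) \<le> (\<Sum>k\<le>n. real (n choose k) * p ^ k * q ^ (n - k))"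
        using k nonneg by (intro member_le_sum) auto
      then show "real (n choose k) * p ^ k * q ^ (n - k) \<le> (p + q) ^ n"
        by (simp add: binomial_ring)
    qed (use b nonneg in auto)
    finally show "v (of_nat (n choose k)) * v x ^ k * v y ^ (n - k) \<le> ((p + q) powr s) ^ n"
      using nonneg by (simp add: pwn)
  qed simp
  then show ?thesis by (simp add: p_def q_def)
qed

text \<open>Needed to normalize: a power with exponent above 1 of an absolute value can violate the
  triangle inequality, and the growth bound on integers excludes this.\<close>

lemma av_root:
  assumes s: "s > 0" "\<And>n. v (of_nat n) \<le> real n powr s"
  shows "absolute_value K (restrict (\<lambda>x. v x powr (1/s)) K)"
  unfolding absolute_value_def
proof (intro conjI ballI)
  fix x y assume xy: "x \<in> K" "y \<in> K"
  show "restrict (\<lambda>x. v x powr (1/s)) K (x * y)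
      = restrict (\<lambda>x. v x powr (1/s)) K x * restrict (\<lambda>x. v x powr (1/s)) K y"
    using xy by (simp add: sf_mult[OF K] av_mult powr_mult av_nonneg)
  have "v (x + y) powr (1/s) \<le> ((v x powr (1/s) + v y powr (1/s)) powr s) powr (1/s)"
    using s xy by (intro powr_mono2 av_powr_subadditive av_nonneg sf_add[OF K]) auto
  also have "\<dots> = v x powr (1/s) + v y powr (1/s)"
    using s(1) by (simp add: powr_powr)
  finally show "restrict (\<lambda>x. v x powr (1/s)) K (x + y)
      \<le> restrict (\<lambda>x. v x powr (1/s)) K x + restrict (\<lambda>x. v x powr (1/s)) K y"
    using xy by (simp add: sf_add[OF K])
qed (use s(1) av_eq_0 in auto)

text \<open>Binomial coefficients have value at most 1, so each term of the expansion is at most the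
  \<open>n\<close>-th power of the maximum.\<close>

lemma av_ultrametric:
  assumes nat: "\<And>n. v (of_nat n) \<le> 1" and x: "x \<in> K" "y \<in> K"
  shows "v (x + y) \<le> max (v x) (v y)"
proof (rule av_binomial[OF x])
  let ?M = "max (v x) (v y)"
  show M: "?M \<ge> 0" using av_nonneg x by (simp add: le_max_iff_disj)
  fix n k :: nat assume k: "k \<le> n"
  have "v (of_nat (n choose k)) * v x ^ k * v y ^ (n - k) \<le> 1 * ?M ^ k * ?M ^ (n - k)"
    using nat x M by (intro mult_mono power_mono)
      (auto intro!: av_nonneg mult_nonneg_nonneg zero_le_power sf_of_nat[OF K])
  also have "\<dots> = ?M ^ n" using k by (simp flip: power_add)
  finally show "v (of_nat (n choose k)) * v x ^ k * v y ^ (n - k) \<le> ?M ^ n" .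
qed

lemma av_ultrametric_sum:
  assumes nat: "\<And>n. v (of_nat n) \<le> 1"
    and f: "\<And>i. i \<in> I \<Longrightarrow> f i \<in> K" "\<And>i. i \<in> I \<Longrightarrow> v (f i) \<le> B" and B: "B \<ge> 0"
  shows "v (sum f I) \<le> B"
  using f
proof (induction I rule: infinite_finite_induct)
  case (insert i I)
  have "v (f i + sum f I) \<le> max (v (f i)) (v (sum f I))"
    using insert by (intro av_ultrametric[OF nat] sf_sum[OF K]) auto
  then show ?case using insert by fastforce
qed (use B av_0 in auto)

text \<open>For \<open>v x > 1\<close> the leading term alone would exceed all the others. Only the
  value of the leading coefficient must be 1, so integer polynomials with leading coefficient prime
  to \<open>p\<close> are covered.\<close>

lemma av_integral_le_1:
  assumes nat: "\<And>n. v (of_nat n) \<le> 1" and x: "x \<in> K"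
    and p: "\<And>i. coeff p i \<in> K" "\<And>i. v (coeff p i) \<le> 1" "v (lead_coeff p) = 1" "poly p x = 0"
  shows "v x \<le> 1"
proof (rule ccontr)
  assume "\<not> v x \<le> 1"
  then have gt: "v x > 1" by simp
  define n where "n = degree p"
  have p0: "p \<noteq> 0" using p(3) av_0 by auto
  then have n: "n > 0"
    using p(4) unfolding n_def by (metis degree_eq_zeroE gr0I pCons_0_0 poly_const_conv)
  have "poly p x = (\<Sum>i<n. coeff p i * x ^ i) + coeff p n * x ^ n"
    by (simp add: poly_altdef n_def flip: lessThan_Suc_atMost)
  then have "coeff p n * x ^ n = - (\<Sum>i<n. coeff p i * x ^ i)" using p(4)
    by (simp add: eq_neg_iff_add_eq_0 add.commute)
  moreover have "(\<Sum>i<n. coeff p i * x ^ i) \<in> K"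
    using p x by (intro sf_sum[OF K] sf_mult[OF K] sf_power[OF K])
  ultimately have "v (coeff p n * x ^ n) = v (\<Sum>i<n. coeff p i * x ^ i)"
    by (simp add: av_uminus)
  also have "\<dots> \<le> v x ^ (n - 1)"
  proof (rule av_ultrametric_sum[OF nat])
    fix i assume i: "i \<in> {..<n}"
    have "v (coeff p i * x ^ i) = v (coeff p i) * v x ^ i"
      using p x by (simp add: av_mult av_power sf_power[OF K])
    also have "\<dots> \<le> 1 * v x ^ (n - 1)"
      using p(2) gt i by (intro mult_mono power_increasing) auto
    finally show "v (coeff p i * x ^ i) \<le> v x ^ (n - 1)" by simp
    show "coeff p i * x ^ i \<in> K" using p x by (intro sf_mult[OF K] sf_power[OF K])
  qed (use gt in simp)
  finally have "v x ^ n \<le> v x ^ (n - 1)"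
    using p x by (simp add: av_mult av_power sf_power[OF K] n_def)
  moreover have "v x ^ (n - 1) < v x ^ n" using gt n by (intro power_strict_increasing) auto
  ultimately show False by simp
qed

end

section \<open>Comparison of values at integers, and Ostrowski's theorem\<close>

text \<open>The archimedean case of Ostrowski's theorem compares \<open>v m\<close> and \<open>v n\<close> by expanding powers
  of \<open>m\<close> in base \<open>n\<close>.\<close>

context
  fixes K :: "'a :: field_char_0 set" and v :: "'a \<Rightarrow> real"
  assumes K: "subfield K Rg" and v: "absolute_value K v"
begin

text \<open>Splitting off the last base \<open>n\<close> digit by division with remainder. Each of
  the \<open>L + 1\<close> digits has value at most \<open>n\<close>, and the maximum with 1 lets a
  single power bound all the powers of \<open>n\<close>.\<close>

lemma av_base_expansion:
  assumes n: "n \<ge> 2" and m: "m < n ^ Suc L"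
  shows "v (of_nat m) \<le> real n * (real L + 1) * (max 1 (v (of_nat n))) ^ L"
  using m
proof (induction L arbitrary: m)
  case 0
  then show ?case using av_of_nat_le[OF K v, of m] by simp
next
  case (Suc L)
  let ?N = "max 1 (v (of_nat n))"
  define q r where "q = m div n" and "r = m mod n"
  have m: "m = q * n + r" by (simp add: q_def r_def)
  have r: "r < n" using n by (simp add: r_def)
  have "q < n ^ Suc L" using Suc.prems n by (simp add: q_def less_mult_imp_div_less mult.commute)
  from Suc.IH[OF this] have q: "v (of_nat q) \<le> real n * (real L + 1) * ?N ^ L" .
  have "v (of_nat m) \<le> v (of_nat q * of_nat n) + v (of_nat r)"
    unfolding m of_nat_add of_nat_mult by (intro av_add[OF K v] sf_mult[OF K] sf_of_nat[OF K])
  also have "\<dots> = v (of_nat q) * v (of_nat n) + v (of_nat r)"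
    by (simp add: av_mult[OF K v] sf_of_nat[OF K])
  also have "\<dots> \<le> (real n * (real L + 1) * ?N ^ L) * ?N + real n * ?N ^ Suc L"
  proof (intro add_mono mult_mono q)
    have "v (of_nat r) \<le> real n * 1" using av_of_nat_le[OF K v, of r] r by simp
    also have "\<dots> \<le> real n * ?N ^ Suc L"
      by (intro mult_left_mono one_le_power) auto
    finally show "v (of_nat r) \<le> real n * ?N ^ Suc L" .
  qed (auto intro: av_nonneg[OF K v] sf_of_nat[OF K])
  also have "\<dots> = real n * (real (Suc L) + 1) * ?N ^ Suc L" by (simp add: algebra_simps)
  finally show ?case .
qed

lemma av_compare:
  assumes n: "n \<ge> 2" and m: "m \<ge> 2"
  shows "v (of_nat m) \<le> max 1 (v (of_nat n)) powr (ln m / ln n)"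
proof (rule exponential_growth_comparison)
  fix k :: nat
  let ?N = "max 1 (v (of_nat n))" and ?\<theta> = "ln (real m) / ln (real n)"
  \<comment> \<open>With this \<open>L\<close> the power \<open>m ^ k\<close> has at most
    \<open>L + 1\<close> digits in base \<open>n\<close>. As \<open>L\<close> grows linearly in
    \<open>k\<close>, the factor in front of the exponential is linear.\<close>
  define L where "L = nat \<lfloor>k * ?\<theta>\<rfloor>"
  have ln: "ln (real n) > 0" "ln (real m) > 0" using n m by auto
  have L: "real L \<le> k * ?\<theta>" "k * ?\<theta> < real L + 1"
  proof -
    have "k * ?\<theta> \<ge> 0" using ln by simp
    then show "real L \<le> k * ?\<theta>" "k * ?\<theta> < real L + 1" unfolding L_def by linarith+
  qed
  have "real (m ^ k) = exp (k * ln m)" using m by (simp add: exp_of_nat_mult)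
  also have "\<dots> < exp ((real L + 1) * ln n)"
    using L(2) ln by (simp add: field_simps)
  also have "\<dots> = real (n ^ Suc L)"
    using n exp_of_nat_mult[of "Suc L" "ln (real n)"] by (simp add: add.commute)
  finally have "m ^ k < n ^ Suc L" by (simp only: of_nat_less_iff)
  from av_base_expansion[OF n this]
  have "v (of_nat m) ^ k \<le> real n * (real L + 1) * ?N ^ L"
    by (simp add: av_power[OF K v] sf_of_nat[OF K])
  also have "\<dots> \<le> real n * (k * ?\<theta> + 1) * (?N powr ?\<theta>) ^ k"
  proof (intro mult_mono)
    have "?N ^ L = ?N powr L" by (simp add: powr_realpow)
    also have "\<dots> \<le> ?N powr (k * ?\<theta>)" using L by (intro powr_mono) auto
    also have "\<dots> = (?N powr ?\<theta>) ^ k" by (simp add: powr_powr mult.commute flip: powr_realpow)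
    finally show "?N ^ L \<le> (?N powr ?\<theta>) ^ k" .
  qed (use L ln in auto)
  also have "\<dots> = (real n * ?\<theta> * k + real n) * (?N powr ?\<theta>) ^ k" by (simp add: algebra_simps)
  finally show "v (of_nat m) ^ k \<le> (real n * ?\<theta> * k + real n) * (?N powr ?\<theta>) ^ k" .
qed (auto intro: av_nonneg[OF K v] sf_of_nat[OF K])

lemma av_of_int: "v (of_int z) = v (of_nat (nat \<bar>z\<bar>))"
  by (cases z rule: int_cases2) (simp_all add: av_uminus[OF K v] sf_of_nat[OF K])

lemma av_of_rat: 
  "v (of_rat r) = v (of_int (fst (quotient_of r))) / v (of_int (snd (quotient_of r)))"
proof -
  have "r = of_int (fst (quotient_of r)) / of_int (snd (quotient_of r))"
    using quotient_of_div[of r] by (cases "quotient_of r") auto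
  then have "of_rat r = (of_int (fst (quotient_of r)) / of_int (snd (quotient_of r)) :: 'a)"
    by (metis of_rat_divide of_rat_of_int_eq)
  then show ?thesis by (simp add: av_divide[OF K v] sf_of_int[OF K])
qed

text \<open>Exchanging the two integers in \<open>av_compare\<close> shows that the quotient of
  \<open>ln (v (of_nat m))\<close> by \<open>ln m\<close> is the same for all
  \<open>m \<ge> 2\<close>; this constant is \<open>s\<close>.\<close>

lemma ostrowski_archimedean:
  assumes "v (of_nat n0) > 1"
  shows "\<exists>s>0. \<forall>r. v (of_rat r) = \<bar>of_rat r\<bar> powr s"
proof -
  \<comment> \<open>If some \<open>n \<ge> 2\<close> had value at most 1, the comparison with base
    \<open>n\<close> would bound the value of \<open>n0\<close> by 1.\<close>
  have gt: "v (of_nat n) > 1" if "n \<ge> 2" for n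
  proof (rule ccontr)
    assume "\<not> v (of_nat n) > 1"
    moreover have "n0 \<ge> 2"
    proof (rule ccontr)
      assume "\<not> n0 \<ge> 2"
      then have "n0 = 0 \<or> n0 = 1" by auto
      then show False using assms av_0[OF K v] av_1[OF K v] by auto
    qed
    ultimately show False using av_compare[OF that, of n0] assms by (simp add: max_def split: if_splits)
  qed
  have le: "ln (v (of_nat m)) / ln m \<le> ln (v (of_nat n)) / ln n" if "m \<ge> 2" "n \<ge> 2" for m n
  proof -
    have "v (of_nat m) \<le> v (of_nat n) powr (ln m / ln n)"
      using av_compare[OF that(2,1)] gt[OF that(2)] by simp
    then have "ln (v (of_nat m)) \<le> ln (v (of_nat n) powr (ln m / ln n))"
      using gt[OF that(1)] by (intro ln_mono) auto
    then have "ln (v (of_nat m)) \<le> (ln m / ln n) * ln (v (of_nat n))"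
      using gt[OF that(2)] by (simp add: ln_powr)
    then show ?thesis using that by (simp add: field_simps)
  qed
  define s where "s = ln (v (of_nat 2)) / ln 2"
  have s: "s > 0" using gt[of 2] by (simp add: s_def)
  have nat: "v (of_nat m) = real m powr s" for m
  proof -
    consider "m = 0" | "m = 1" | "m \<ge> 2" by linarith
    then show ?thesis
    proof cases
      case 3
      then have "ln (v (of_nat m)) / ln m = s"
        unfolding s_def using le[of m 2] le[of 2 m] by simp
      then have "ln (v (of_nat m)) = s * ln m" using 3 by (simp add: field_simps)
      then have "exp (ln (v (of_nat m))) = real m powr s" using 3 by (simp add: powr_def)
      then show ?thesis using gt[OF 3] by simp
    qed (use s av_0[OF K v] av_1[OF K v] in auto)
  qed
  have "v (of_rat r) = \<bar>of_rat r\<bar> powr s" for r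
  proof -
    have "r = of_int (fst (quotient_of r)) / of_int (snd (quotient_of r))"
      using quotient_of_div[of r] by (cases "quotient_of r") auto
    then have "\<bar>of_rat r :: real\<bar> = \<bar>of_int (fst (quotient_of r))\<bar> / \<bar>of_int (snd (quotient_of r))\<bar>"
      by (metis abs_divide of_rat_divide of_rat_of_int_eq)
    moreover have "v (of_int z) = \<bar>of_int z\<bar> powr s" for z
      unfolding av_of_int nat by simp
    ultimately show ?thesis
      by (simp add: av_of_rat powr_divide)
  qed
  with s show ?thesis by blast
qed

lemma av_of_int_le_1: "(\<And>n. v (of_nat n) \<le> 1) \<Longrightarrow> v (of_int z) \<le> 1"
  by (subst av_of_int) blast

text \<open>Some prime \<open>p\<close> has value below 1, as otherwise all nonzero integers and
  hence all nonzero rationals would have value 1. Integers prime to \<open>p\<close> have value 1,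
  so the value only counts factors \<open>p\<close>, and \<open>s\<close> is fixed by its value at
  \<open>p\<close>.\<close>

lemma ostrowski_nonarchimedean:
  assumes nat: "\<And>n. v (of_nat n) \<le> 1" and nontriv: "r0 \<noteq> 0" "v (of_rat r0) \<noteq> 1"
  shows "\<exists>s>0. \<exists>p. prime p \<and> (\<forall>r. v (of_rat r) = padic_abs p r powr s)"
proof -
  have "\<exists>p. prime p \<and> v (of_nat p) < 1"
  proof (rule ccontr)
    assume no: "\<nexists>p. prime p \<and> v (of_nat p) < 1"
    have pr: "v (of_nat p) = 1" if "prime p" for p
    proof -
      have "\<not> v (of_nat p) < 1" using no that by blast
      with nat[of p] show ?thesis by linarith
    qed
    have one: "v (of_nat n) = 1" if "n > 0" for n
      using that
    proof (induction n rule: prime_divisors_induct)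
      case (factor p n)
      then show ?case using pr by (simp add: av_mult[OF K v] sf_of_nat[OF K])
    next
      case (unit n)
      then show ?case using av_1[OF K v] by simp
    qed simp
    have "v (of_int z) = 1" if "z \<noteq> 0" for z
      unfolding av_of_int using that by (intro one) simp
    then have "v (of_rat r0) = 1"
    proof -
      have "snd (quotient_of r0) \<noteq> 0" using quotient_of_denom_pos'[of r0] by simp
      moreover have "fst (quotient_of r0) \<noteq> 0"
        using nontriv(1) quotient_of_div[of r0 "fst (quotient_of r0)" "snd (quotient_of r0)"] by auto
      ultimately show ?thesis
        using \<open>\<And>z. z \<noteq> 0 \<Longrightarrow> v (of_int z) = 1\<close> by (simp add: av_of_rat)
    qed
    with nontriv show False by simp
  qed
  then obtain p where p: "prime p" "v (of_nat p) < 1" by blast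
  have vp: "v (of_nat p) > 0" using p(1) by (intro av_pos[OF K v] sf_of_nat[OF K]) auto
  define s where "s = - ln (v (of_nat p)) / ln p"
  have lnp: "ln (real p) > 0" using prime_gt_1_nat[OF p(1)] by simp
  have s: "s > 0" using p(2) vp lnp by (simp add: s_def field_simps)
  have vps: "v (of_nat p) = real p powr (- s)"
  proof -
    have "real p powr (- s) = exp (- s * ln p)" using prime_gt_0_nat[OF p(1)] by (simp add: powr_def)
    also have "- s * ln p = ln (v (of_nat p))" using lnp by (simp add: s_def)
    finally show ?thesis using vp by simp
  qed
  \<comment> \<open>If \<open>m\<close> had value below 1 as well, a Bezout relation and the
    ultrametric inequality would give 1 a value below 1.\<close>
  have unit: "v (of_int m) = 1" if m: "\<not> int p dvd m" for m
  proof (rule ccontr)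
    assume "v (of_int m) \<noteq> 1"
    then have lt: "v (of_int m) < 1" using av_of_int_le_1[OF nat, of m] by simp
    have "coprime (int p) m" using m p(1) by (simp add: prime_imp_coprime)
    then have "gcd (int p) m = 1" by simp
    then obtain a b where "a * int p + b * m = 1"
      using bezout_int[of "int p" m] by auto
    then have "of_int (a * int p + b * m) = (1 :: 'a)" by simp
    then have "1 = of_int a * of_nat p + (of_int b * of_int m :: 'a)" by simp
    moreover have "v (of_int a * of_nat p + of_int b * of_int m)
        \<le> max (v (of_int a * of_nat p)) (v (of_int b * of_int m))"
      by (intro av_ultrametric[OF K v nat] sf_mult[OF K] sf_of_int[OF K] sf_of_nat[OF K])
    ultimately have "v 1 \<le> max (v (of_int a * of_nat p)) (v (of_int b * of_int m))" by simp
    moreover have "v (of_int a * of_nat p) < 1" "v (of_int b * of_int m) < 1"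
    proof -
      have "v (of_int a) * v (of_nat p) \<le> 1 * v (of_nat p)"
        by (intro mult_right_mono av_of_int_le_1[OF nat] av_nonneg[OF K v] sf_of_nat[OF K])
      then show "v (of_int a * of_nat p) < 1"
        using p(2) by (simp add: av_mult[OF K v] sf_of_nat[OF K] sf_of_int[OF K])
      have "v (of_int b) * v (of_int m) \<le> 1 * v (of_int m)"
        by (intro mult_right_mono av_of_int_le_1[OF nat] av_nonneg[OF K v] sf_of_int[OF K])
      then show "v (of_int b * of_int m) < 1"
        using lt by (simp add: av_mult[OF K v] sf_of_int[OF K])
    qed
    ultimately show False using av_1[OF K v] by simp
  qed
  have int: "v (of_int m) = real p powr (- s * multiplicity (int p) m)" if m: "m \<noteq> 0" for m
  proof -
    obtain m' where m': "m = int p ^ multiplicity (int p) m * m'" "\<not> int p dvd m'"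
      using multiplicity_decompose'[of m "int p"] m prime_gt_1_nat[OF p(1)] by auto
    have "v (of_int m) = v (of_nat p ^ multiplicity (int p) m * of_int m')"
      by (subst m'(1)) simp
    also have "\<dots> = v (of_nat p) ^ multiplicity (int p) m"
      using unit[OF m'(2)]
      by (simp add: av_mult[OF K v] av_power[OF K v] sf_power[OF K] sf_of_nat[OF K] sf_of_int[OF K])
    also have "\<dots> = real p powr (- s * multiplicity (int p) m)"
      unfolding vps using p(1) prime_gt_0_nat[of p] by (simp add: powr_realpow[symmetric] powr_powr)
    finally show ?thesis .
  qed
  have "v (of_rat r) = padic_abs p r powr s" for r
  proof (cases "r = 0")
    case True
    then show ?thesis using s av_0[OF K v] by (simp add: padic_abs_def)
  next
    case False
    have den: "snd (quotient_of r) \<noteq> 0" using quotient_of_denom_pos'[of r] by simp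
    have num: "fst (quotient_of r) \<noteq> 0"
      using False quotient_of_div[of r "fst (quotient_of r)" "snd (quotient_of r)"] by auto
    have pos: "real p > 0" using prime_gt_0_nat[OF p(1)] by simp
    show ?thesis
      using False pos
      by (simp add: av_of_rat int[OF den] int[OF num] padic_abs_def powr_real_of_int'[symmetric]
          powr_powr flip: powr_diff) (simp add: algebra_simps)
  qed
  with s p(1) show ?thesis by blast
qed

text \<open>If the rationals had trivial values, the coefficients of a rational polynomial killing
  \<open>z\<close> would have value 0 or 1, so every element, and also its inverse, would have value
  at most 1.\<close>

lemma av_nontrivial_on_rationals:
  assumes alg: "\<forall>x :: 'a. algebraic x" and x: "x \<in> K" "x \<noteq> 0" "v x \<noteq> 1"
  shows "\<exists>r. r \<noteq> 0 \<and> v (of_rat r) \<noteq> 1"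
proof (rule ccontr)
  assume "\<nexists>r. r \<noteq> 0 \<and> v (of_rat r) \<noteq> 1"
  then have triv: "v (of_rat r) = 1" if "r \<noteq> 0" for r using that by blast
  then have rat: "v r = (if r = 0 then 0 else 1)" if "r \<in> \<rat>" for r
    using that av_0[OF K v] by (auto elim!: Rats_cases)
  have nat: "v (of_nat n) \<le> 1" for n using rat[of "of_nat n"] by simp
  have "v z \<le> 1" if z: "z \<in> K" for z
  proof -
    obtain p where p: "\<forall>i. coeff p i \<in> \<rat>" "p \<noteq> 0" "poly p z = 0"
      using alg unfolding algebraic_altdef by blast
    show ?thesis
      by (rule av_integral_le_1[OF K v nat z, of p]) (use p rat sf_Rats[OF K] in auto)
  qed
  then have "v x \<le> 1" "v (inverse x) \<le> 1" using x sf_inverse[OF K] by auto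
  moreover have "v x > 0" using av_pos[OF K v] x by simp
  ultimately show False using x(3) by (simp add: av_inverse[OF K v x(1)] inverse_le_1_iff)
qed

theorem ostrowski:
  assumes alg: "\<forall>x :: 'a. algebraic x" and "\<exists>x\<in>K. x \<noteq> 0 \<and> v x \<noteq> 1"
  shows "\<exists>s>0. (\<forall>r. v (of_rat r) = \<bar>of_rat r\<bar> powr s) \<or>
    (\<exists>p. prime p \<and> (\<forall>r. v (of_rat r) = padic_abs p r powr s))"
proof -
  obtain r0 where "r0 \<noteq> 0" "v (of_rat r0) \<noteq> 1"
    using av_nontrivial_on_rationals[OF alg] assms(2) by blast
  then show ?thesis
    using ostrowski_nonarchimedean[of r0] ostrowski_archimedean by (meson not_less)
qed

end

section \<open>Normalized absolute values\<close>

lemma padic_abs_nonneg: "padic_abs p r \<ge> 0"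
  by (simp add: padic_abs_def)

lemma padic_abs_of_int:
  "padic_abs p (of_int z) = (if z = 0 then 0 else real p powi (- int (multiplicity (int p) z)))"
  by (simp add: padic_abs_def)

lemma padic_abs_of_int_le_1:
  assumes "prime p" shows "padic_abs p (of_int z) \<le> 1"
proof -
  have "real p ^ multiplicity (int p) z \<ge> 1" using prime_ge_1_nat[OF assms] by (intro one_le_power) simp
  then show ?thesis by (simp add: padic_abs_of_int power_int_minus inverse_le_1_iff)
qed

lemma padic_abs_of_int_unit: "z \<noteq> 0 \<Longrightarrow> \<not> int p dvd z \<Longrightarrow> padic_abs p (of_int z) = 1"
  by (simp add: padic_abs_of_int not_dvd_imp_multiplicity_0)

lemma padic_abs_self:
  assumes "prime p" shows "padic_abs p (of_nat p) = 1 / p"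
proof -
  have "multiplicity (int p) (int p) = 1"
    using assms prime_gt_1_nat[OF assms] by (intro multiplicity_self) auto
  then have "padic_abs p (of_int (int p)) = 1 / p"
    using prime_gt_0_nat[OF assms] by (subst padic_abs_of_int) (simp add: power_int_minus inverse_eq_divide)
  then show ?thesis by simp
qed

lemma padic_abs_other_prime:
  assumes "prime p" "prime q" "p \<noteq> q"
  shows "padic_abs p (of_nat q) = 1"
proof -
  have "\<not> int p dvd int q" using assms primes_dvd_imp_eq[of p q] by auto
  then have "padic_abs p (of_int (int q)) = 1"
    using prime_gt_0_nat[OF assms(2)] by (intro padic_abs_of_int_unit) auto
  then show ?thesis by simp
qed

text \<open>Each place contains exactly one such absolute value. Sums over the places of a number
  field are written as sums over these representatives.\<close>

definition normalized :: "'a :: field_char_0 set \<Rightarrow> ('a \<Rightarrow> real) \<Rightarrow> bool" where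
  "normalized K b \<longleftrightarrow> absolute_value K b \<and> extends_usual_abs b"

definition place_of :: "'a :: field set \<Rightarrow> ('a \<Rightarrow> real) \<Rightarrow> 'a place" where
  "place_of K b = {c. absolute_value K c \<and> equivalent_absolute_values K b c}"

lemma extends_usual_of_nat_le:
  assumes "extends_usual_abs (b :: 'a :: field_char_0 \<Rightarrow> real)" shows "b (of_nat n) \<le> n"
proof -
  have eq: "b (of_nat n) = b (of_rat (of_nat n))" by simp
  consider "\<forall>r. b (of_rat r) = \<bar>of_rat r\<bar>"
    | p where "prime p" "\<forall>r. b (of_rat r) = padic_abs p r"
    using assms by (auto simp: extends_usual_abs_def)
  then show ?thesis
  proof cases
    case 2
    have "b (of_nat n) = padic_abs p (of_int (int n))" using 2(2)[rule_format, of "of_nat n"] by simp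
    then show ?thesis
      using padic_abs_of_int_le_1[OF 2(1), of "int n"] padic_abs_of_int[of p "int n"] by (cases "n = 0") auto
  qed (simp add: eq del: of_rat_of_nat_eq, simp)
qed

text \<open>The witnesses are 2 in the archimedean case and the inverse of \<open>p\<close> in the
  p-adic case.\<close>

lemma extends_usual_exists_big:
  assumes "extends_usual_abs (b :: 'a :: field_char_0 \<Rightarrow> real)" shows "\<exists>r. r \<noteq> 0 \<and> b (of_rat r) > 1"
proof -
  consider "\<forall>r. b (of_rat r) = \<bar>of_rat r\<bar>"
    | p where "prime p" "\<forall>r. b (of_rat r) = padic_abs p r"
    using assms by (auto simp: extends_usual_abs_def)
  then show ?thesis
  proof cases
    case 1
    then have "b (of_rat 2) = 2" by (metis abs_numeral of_rat_numeral_eq)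
    then show ?thesis by (intro exI[of _ 2]) simp
  next
    case 2
    have p: "p > 1" using prime_gt_1_nat[OF 2(1)] .
    have "quotient_of (1 / of_nat p) = (1, int p)"
      using p quotient_of_Fract[of 1 "int p"] by (simp add: Fract_of_int_quotient)
    moreover have "multiplicity (int p) (int p) = 1" using p by (intro multiplicity_self) auto
    ultimately have "padic_abs p (1 / of_nat p) = p" using p by (simp add: padic_abs_def)
    then show ?thesis using 2(2) p by (intro exI[of _ "1 / of_nat p"]) auto
  qed
qed

text \<open>The exponent is 1, as seen at 2 or at \<open>p\<close>. An archimedean and a p-adic
  value cannot be equivalent, as \<open>p\<close> is large for one and small for the other; the same
  test separates different primes.\<close>

lemma normalized_equivalent_eq:
  assumes b: "normalized K b" and c: "normalized K c" and K: "subfield K (Rg :: 'a :: field_char_0 ring)"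
    and eq: "equivalent_absolute_values K b c"
  shows "b = c"
proof -
  obtain s where s: "s > 0" "\<forall>x\<in>K. c x = b x powr s"
    using eq by (auto simp: equivalent_absolute_values_def)
  then have sr: "c (of_rat r) = b (of_rat r) powr s" for r using sf_of_rat[OF K] by blast
  have "s = 1"
  proof -
    consider (inf) "\<forall>r. b (of_rat r) = \<bar>of_rat r\<bar>" "\<forall>r. c (of_rat r) = \<bar>of_rat r\<bar>"
      | (infp) p where "\<forall>r. b (of_rat r) = \<bar>of_rat r\<bar>" "prime p" "\<forall>r. c (of_rat r) = padic_abs p r"
      | (p) p where "prime p" "\<forall>r. b (of_rat r) = padic_abs p r" "extends_usual_abs c"
      using b c by (auto simp: normalized_def extends_usual_abs_def)
    then show ?thesis
    proof cases
      case inf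
      then have "b (of_rat 2) = 2" "c (of_rat 2) = 2" by (metis abs_numeral of_rat_numeral_eq)+
      then have "(2 :: real) = 2 powr s" using sr[of 2] by simp
      then have "(2 :: real) powr 1 = 2 powr s" by simp
      then show ?thesis by (subst (asm) powr_inj) auto
    next
      case infp
      have "padic_abs p (of_nat p) = real p powr s" using sr[of "of_nat p"] infp(1)[rule_format, of "of_nat p"]
          infp(3)[rule_format, of "of_nat p"] by simp
      then have "1 / real p = real p powr s" using padic_abs_self[OF infp(2)] by simp
      moreover have "real p powr s > 1"
        using s(1) prime_gt_1_nat[OF infp(2)] by (intro gr_one_powr) auto
      moreover have "1 / real p < 1" using prime_gt_1_nat[OF infp(2)] by simp
      ultimately show ?thesis by simp
    next
      case p
      have p1: "real p > 1" using prime_gt_1_nat[OF p(1)] by simp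
      have cp: "c (of_nat p) = (1 / real p) powr s"
        using sr[of "of_nat p"] p(2)[rule_format, of "of_nat p"] padic_abs_self[OF p(1)] by simp
      have "(1 / real p) powr s < 1"
        using powr_less_mono2[of s "1 / real p" 1] s(1) p1 by simp
      with cp have lt: "c (of_nat p) < 1" by simp
      have "c (of_nat p) = 1 / real p"
      proof -
        consider "\<forall>r. c (of_rat r) = \<bar>of_rat r\<bar>"
          | q where "prime q" "\<forall>r. c (of_rat r) = padic_abs q r"
          using p(3) by (auto simp: extends_usual_abs_def)
        then show ?thesis
        proof cases
          case 1
          then have "c (of_rat (of_nat p)) = p" using 1[rule_format, of "of_nat p"] by (simp only: of_rat_of_nat_eq abs_of_nat)
          then show ?thesis using lt p1 by simp
        next
          case 2
          then have "c (of_rat (of_nat p)) = padic_abs q (of_nat p)" by blast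
          then have cq: "c (of_nat p) = padic_abs q (of_nat p)" by simp
          then have "q = p" using lt padic_abs_other_prime[OF 2(1) p(1)] by force
          then show ?thesis using cq padic_abs_self[OF p(1)] by simp
        qed
      qed
      with cp have "(1 / real p) powr 1 = (1 / real p) powr s" by simp
      then show ?thesis using p1 by (subst (asm) powr_inj) auto
    qed
  qed
  then have "b x = c x" if "x \<in> K" for x
    using s(2) b that by (auto simp: normalized_def absolute_value_def)
  then show ?thesis
    using b c by (intro extensionalityI[of _ K]) (auto simp: normalized_def absolute_value_def)
qed

section \<open>Places and their normalized representatives\<close>

lemma equivalent_refl: "absolute_value K b \<Longrightarrow> equivalent_absolute_values K b b"
  unfolding equivalent_absolute_values_def absolute_value_def by (intro exI[of _ 1]) auto

lemma equivalent_sym: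
  assumes "equivalent_absolute_values K b c" "absolute_value K b"
  shows "equivalent_absolute_values K c b"
proof -
  obtain s where s: "s > 0" "\<forall>x\<in>K. c x = b x powr s"
    using assms(1) by (auto simp: equivalent_absolute_values_def)
  then have "\<forall>x\<in>K. b x = c x powr (1/s)"
    using assms(2) by (simp add: powr_powr absolute_value_def)
  then show ?thesis using s(1) unfolding equivalent_absolute_values_def by (intro exI[of _ "1/s"]) simp
qed

lemma equivalent_trans:
  assumes "equivalent_absolute_values K b c" "equivalent_absolute_values K c d"
  shows "equivalent_absolute_values K b d"
proof -
  obtain s t where s: "s > 0" "\<forall>x\<in>K. c x = b x powr s" and t: "t > 0" "\<forall>x\<in>K. d x = c x powr t"
    using assms by (auto simp: equivalent_absolute_values_def)
  then have "\<forall>x\<in>K. d x = b x powr (s * t)" by (simp add: powr_powr)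
  with s(1) t(1) show ?thesis
    unfolding equivalent_absolute_values_def by (intro exI[of _ "s * t"]) simp
qed

lemma place_of_eq:
  assumes "absolute_value K b" "absolute_value K c" "equivalent_absolute_values K b c"
  shows "place_of K b = place_of K c"
  using assms equivalent_sym[of K b c] equivalent_trans unfolding place_of_def by blast

lemma place_of_normalized_mem:
  assumes K: "subfield K (Rg :: 'a :: field_char_0 ring)" and b: "normalized K b"
  shows "place_of K b \<in> places K"
proof -
  obtain r where "r \<noteq> 0" "b (of_rat r) > 1"
    using extends_usual_exists_big b by (auto simp: normalized_def)
  then have "nontrivial_absolute_value K b"
    using b sf_of_rat[OF K, of r] unfolding nontrivial_absolute_value_def normalized_def
    by (metis of_rat_eq_0_iff less_irrefl)
  then show ?thesis unfolding places_def place_of_def by blast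
qed

text \<open>By Ostrowski the given absolute value is an \<open>s\<close>-th power of a usual one on
  the rationals. Its \<open>s\<close>-th root is normalized, and \<open>av_root\<close> gives the
  triangle inequality.\<close>

lemma place_has_normalized:
  assumes alg: "\<forall>x :: 'a :: field_char_0. algebraic x"
    and K: "subfield K (Rg :: 'a ring)" and y: "y \<in> places K"
  shows "\<exists>b. normalized K b \<and> y = place_of K b"
proof -
  obtain a where a: "nontrivial_absolute_value K a" "y = place_of K a"
    using y by (auto simp: places_def place_of_def)
  then have av: "absolute_value K a" by (simp add: nontrivial_absolute_value_def)
  obtain s where s: "s > 0" and cases:
    "(\<forall>r. a (of_rat r) = \<bar>of_rat r\<bar> powr s) \<or>
     (\<exists>p. prime p \<and> (\<forall>r. a (of_rat r) = padic_abs p r powr s))"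
    using ostrowski[OF K av alg] a(1) by (auto simp: nontrivial_absolute_value_def)
  define b where "b = restrict (\<lambda>x. a x powr (1/s)) K"
  have br: "b (of_rat r) = a (of_rat r) powr (1/s)" for r
    by (simp add: b_def sf_of_rat[OF K])
  have ext: "extends_usual_abs b"
    using cases s unfolding extends_usual_abs_def br by (auto simp: powr_powr padic_abs_nonneg)
  have "a (of_nat n) \<le> real n powr s" for n
  proof -
    have "a (of_nat n) = b (of_nat n) powr s"
      using s av by (simp add: b_def sf_of_nat[OF K] powr_powr av_nonneg[OF K])
    also have "\<dots> \<le> real n powr s"
      using s extends_usual_of_nat_le[OF ext, of n]
      by (intro powr_mono2) (auto simp: b_def sf_of_nat[OF K])
    finally show ?thesis .
  qed
  then have "absolute_value K b" unfolding b_def by (rule av_root[OF K av s])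
  moreover have "equivalent_absolute_values K a b"
    unfolding equivalent_absolute_values_def b_def using s by (intro exI[of _ "1/s"]) simp
  ultimately show ?thesis using ext a(2) place_of_eq[OF av] by (auto simp: normalized_def)
qed

lemma place_abs_place_of:
  assumes b: "normalized (UNIV :: 'a :: field_char_0 set) b"
  shows "place_abs (place_of UNIV b) = b"
  unfolding place_abs_def
proof (rule the_equality)
  have U: "subfield UNIV (Rg :: 'a ring)" by (simp add: subfield_Rg_iff)
  show "b \<in> place_of UNIV b \<and> extends_usual_abs b"
    using b equivalent_refl by (auto simp: place_of_def normalized_def)
  fix a assume "a \<in> place_of UNIV b \<and> extends_usual_abs a"
  then show "a = b"
    using normalized_equivalent_eq[OF b _ U, of a] by (auto simp: place_of_def normalized_def)
qed

lemma normalized_restrict: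
  assumes b: "normalized UNIV b" and K: "subfield K (Rg :: 'a :: field_char_0 ring)"
  shows "normalized K (restrict b K)"
  using b K unfolding normalized_def absolute_value_def extends_usual_abs_def
  by (simp add: sf_of_rat[OF K] sf_mult[OF K] sf_add[OF K])

text \<open>For fixed \<open>K\<close> the basic sets become the fibres of one restriction map on
  normalized absolute values; this makes products of logarithms into finite sums of
  indicators.\<close>

lemma places_above_place_of:
  assumes alg: "\<forall>x :: 'a :: field_char_0. algebraic x"
    and K: "subfield K (Rg :: 'a ring)" and c: "normalized K c"
  shows "places_above K (place_of K c) = {y \<in> places_Qbar. restrict (place_abs y) K = c}"
proof -
  have U: "subfield UNIV (Rg :: 'a ring)" by (simp add: subfield_Rg_iff)
  have "lies_above y K (place_of K c) \<longleftrightarrow> restrict (place_abs y) K = c" if y: "y \<in> places_Qbar" for y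
  proof -
    obtain b where b: "normalized UNIV b" "y = place_of UNIV b"
      using place_has_normalized[OF alg U y] by blast
    have pa: "place_abs y = b" using place_abs_place_of b by simp
    have bK: "normalized K (restrict b K)" by (rule normalized_restrict[OF b(1) K])
    show ?thesis
    proof
      assume *: "lies_above y K (place_of K c)"
      have "b \<in> y" using b equivalent_refl by (auto simp: place_of_def normalized_def)
      then have "restrict b K \<in> place_of K c" using * by (auto simp: lies_above_def)
      then show "restrict (place_abs y) K = c"
        unfolding pa using normalized_equivalent_eq[OF c bK K] by (simp add: place_of_def)
    next
      assume eq: "restrict (place_abs y) K = c"
      show "lies_above y K (place_of K c)"
        unfolding lies_above_def
      proof
        fix a assume "a \<in> y"
        then have a: "absolute_value UNIV a" "equivalent_absolute_values UNIV b a"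
          using b(2) by (auto simp: place_of_def)
        have "absolute_value K (restrict a K)"
          using a(1) unfolding absolute_value_def by (simp add: sf_mult[OF K] sf_add[OF K])
        moreover have "equivalent_absolute_values K c (restrict a K)"
          using a(2) eq pa unfolding equivalent_absolute_values_def by auto
        ultimately show "restrict a K \<in> place_of K c" by (simp add: place_of_def)
      qed
    qed
  qed
  then show ?thesis unfolding places_above_def by blast
qed

section \<open>Weak approximation and finiteness of the set of relevant absolute values\<close>

text \<open>Some \<open>z\<close> has \<open>a z < b z\<close>. A high power of \<open>z\<close>
  makes the ratio of the two values exceed \<open>C\<close>, the common value of the rational
  \<open>r\<close>; multiplying by a power of \<open>r\<close> shifts both values together until 1
  lies between them.\<close>

lemma separate_two:
  assumes K: "subfield K (Rg :: 'a :: field_char_0 ring)" and a: "absolute_value K a" and b: "absolute_value K b"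
    and eq: "\<And>r. a (of_rat r) = b (of_rat r)" and r: "a (of_rat r) > 1" and ne: "a \<noteq> b"
  shows "\<exists>x\<in>K. a x < 1 \<and> b x > 1"
proof -
  obtain x where x: "x \<in> K" "a x \<noteq> b x"
    using ne a b extensionalityI[of a K b] by (auto simp: absolute_value_def)
  have x0: "x \<noteq> 0" using x av_0[OF K a] av_0[OF K b] by auto
  obtain z where z: "z \<in> K" "a z < b z"
  proof (cases "a x < b x")
    case False
    then have "a (inverse x) < b (inverse x)"
      using x x0 av_inverse[OF K a x(1)] av_inverse[OF K b x(1)] av_pos[OF K b x(1) x0]
      by (simp add: less_imp_inverse_less)
    then show ?thesis using that sf_inverse[OF K x(1)] by blast
  qed (use x that in blast)
  then have z0: "z \<noteq> 0" using av_0[OF K a] av_0[OF K b] by auto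
  define C where "C = a (of_rat r)"
  have az: "a z > 0" using av_pos[OF K a z(1) z0] .
  have "b z / a z > 1" using z az by simp
  then obtain n where n: "(b z / a z) ^ n > C" using real_arch_pow by blast
  \<comment> \<open>The largest integer with \<open>C powi k * a z ^ n < 1\<close>. Since
    \<open>k + 1\<close> fails, the ratio above \<open>C\<close> pushes the value under
    \<open>b\<close> beyond 1.\<close>
  define k where "k = \<lceil>log C (1 / a z ^ n)\<rceil> - 1"
  have C: "C > 1" using r by (simp add: C_def)
  have pi: "C powr (real_of_int j) = C powi j" for j
    using C by (simp add: powr_real_of_int')
  have "C powr (real_of_int k) < C powr (log C (1 / a z ^ n))"
    using C unfolding k_def by (intro powr_less_mono) linarith+
  then have 1: "C powi k * a z ^ n < 1"
    unfolding pi using C az by (simp add: field_simps)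
  have "C powr (log C (1 / a z ^ n)) \<le> C powr (real_of_int (k + 1))"
    using C unfolding k_def by (intro powr_mono) linarith+
  then have "1 / a z ^ n \<le> C powi (k + 1)"
    unfolding pi using C az by simp
  then have 2: "1 / a z ^ n \<le> C powi k * C" using C by (simp add: power_int_add)
  have "C < b z ^ n * (1 / a z ^ n)" using n by (simp add: power_divide)
  also have "\<dots> \<le> b z ^ n * (C powi k * C)"
    using 2 av_nonneg[OF K b z(1)] by (intro mult_left_mono) auto
  finally have 3: "b z ^ n * C powi k > 1" using C by (simp add: field_simps)
  have Kr: "(of_rat r :: 'a) powi k \<in> K"
    using sf_power[OF K sf_of_rat[OF K]] sf_inverse[OF K]
    by (simp add: power_int_def power_inverse)
  have powi: "v (of_rat r powi k) = v (of_rat r) powi k" if "absolute_value K v" for v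
    by (simp add: power_int_def av_power[OF K that] av_inverse[OF K that] sf_of_rat[OF K] sf_inverse[OF K])
  show ?thesis
  proof
    show "z ^ n * of_rat r powi k \<in> K" using z(1) Kr sf_mult[OF K] sf_power[OF K] by blast
    show "a (z ^ n * of_rat r powi k) < 1 \<and> b (z ^ n * of_rat r powi k) > 1"
      using 1 3 z(1) Kr eq[of r]
      by (simp add: av_mult[OF K a] av_mult[OF K b] av_power[OF K a] av_power[OF K b]
          powi[OF a] powi[OF b] sf_power[OF K] C_def mult.commute)
  qed
qed

text \<open>The usual weights of weak approximation: they approach 0 where \<open>x\<close> is small
  and 1 where it is large, so they kill small places without disturbing the values at large
  ones.\<close>

lemma power_quotient_limits:
  assumes K: "subfield K (Rg :: 'a :: field_char_0 ring)" and v: "absolute_value K v" and x: "x \<in> K"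
  defines "w \<equiv> \<lambda>n. x ^ n / (1 + x ^ n)"
  shows "v x < 1 \<Longrightarrow> (\<lambda>n. v (w n)) \<longlonglongrightarrow> 0" "v x > 1 \<Longrightarrow> (\<lambda>n. v (w n)) \<longlonglongrightarrow> 1"
proof -
  have vw: "v (w n) = v x ^ n / v (1 + x ^ n)" for n
    using x by (simp add: w_def av_divide[OF K v] av_power[OF K v] sf_power[OF K] sf_add[OF K] sf_1[OF K])
  have vx: "v x \<ge> 0" by (rule av_nonneg[OF K v x])
  have wpos: "v (w n) \<ge> 0" for n
    unfolding w_def by (intro av_nonneg[OF K v] sf_divide[OF K] sf_add[OF K] sf_power[OF K] sf_1[OF K] x)
  have 1: "v (1 + x ^ n) \<ge> 1 - v x ^ n" for n
  proof -
    have "v ((1 + x ^ n) + - (x ^ n)) \<le> v (1 + x ^ n) + v (- (x ^ n))"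
      using x by (intro av_add[OF K v] sf_add[OF K] sf_uminus[OF K] sf_power[OF K] sf_1[OF K])
    then show ?thesis
      using x by (simp add: av_1[OF K v] av_uminus[OF K v] av_power[OF K v] sf_power[OF K])
  qed
  have 2: "v (1 + x ^ n) \<ge> v x ^ n - 1" "v (1 + x ^ n) \<le> 1 + v x ^ n" for n
  proof -
    have "v ((1 + x ^ n) + - 1) \<le> v (1 + x ^ n) + v (- 1)"
      using x by (intro av_add[OF K v] sf_add[OF K] sf_uminus[OF K] sf_power[OF K] sf_1[OF K])
    then show "v (1 + x ^ n) \<ge> v x ^ n - 1"
      using x by (simp add: av_1[OF K v] av_uminus[OF K v] av_power[OF K v] sf_1[OF K])
    show "v (1 + x ^ n) \<le> 1 + v x ^ n"
      using av_add[OF K v sf_1[OF K] sf_power[OF K x], of n]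
      by (simp add: av_1[OF K v] av_power[OF K v] x)
  qed
  show "(\<lambda>n. v (w n)) \<longlonglongrightarrow> 0" if lt: "v x < 1"
  proof (rule tendsto_sandwich[of "\<lambda>_. 0" _ _ "\<lambda>n. v x ^ n / (1 - v x ^ n)"])
    have p0: "(\<lambda>n. v x ^ n) \<longlonglongrightarrow> 0" using lt vx by (intro LIMSEQ_realpow_zero) auto
    have "(\<lambda>n. v x ^ n / (1 - v x ^ n)) \<longlonglongrightarrow> 0 / (1 - 0)"
      by (intro tendsto_divide tendsto_diff tendsto_const p0) auto
    then show "(\<lambda>n. v x ^ n / (1 - v x ^ n)) \<longlonglongrightarrow> 0" by simp
    have "eventually (\<lambda>n. v x ^ n < 1) sequentially" using order_tendstoD(2)[OF p0] by simp
    then show "eventually (\<lambda>n. v (w n) \<le> v x ^ n / (1 - v x ^ n)) sequentially"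
      by eventually_elim (use vw 1 vx in \<open>auto intro!: divide_left_mono mult_pos_pos less_le_trans[OF _ 1]\<close>)
  qed (simp_all add: wpos)
  show "(\<lambda>n. v (w n)) \<longlonglongrightarrow> 1" if gt: "v x > 1"
  proof (rule tendsto_sandwich[of "\<lambda>n. 1 / (1 / v x ^ n + 1)" _ _ "\<lambda>n. 1 / (1 - 1 / v x ^ n)"])
    have p0: "(\<lambda>n. 1 / v x ^ n) \<longlonglongrightarrow> 0" using gt by (intro LIMSEQ_divide_realpow_zero)
    have "(\<lambda>n. 1 / (1 / v x ^ n + 1)) \<longlonglongrightarrow> 1 / (0 + 1)" "(\<lambda>n. 1 / (1 - 1 / v x ^ n)) \<longlonglongrightarrow> 1 / (1 - 0)"
      by (intro tendsto_divide tendsto_diff tendsto_add tendsto_const p0; simp)+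
    then show "(\<lambda>n. 1 / (1 / v x ^ n + 1)) \<longlonglongrightarrow> 1" "(\<lambda>n. 1 / (1 - 1 / v x ^ n)) \<longlonglongrightarrow> 1" by auto
    have ev: "eventually (\<lambda>n. 1 / v x ^ n < 1) sequentially" using order_tendstoD(2)[OF p0] by simp
    have pos: "v x ^ n > 0" for n using gt by simp
    show "eventually (\<lambda>n. v (w n) \<le> 1 / (1 - 1 / v x ^ n)) sequentially"
      using ev
    proof eventually_elim
      case (elim n)
      have "v x ^ n > 1" using elim pos[of n] by (simp add: field_simps)
      then have "v (w n) \<le> v x ^ n / (v x ^ n - 1)"
        unfolding vw using 2(1)[of n] by (intro divide_left_mono mult_pos_pos) auto
      also have "\<dots> = 1 / (1 - 1 / v x ^ n)" using gt by (simp add: divide_simps)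
      finally show ?case .
    qed
    show "eventually (\<lambda>n. 1 / (1 / v x ^ n + 1) \<le> v (w n)) sequentially"
      using ev
    proof eventually_elim
      case (elim n)
      have g: "v x ^ n > 1" using elim pos[of n] by (simp add: field_simps)
      then have "v x ^ n / (1 + v x ^ n) \<le> v (w n)"
        unfolding vw using 2[of n] by (intro divide_left_mono mult_pos_pos) auto
      moreover have "1 / v x ^ n + 1 = (1 + v x ^ n) / v x ^ n"
        using gt by (simp add: add_divide_distrib)
      then have "v x ^ n / (1 + v x ^ n) = 1 / (1 / v x ^ n + 1)" by simp
      ultimately show ?case by simp
    qed
  qed
qed

text \<open>Adding \<open>a\<close> to the set: if the old \<open>x\<close> is already small at
  \<open>a\<close>, it is kept. Otherwise an element \<open>z\<close> separating \<open>a\<close>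
  from \<open>b\<close> is multiplied by \<open>x ^ n\<close> when \<open>a x = 1\<close>, and by
  \<open>x ^ n / (1 + x ^ n)\<close> when \<open>a x > 1\<close>.\<close>

lemma separate_one_from_finite:
  assumes K: "subfield K (Rg :: 'a :: field_char_0 ring)" and A: "finite A"
    and av: "\<And>a. a \<in> insert b A \<Longrightarrow> absolute_value K a"
    and eq: "\<And>a r. a \<in> A \<Longrightarrow> a (of_rat r) = b (of_rat r)" and r: "b (of_rat r) > 1" and ne: "b \<notin> A"
  shows "\<exists>x\<in>K. b x > 1 \<and> (\<forall>a\<in>A. a x < 1)"
  using A av eq ne
proof (induction A rule: finite_induct)
  case empty
  then show ?case using r sf_of_rat[OF K] by auto
next
  case (insert a A)
  have a: "absolute_value K a" and b: "absolute_value K b" and A: "\<And>c. c \<in> A \<Longrightarrow> absolute_value K c"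
    using insert.prems by auto
  obtain x where x: "x \<in> K" "b x > 1" "\<forall>c\<in>A. c x < 1"
    using insert.IH insert.prems by auto
  obtain z where z: "z \<in> K" "a z < 1" "b z > 1"
  proof -
    have ab: "a (of_rat q) = b (of_rat q)" for q using insert.prems(2) by simp
    have "\<exists>x\<in>K. a x < 1 \<and> b x > 1"
      by (rule separate_two[OF K a b ab, of r]) (use r ab insert.prems(3) in auto)
    then show ?thesis using that by blast
  qed
  have fin: "\<exists>x\<in>K. b x > 1 \<and> (\<forall>a\<in>insert a A. a x < 1)"
    if w: "\<And>n :: nat. w n \<in> K" and ba: "eventually (\<lambda>n. b (w n * z) > 1) sequentially"
      "eventually (\<lambda>n. a (w n * z) < 1) sequentially"
      and cw: "\<And>c. c \<in> A \<Longrightarrow> (\<lambda>n. c (w n)) \<longlonglongrightarrow> 0" for w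
  proof -
    have "eventually (\<lambda>n. c (w n * z) < 1) sequentially" if c: "c \<in> A" for c
    proof -
      have "(\<lambda>n. c (w n) * c z) \<longlonglongrightarrow> 0 * c z" using cw[OF c] by (intro tendsto_intros)
      then have "eventually (\<lambda>n. c (w n) * c z < 1) sequentially" by (rule order_tendstoD) simp
      then show ?thesis using av_mult[OF K A[OF c] w z(1)] by simp
    qed
    then have "eventually (\<lambda>n. \<forall>c\<in>A. c (w n * z) < 1) sequentially"
      using insert.hyps(1) by (simp add: eventually_ball_finite_distrib)
    with ba have "eventually (\<lambda>n. b (w n * z) > 1 \<and> (\<forall>c\<in>insert a A. c (w n * z) < 1)) sequentially"
      by eventually_elim auto
    then obtain n where "b (w n * z) > 1 \<and> (\<forall>c\<in>insert a A. c (w n * z) < 1)"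
      by (auto simp: eventually_sequentially)
    then show ?thesis using sf_mult[OF K w z(1)] by blast
  qed
  consider "a x < 1" | "a x = 1" | "a x > 1" by linarith
  then show ?case
  proof cases
    case 1
    then show ?thesis using x by blast
  next
    case 2
    show ?thesis
    proof (rule fin[of "\<lambda>n. x ^ n"])
      have "1 < b x ^ n * b z" for n
      proof -
        have "1 * b z \<le> b x ^ n * b z" using z(3) x(2) by (intro mult_right_mono one_le_power) auto
        with z(3) show ?thesis by linarith
      qed
      then show "eventually (\<lambda>n. b (x ^ n * z) > 1) sequentially"
        using x(1) z(1) by (simp add: av_mult[OF K b] av_power[OF K b] sf_power[OF K])
      show "eventually (\<lambda>n. a (x ^ n * z) < 1) sequentially"
        using 2 z(1,2) x(1) by (simp add: av_mult[OF K a] av_power[OF K a] sf_power[OF K])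
      show "(\<lambda>n. c (x ^ n)) \<longlonglongrightarrow> 0" if c: "c \<in> A" for c
      proof -
        have "(\<lambda>n. c x ^ n) \<longlonglongrightarrow> 0"
          using x(3) c av_nonneg[OF K A[OF c] x(1)] by (intro LIMSEQ_realpow_zero) auto
        then show ?thesis using x(1) by (simp add: av_power[OF K A[OF c]])
      qed
    qed (use x(1) sf_power[OF K] in blast)
  next
    case 3
    let ?w = "\<lambda>n. x ^ n / (1 + x ^ n)"
    have wK: "?w n \<in> K" for n
      using x(1) by (intro sf_divide[OF K] sf_add[OF K] sf_power[OF K] sf_1[OF K])
    show ?thesis
    proof (rule fin[of ?w])
      have "(\<lambda>n. b (?w n) * b z) \<longlonglongrightarrow> 1 * b z" "(\<lambda>n. a (?w n) * a z) \<longlonglongrightarrow> 1 * a z"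
        using power_quotient_limits(2)[OF K b x(1,2)] power_quotient_limits(2)[OF K a x(1) 3]
        by (intro tendsto_mult tendsto_const; simp)+
      then have "eventually (\<lambda>n. b (?w n) * b z > 1) sequentially"
        "eventually (\<lambda>n. a (?w n) * a z < 1) sequentially"
        using z(2,3) order_tendstoD(1)[of "\<lambda>n. b (?w n) * b z" "1 * b z" sequentially 1]
          order_tendstoD(2)[of "\<lambda>n. a (?w n) * a z" "1 * a z" sequentially 1] by simp_all
      then show "eventually (\<lambda>n. b (?w n * z) > 1) sequentially"
        "eventually (\<lambda>n. a (?w n * z) < 1) sequentially"
        using av_mult[OF K a wK z(1)] av_mult[OF K b wK z(1)] by simp_all
      show "(\<lambda>n. c (?w n)) \<longlonglongrightarrow> 0" if "c \<in> A" for c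
        using power_quotient_limits(1)[OF K A[OF that] x(1)] x(3) that by simp
    qed (rule wK)
  qed
qed

text \<open>Elements \<open>x\<^sub>i\<close> with \<open>b\<^sub>i\<close> large at \<open>x\<^sub>i\<close> and all other \<open>b\<^sub>j\<close> at most 1 are linearly
  independent over the rationals, so the degree bounds the number of the \<open>b\<^sub>i\<close>.\<close>

lemma finite_absolute_values_above:
  assumes K: "number_field (K :: 'a :: field_char_0 set)" and u: "u r0 > (1 :: real)"
  shows "finite {b. absolute_value K b \<and> (\<forall>r. b (of_rat r) = u r)}" (is "finite ?N")
proof -
  note K' = number_field_subfield[OF K]
  from number_field_independent_bound[OF K]
  obtain d where d: "\<forall>n. \<forall>x :: nat \<Rightarrow> 'a. (\<forall>i<n. x i \<in> K) \<longrightarrow>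
     (\<forall>c. (\<forall>i<n. c i \<in> \<rat>) \<longrightarrow> (\<Sum>i<n. c i * x i) = 0 \<longrightarrow> (\<forall>i<n. c i = 0)) \<longrightarrow> n \<le> d"
    by (rule exE)
  have "card A \<le> d" if A: "finite A" "A \<subseteq> ?N" for A
  proof -
    obtain f where f: "bij_betw f {..<card A} A"
      using ex_bij_betw_nat_finite[OF A(1)] by (auto simp: atLeast0LessThan)
    define m where "m = card A"
    have fA: "f i \<in> ?N" if "i < m" for i using f A(2) that by (auto simp: bij_betw_def m_def)
    \<comment> \<open>The threshold \<open>m\<close> is the number of absolute values: one term of
      this size outweighs the remaining \<open>m - 1\<close> terms in a linear relation.\<close>
    have "\<exists>x\<in>K. f i x \<ge> m \<and> (\<forall>j<m. j \<noteq> i \<longrightarrow> f j x \<le> 1)" if i: "i < m" for i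
    proof -
      have "\<exists>x\<in>K. f i x > 1 \<and> (\<forall>a\<in>f ` ({..<m} - {i}). a x < 1)"
      proof (rule separate_one_from_finite[OF K'])
        show "absolute_value K a" if "a \<in> insert (f i) (f ` ({..<m} - {i}))" for a
          using that fA i by auto
        show "a (of_rat r) = f i (of_rat r)" if "a \<in> f ` ({..<m} - {i})" for a r
          using that fA i by auto
        show "f i \<notin> f ` ({..<m} - {i})"
          using f i by (auto simp: bij_betw_def inj_on_def m_def)
        show "f i (of_rat r0) > 1" using fA[OF i] u by simp
      qed simp
      then obtain x where x: "x \<in> K" "f i x > 1" "\<forall>j<m. j \<noteq> i \<longrightarrow> f j x < 1" by auto
      obtain n where n: "f i x ^ n > m" using real_arch_pow[OF x(2)] by blast
      have av: "absolute_value K (f j)" if "j < m" for j using fA[OF that] by simp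
      have "f j (x ^ n) \<le> 1" if "j < m" "j \<noteq> i" for j
        using x(1,3) that av_nonneg[OF K' av[OF that(1)] x(1)]
        by (simp add: av_power[OF K' av[OF that(1)]] power_le_one less_imp_le)
      then show ?thesis
        using n x(1) by (intro bexI[of _ "x ^ n"])
          (auto simp: av_power[OF K' av[OF i]] less_imp_le sf_power[OF K'])
    qed
    then obtain x where x: "\<And>i. i < m \<Longrightarrow> x i \<in> K" "\<And>i. i < m \<Longrightarrow> f i (x i) \<ge> m"
      "\<And>i j. i < m \<Longrightarrow> j < m \<Longrightarrow> j \<noteq> i \<Longrightarrow> f j (x i) \<le> 1" by metis
    have "\<forall>i<m. c i = 0" if c: "\<forall>i<m. c i \<in> \<rat>" "(\<Sum>i<m. c i * x i) = 0" for c
    proof (cases "m = 0")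
      case False
      define U where "U = f 0"
      have U: "f i (c j) = U (c j)" if "i < m" "j < m" for i j
        using c(1) that fA[of i] fA[of 0] by (auto simp: U_def elim!: Rats_cases)
      have "Max ((\<lambda>i. U (c i)) ` {..<m}) \<in> (\<lambda>i. U (c i)) ` {..<m}" using False by (intro Max_in) auto
      \<comment> \<open>At the largest coefficient the \<open>i\<close>-th term has value at least
        \<open>m * U (c i)\<close>, while the other \<open>m - 1\<close> terms have value at most
        \<open>U (c i)\<close> each; hence \<open>U (c i)\<close> vanishes, and with it all
        coefficients.\<close>
      then obtain i where i: "i < m" "\<And>j. j < m \<Longrightarrow> U (c j) \<le> U (c i)"
        by (smt (verit, best) Max_ge finite_imageI finite_lessThan imageE imageI lessThan_iff)
      have av: "absolute_value K (f i)" using fA[OF i(1)] by simp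
      have cK: "c j \<in> K" if "j < m" for j using c(1) that sf_Rats[OF K'] by blast
      have "U (c i) * m \<le> f i (c i) * f i (x i)"
        using x(2)[OF i(1)] U[OF i(1,1)] av_nonneg[OF K' av cK[OF i(1)]] by (simp add: mult_left_mono)
      also have "\<dots> = f i (c i * x i)" using cK x(1) i(1) by (simp add: av_mult[OF K' av])
      also have "c i * x i = - (\<Sum>j\<in>{..<m} - {i}. c j * x j)"
        using c(2) i(1) by (simp add: sum.remove[of "{..<m}" i] eq_neg_iff_add_eq_0)
      also have "f i \<dots> = f i (\<Sum>j\<in>{..<m} - {i}. c j * x j)"
        using cK x(1) by (intro av_uminus[OF K' av] sf_sum[OF K'] sf_mult[OF K']) auto
      also have "\<dots> \<le> (\<Sum>j\<in>{..<m} - {i}. f i (c j * x j))"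
        using cK x(1) by (intro av_sum[OF K' av] sf_mult[OF K']) auto
      also have "\<dots> \<le> (\<Sum>j\<in>{..<m} - {i}. U (c i) * 1)"
      proof (rule sum_mono)
        fix j assume j: "j \<in> {..<m} - {i}"
        have "f i (c j * x j) = U (c j) * f i (x j)"
          using j cK x(1) U[OF i(1)] by (simp add: av_mult[OF K' av])
        also have "\<dots> \<le> U (c i) * 1"
        proof (rule mult_mono)
          show "U (c j) \<le> U (c i)" using i(2) j by simp
          show "f i (x j) \<le> 1" using x(3)[of j i] j i(1) by simp
          show "0 \<le> U (c i)" using U[OF i(1,1)] av_nonneg[OF K' av cK[OF i(1)]] by simp
          show "0 \<le> f i (x j)" using av_nonneg[OF K' av x(1)[of j]] j by simp
        qed
        finally show "f i (c j * x j) \<le> U (c i) * 1" .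
      qed
      also have "\<dots> = U (c i) * (m - 1)" using i(1) by (simp add: of_nat_diff)
      finally have "U (c i) \<le> 0" using i(1) by (simp add: of_nat_diff algebra_simps)
      then have "f j (c j) = 0" if "j < m" for j
        using i(2)[OF that] U[OF that that] av_nonneg[OF K' _ cK[OF that], of "f j"] fA[OF that] by auto
      then show ?thesis using fA cK av_eq_0[OF K'] by auto
    qed simp
    then have "m \<le> d" by (intro d[rule_format]) (use x(1) in blast)+
    then show "card A \<le> d" by (simp add: m_def)
  qed
  then show ?thesis by (intro finite_if_finite_subsets_card_bdd[of _ d, THEN conjunct1]) blast
qed

text \<open>For primes dividing neither the leading nor the constant coefficient of an integer
  polynomial killing \<open>x\<close>, both \<open>x\<close> and its inverse have value at most 1.
  This leaves the archimedean value and finitely many primes, each with finitely many extensions to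
  \<open>K\<close>.\<close>

lemma finite_nontrivial_normalized:
  assumes alg: "\<forall>x :: 'a :: field_char_0. algebraic x"
    and K: "number_field (K :: 'a set)" and x: "x \<in> K" "x \<noteq> 0"
  shows "finite {b. normalized K b \<and> b x \<noteq> 1}"
proof -
  note K' = number_field_subfield[OF K]
  obtain h where h: "h \<noteq> 0" "coeff h 0 \<noteq> 0" "poly (map_poly of_int h) x = 0"
    using algebraicE'_nonzero[of x] alg x(2) by blast
  define N where "N = lead_coeff h * coeff h 0"
  have N: "N \<noteq> 0" using h by (simp add: N_def)
  define P where "P = {p. prime p \<and> int p dvd N}"
  have "finite P"
  proof (rule finite_subset)
    show "P \<subseteq> nat ` {d. d dvd N}"
    proof
      fix p assume "p \<in> P"
      then show "p \<in> nat ` {d. d dvd N}"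
        by (intro image_eqI[of _ _ "int p"]) (simp_all add: P_def)
    qed
  qed (use N finite_divisors_int in simp)
  define Nm where "Nm = (\<lambda>u :: rat \<Rightarrow> real. {b. absolute_value K b \<and> (\<forall>r. b (of_rat r) = u r)})"
  have "b \<in> Nm (\<lambda>r. \<bar>of_rat r\<bar>) \<union> (\<Union>p\<in>P. Nm (padic_abs p))"
    if b: "normalized K b" "b x \<noteq> 1" for b
  proof -
    have av: "absolute_value K b" using b(1) by (simp add: normalized_def)
    consider "\<forall>r. b (of_rat r) = \<bar>of_rat r\<bar>"
      | p where "prime p" "\<forall>r. b (of_rat r) = padic_abs p r"
      using b(1) by (auto simp: normalized_def extends_usual_abs_def)
    then show ?thesis
    proof cases
      case 1
      then show ?thesis using av by (simp add: Nm_def)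
    next
      case 2
      have bint: "b (of_int z) = padic_abs p (of_int z)" for z
        using 2(2) by (metis of_rat_of_int_eq)
      have nat: "b (of_nat n) \<le> 1" for n
        using bint[of "int n"] padic_abs_of_int_le_1[OF 2(1), of "int n"] by simp
      have "int p dvd N"
      proof (rule ccontr)
        assume np: "\<not> int p dvd N"
        then have lc: "\<not> int p dvd lead_coeff h" "\<not> int p dvd coeff h 0" by (auto simp: N_def)
        have deg: "degree (map_poly of_int g :: 'a poly) = degree g" for g by (intro degree_map_poly) auto
        have le: "b z \<le> 1" if z: "z \<in> K" and g: "poly (map_poly of_int g) z = 0" "\<not> int p dvd lead_coeff g" for z g
        proof (rule av_integral_le_1[OF K' av nat z])
          show "coeff (map_poly of_int g) i \<in> K" for i
            by (simp add: coeff_map_poly sf_of_int[OF K'])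
          show "b (coeff (map_poly of_int g) i) \<le> 1" for i
            using padic_abs_of_int_le_1[OF 2(1)] by (simp add: coeff_map_poly bint)
          have "lead_coeff g \<noteq> 0" using g(2) by auto
          then show "b (lead_coeff (map_poly of_int g)) = 1"
            unfolding deg using g(2) padic_abs_of_int_unit by (simp add: coeff_map_poly bint)
        qed (rule g(1))
        have "b x \<le> 1" using le[OF x(1) h(3) lc(1)] .
        moreover have "b (inverse x) \<le> 1"
        proof (rule le[OF sf_inverse[OF K' x(1)]])
          \<comment> \<open>The inverse of \<open>x\<close> is a root of the reversed polynomial,
            whose leading coefficient is the constant term of \<open>h\<close>; this is why
            \<open>N\<close> contains both coefficients.\<close>
          have "map_poly of_int (reflect_poly h) = (reflect_poly (map_poly of_int h) :: 'a poly)"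
            by (intro poly_eqI) (simp add: coeff_map_poly coeff_reflect_poly deg)
          then show "poly (map_poly of_int (reflect_poly h)) (inverse x) = 0"
            using h(3) x(2) by (simp add: poly_reflect_poly_nz)
          show "\<not> int p dvd lead_coeff (reflect_poly h)"
            using lc(2) h(2) by (simp add: coeff_reflect_poly)
        qed
        moreover have "b x > 0" by (rule av_pos[OF K' av x])
        ultimately show False using b(2) by (simp add: av_inverse[OF K' av x(1)] inverse_le_1_iff)
      qed
      then show ?thesis using 2 av by (auto simp: Nm_def P_def)
    qed
  qed
  then have "{b. normalized K b \<and> b x \<noteq> 1} \<subseteq> Nm (\<lambda>r. \<bar>of_rat r\<bar>) \<union> (\<Union>p\<in>P. Nm (padic_abs p))" by blast
  moreover have "finite (Nm (\<lambda>r. \<bar>of_rat r\<bar>))"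
    unfolding Nm_def by (rule finite_absolute_values_above[OF K, of _ 2]) simp
  moreover have "finite (Nm (padic_abs p))" if "p \<in> P" for p
  proof (cases "Nm (padic_abs p) = {}")
    case False
    then obtain b where b: "\<forall>r. b (of_rat r :: 'a) = padic_abs p r" by (auto simp: Nm_def)
    then have "extends_usual_abs b" using that by (auto simp: extends_usual_abs_def P_def)
    then obtain r where "padic_abs p r > 1" using extends_usual_exists_big b by metis
    then show ?thesis unfolding Nm_def by (rule finite_absolute_values_above[OF K])
  qed simp
  ultimately show ?thesis using \<open>finite P\<close> by (meson finite_UN_I finite_Un finite_subset)
qed

section \<open>Completions of conjugate fields\<close>

lemma dimension_hom_image:
  assumes "ring_hom_ring R S h" "inj_on h (carrier R)" "F \<subseteq> carrier R" "ring.dimension R n F E"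
  shows "E \<subseteq> carrier R \<and> ring.dimension S n (h ` F) (h ` E)"
proof -
  interpret ring_hom_ring R S h by (rule assms(1))
  show ?thesis
    using assms(4,3)
  proof (induction n F E rule: R.dimension.induct)
    case (zero_dim F)
    then show ?case by simp
  next
    case (Suc_dim u E n F)
    then have E: "E \<subseteq> carrier R" "S.dimension n (h ` F) (h ` E)" by auto
    have "h u \<notin> h ` E" using Suc_dim.hyps(1,2) E(1) assms(2) by (auto simp: inj_on_def)
    then have "S.dimension (Suc n) (h ` F) (S.line_extension (h ` F) (h u) (h ` E))"
      using Suc_dim.hyps(1) E(2) by (intro S.dimension.Suc_dim) auto
    then have "S.dimension (Suc n) (h ` F) (h ` R.line_extension F u E)"
      using line_extension_hom[OF Suc_dim.prems Suc_dim.hyps(1) E(1)] by simp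
    moreover have "R.line_extension F u E \<subseteq> carrier R"
      using Suc_dim.prems Suc_dim.hyps(1) E(1)
      unfolding R.line_extension_def set_add_def set_mult_def r_coset_def by fastforce
    ultimately show ?case by simp
  qed
qed

text \<open>An equivalence for each \<open>n\<close> identifies the values of
  \<open>ring.dim\<close> on both sides without first establishing finite dimension.\<close>

lemma dimension_iso_image:
  assumes "ring R" "ring S" "h \<in> ring_iso R S" "F \<subseteq> carrier R" "E \<subseteq> carrier R"
  shows "ring.dimension S n (h ` F) (h ` E) \<longleftrightarrow> ring.dimension R n F E"
proof
  have h: "bij_betw h (carrier R) (carrier S)" "h \<in> ring_hom R S"
    using assms(3) by (auto simp: ring_iso_def)
  show "ring.dimension S n (h ` F) (h ` E)" if "ring.dimension R n F E"
    using dimension_hom_image[of R S h F n E] assms h that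
    by (auto simp: bij_betw_def intro: ring_hom_ringI2)
  assume dim: "ring.dimension S n (h ` F) (h ` E)"
  let ?k = "inv_into (carrier R) h"
  have k: "?k \<in> ring_iso S R" by (rule ring_iso_set_sym[OF assms(1,3)])
  have inv: "?k ` (h ` A) = A" if "A \<subseteq> carrier R" for A
    using that h(1) by (intro inv_into_image_cancel) (auto simp: bij_betw_def)
  have hF: "h ` F \<subseteq> carrier S" using assms(4) h(1) by (auto simp: bij_betw_def)
  have "ring.dimension R n (?k ` (h ` F)) (?k ` (h ` E))"
    using dimension_hom_image[OF ring_hom_ringI2[OF assms(2,1)], of ?k "h ` F" n "h ` E"] k hF dim
    by (auto simp: ring_iso_def bij_betw_def)
  then show "ring.dimension R n F E" using assms(4,5) inv by simp
qed

lemma aut_ring_iso: "field_automorphism \<sigma> \<Longrightarrow> \<sigma> \<in> ring_iso Rg Rg"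
  unfolding ring_iso_def ring_hom_def by (auto simp: Rg_simps aut_mult aut_add aut_1 aut_bij)

lemma aut_image_Rats: "field_automorphism \<sigma> \<Longrightarrow> \<sigma> ` \<rat> = \<rat>"
  by (simp add: aut_Rats cong: image_cong)

lemma aut_image_number_field:
  assumes \<sigma>: "field_automorphism \<sigma>" and K: "number_field K"
  shows "number_field (\<sigma> ` K)" "field_degree (\<sigma> ` K) = field_degree K"
proof -
  have dim: "ring.dimension Rg n \<rat> (\<sigma> ` K) \<longleftrightarrow> ring.dimension Rg n \<rat> K" for n
    using dimension_iso_image[OF Rg_ring Rg_ring aut_ring_iso[OF \<sigma>], of \<rat> K n]
    by (simp add: aut_image_Rats[OF \<sigma>] Rg_simps)
  have "subfield (\<sigma> ` K) Rg"
    using number_field_subfield[OF K] unfolding subfield_Rg_iff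
    by (auto simp: aut_1[OF \<sigma>] simp flip: aut_add[OF \<sigma>] aut_mult[OF \<sigma>] aut_uminus[OF \<sigma>] aut_inverse[OF \<sigma>])
      (metis aut_1[OF \<sigma>] image_eqI)
  with K dim show "number_field (\<sigma> ` K)"
    unfolding number_field_def ring.finite_dimension_def[OF Rg_ring] by simp
  show "field_degree (\<sigma> ` K) = field_degree K"
    unfolding field_degree_def ring.dim_def[OF Rg_ring] by (simp add: dim)
qed

section \<open>Cauchy sequences, null sequences and the completion as a quotient ring\<close>

lemma cauchy_carrier:
  "s \<in> carrier (cauchy_ring K v) \<longleftrightarrow>
     (\<forall>n. s n \<in> K) \<and> (\<forall>a\<in>v. \<forall>e>0. \<exists>N. \<forall>m\<ge>N. \<forall>n\<ge>N. a (s m - s n) < e)"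
  by (auto simp: cauchy_ring_def cauchy_at_def)

lemma null_ideal_iff:
  "s \<in> null_ideal K v \<longleftrightarrow> s \<in> carrier (cauchy_ring K v) \<and> (\<forall>a\<in>v. (\<lambda>n. a (s n)) \<longlonglongrightarrow> 0)"
  by (simp add: null_ideal_def null_at_def)

context
  fixes K :: "'a :: field_char_0 set" and v :: "'a place"
  assumes K: "subfield K Rg" and v: "\<And>a. a \<in> v \<Longrightarrow> absolute_value K a"
begin

lemma cauchy_bounded:
  assumes s: "s \<in> carrier (cauchy_ring K v)" and a: "a \<in> v"
  shows "\<exists>M>0. \<forall>n. a (s n) \<le> M"
proof -
  have sK: "s n \<in> K" for n using s by (simp add: cauchy_carrier)
  obtain N where N: "\<forall>m\<ge>N. \<forall>n\<ge>N. a (s m - s n) < 1"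
    using s a zero_less_one unfolding cauchy_carrier by blast
  define M where "M = Max ((\<lambda>n. a (s n)) ` {..N}) + 1"
  have le: "a (s n) \<le> M - 1" if "n \<le> N" for n
    unfolding M_def using that by (auto intro!: Max_ge)
  have "a (s n) \<le> M" for n
  proof (cases "n \<le> N")
    case False
    have "a ((s n - s N) + s N) \<le> a (s n - s N) + a (s N)"
      using sK by (intro av_add[OF K v[OF a]] sf_diff[OF K])
    moreover have "a (s n - s N) < 1" using N False by simp
    ultimately show ?thesis using le[of N] by simp
  qed (use le in fastforce)
  moreover have "M > 0" using le[of 0] av_nonneg[OF K v[OF a] sK[of 0]] by simp
  ultimately show ?thesis by blast
qed

lemma cauchy_add:
  assumes "s \<in> carrier (cauchy_ring K v)" "t \<in> carrier (cauchy_ring K v)"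
  shows "(\<lambda>n. s n + t n) \<in> carrier (cauchy_ring K v)"
  unfolding cauchy_carrier
proof (intro conjI allI ballI impI)
  show "s n + t n \<in> K" for n using assms sf_add[OF K] by (simp add: cauchy_carrier)
  fix a and e :: real assume a: "a \<in> v" and e: "e > 0"
  obtain N M where NM: "\<forall>m\<ge>N. \<forall>n\<ge>N. a (s m - s n) < e / 2" "\<forall>m\<ge>M. \<forall>n\<ge>M. a (t m - t n) < e / 2"
    using assms a e unfolding cauchy_carrier by (meson half_gt_zero)
  have "a (s m + t m - (s n + t n)) < e" if "m \<ge> max N M" "n \<ge> max N M" for m n
  proof -
    have "a ((s m - s n) + (t m - t n)) \<le> a (s m - s n) + a (t m - t n)"
      using assms by (intro av_add[OF K v[OF a]] sf_diff[OF K]) (auto simp: cauchy_carrier)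
    moreover have "a (s m - s n) < e / 2" "a (t m - t n) < e / 2" using NM that by auto
    ultimately show ?thesis by (simp add: algebra_simps)
  qed
  then show "\<exists>N. \<forall>m\<ge>N. \<forall>n\<ge>N. a (s m + t m - (s n + t n)) < e" by blast
qed

lemma cauchy_mult:
  assumes s: "s \<in> carrier (cauchy_ring K v)" and t: "t \<in> carrier (cauchy_ring K v)"
  shows "(\<lambda>n. s n * t n) \<in> carrier (cauchy_ring K v)"
  unfolding cauchy_carrier
proof (intro conjI allI ballI impI)
  have sK: "s n \<in> K" and tK: "t n \<in> K" for n using assms by (auto simp: cauchy_carrier)
  show "s n * t n \<in> K" for n using sK tK sf_mult[OF K] by simp
  fix a and e :: real assume a: "a \<in> v" and e: "e > 0"
  obtain A B where AB: "A > 0" "B > 0" "\<forall>n. a (s n) \<le> A" "\<forall>n. a (t n) \<le> B"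
    using cauchy_bounded[OF s a] cauchy_bounded[OF t a] by blast
  have "e / (2 * B) > 0" "e / (2 * A) > 0" using AB e by auto
  then obtain N M where NM: "\<forall>m\<ge>N. \<forall>n\<ge>N. a (s m - s n) < e / (2 * B)"
      "\<forall>m\<ge>M. \<forall>n\<ge>M. a (t m - t n) < e / (2 * A)"
    using s t a unfolding cauchy_carrier by meson
  have "a (s m * t m - s n * t n) < e" if "m \<ge> max N M" "n \<ge> max N M" for m n
  proof -
    have "s m * t m - s n * t n = s m * (t m - t n) + (s m - s n) * t n" by (simp add: algebra_simps)
    then have "a (s m * t m - s n * t n) \<le> a (s m * (t m - t n)) + a ((s m - s n) * t n)"
      using sK tK by (simp add: av_add[OF K v[OF a]] sf_mult[OF K] sf_diff[OF K])
    also have "\<dots> = a (s m) * a (t m - t n) + a (s m - s n) * a (t n)"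
      using sK tK by (simp add: av_mult[OF K v[OF a]] sf_diff[OF K])
    also have "\<dots> \<le> A * a (t m - t n) + a (s m - s n) * B"
      using AB sK tK by (intro add_mono mult_mono) (auto intro!: av_nonneg[OF K v[OF a]] sf_diff[OF K])
    also have "\<dots> < A * (e / (2 * A)) + e / (2 * B) * B"
      using NM AB that by (intro add_strict_mono mult_strict_left_mono mult_strict_right_mono) auto
    also have "\<dots> = e" using AB by simp
    finally show ?thesis .
  qed
  then show "\<exists>N. \<forall>m\<ge>N. \<forall>n\<ge>N. a (s m * t m - s n * t n) < e" by blast
qed

lemma cauchy_const: "x \<in> K \<Longrightarrow> (\<lambda>n. x) \<in> carrier (cauchy_ring K v)"
  unfolding cauchy_carrier by (auto simp: av_0[OF K v])

lemma cauchy_uminus: "s \<in> carrier (cauchy_ring K v) \<Longrightarrow> (\<lambda>n. - s n) \<in> carrier (cauchy_ring K v)"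
  using cauchy_mult[OF cauchy_const[of "-1"], of s] sf_uminus[OF K sf_1[OF K]] by simp

lemma cauchy_ring_cring: "cring (cauchy_ring K v)"
proof (rule cringI)
  show "abelian_group (cauchy_ring K v)"
  proof (rule abelian_groupI)
    show "\<exists>t\<in>carrier (cauchy_ring K v). t \<oplus>\<^bsub>cauchy_ring K v\<^esub> s = \<zero>\<^bsub>cauchy_ring K v\<^esub>"
      if "s \<in> carrier (cauchy_ring K v)" for s
      using cauchy_uminus[OF that] by (intro bexI[of _ "\<lambda>n. - s n"]) (auto simp: cauchy_ring_def)
    show "\<zero>\<^bsub>cauchy_ring K v\<^esub> \<in> carrier (cauchy_ring K v)"
      using cauchy_const[OF sf_0[OF K]] by (simp add: cauchy_ring_def)
    show "s \<oplus>\<^bsub>cauchy_ring K v\<^esub> t \<in> carrier (cauchy_ring K v)"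
      if "s \<in> carrier (cauchy_ring K v)" "t \<in> carrier (cauchy_ring K v)" for s t
      using cauchy_add[OF that] by (simp add: cauchy_ring_def)
  qed (auto simp: cauchy_ring_def algebra_simps)
  show "Group.comm_monoid (cauchy_ring K v)"
  proof (rule comm_monoidI)
    show "\<one>\<^bsub>cauchy_ring K v\<^esub> \<in> carrier (cauchy_ring K v)"
      using cauchy_const[OF sf_1[OF K]] by (simp add: cauchy_ring_def)
    show "s \<otimes>\<^bsub>cauchy_ring K v\<^esub> t \<in> carrier (cauchy_ring K v)"
      if "s \<in> carrier (cauchy_ring K v)" "t \<in> carrier (cauchy_ring K v)" for s t
      using cauchy_mult[OF that] by (simp add: cauchy_ring_def)
  qed (auto simp: cauchy_ring_def algebra_simps)
qed (auto simp: cauchy_ring_def algebra_simps)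

lemma null_mult:
  assumes s: "s \<in> null_ideal K v" and t: "t \<in> carrier (cauchy_ring K v)"
  shows "(\<lambda>n. t n * s n) \<in> null_ideal K v"
  unfolding null_ideal_iff
proof (intro conjI ballI)
  have sC: "s \<in> carrier (cauchy_ring K v)" using s by (simp add: null_ideal_iff)
  show "(\<lambda>n. t n * s n) \<in> carrier (cauchy_ring K v)" by (rule cauchy_mult[OF t sC])
  fix a assume a: "a \<in> v"
  have sK: "s n \<in> K" and tK: "t n \<in> K" for n using sC t by (auto simp: cauchy_carrier)
  obtain M where M: "M > 0" "\<forall>n. a (t n) \<le> M" using cauchy_bounded[OF t a] by blast
  show "(\<lambda>n. a (t n * s n)) \<longlonglongrightarrow> 0"
  proof (rule tendsto_sandwich[of "\<lambda>_. 0" _ _ "\<lambda>n. M * a (s n)"])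
    have "(\<lambda>n. M * a (s n)) \<longlonglongrightarrow> M * 0"
      using s a by (intro tendsto_mult tendsto_const) (simp add: null_ideal_iff)
    then show "(\<lambda>n. M * a (s n)) \<longlonglongrightarrow> 0" by simp
    show "eventually (\<lambda>n. 0 \<le> a (t n * s n)) sequentially"
      by (intro always_eventually allI av_nonneg[OF K v[OF a]] sf_mult[OF K] sK tK)
    have "a (t n * s n) \<le> M * a (s n)" for n
      using M sK tK by (simp add: av_mult[OF K v[OF a]] mult_right_mono av_nonneg[OF K v[OF a]])
    then show "eventually (\<lambda>n. a (t n * s n) \<le> M * a (s n)) sequentially" by simp
  qed simp
qed

lemma null_add:
  assumes s: "s \<in> null_ideal K v" and t: "t \<in> null_ideal K v"
  shows "(\<lambda>n. s n + t n) \<in> null_ideal K v"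
  unfolding null_ideal_iff
proof (intro conjI ballI)
  have C: "s \<in> carrier (cauchy_ring K v)" "t \<in> carrier (cauchy_ring K v)"
    using s t by (auto simp: null_ideal_iff)
  show "(\<lambda>n. s n + t n) \<in> carrier (cauchy_ring K v)" by (rule cauchy_add[OF C])
  fix a assume a: "a \<in> v"
  have sK: "s n \<in> K" and tK: "t n \<in> K" for n using C by (auto simp: cauchy_carrier)
  show "(\<lambda>n. a (s n + t n)) \<longlonglongrightarrow> 0"
  proof (rule tendsto_sandwich[of "\<lambda>_. 0" _ _ "\<lambda>n. a (s n) + a (t n)"])
    have "(\<lambda>n. a (s n) + a (t n)) \<longlonglongrightarrow> 0 + 0"
      using s t a by (intro tendsto_add) (simp_all add: null_ideal_iff)
    then show "(\<lambda>n. a (s n) + a (t n)) \<longlonglongrightarrow> 0" by simp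
    show "eventually (\<lambda>n. 0 \<le> a (s n + t n)) sequentially"
      by (intro always_eventually allI av_nonneg[OF K v[OF a]] sf_add[OF K] sK tK)
    show "eventually (\<lambda>n. a (s n + t n) \<le> a (s n) + a (t n)) sequentially"
      by (intro always_eventually allI av_add[OF K v[OF a]] sK tK)
  qed simp
qed

lemma null_ideal_ideal: "ideal (null_ideal K v) (cauchy_ring K v)"
proof (rule idealI)
  interpret cring "cauchy_ring K v" by (rule cauchy_ring_cring)
  show "ring (cauchy_ring K v)" by (rule ring_axioms)
  show "subgroup (null_ideal K v) (add_monoid (cauchy_ring K v))"
  proof (rule add.subgroupI)
    show "null_ideal K v \<subseteq> carrier (cauchy_ring K v)" by (auto simp: null_ideal_iff)
    have "(\<lambda>n. 0) \<in> null_ideal K v"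
      using cauchy_const[OF sf_0[OF K]] by (auto simp: null_ideal_iff av_0[OF K v])
    then show "null_ideal K v \<noteq> {}" by blast
    show "\<ominus>\<^bsub>cauchy_ring K v\<^esub> s \<in> null_ideal K v" if s: "s \<in> null_ideal K v" for s
    proof -
      have "(\<lambda>n. -1 * s n) \<in> null_ideal K v"
        using sf_uminus[OF K sf_1[OF K]] by (intro null_mult[OF s] cauchy_const)
      moreover have "\<ominus>\<^bsub>cauchy_ring K v\<^esub> s = (\<lambda>n. - s n)"
        using s cauchy_uminus[of s]
        by (intro minus_equality) (auto simp: null_ideal_iff, auto simp: cauchy_ring_def)
      ultimately show ?thesis by simp
    qed
    show "s \<oplus>\<^bsub>cauchy_ring K v\<^esub> t \<in> null_ideal K v" if "s \<in> null_ideal K v" "t \<in> null_ideal K v" for s t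
      using null_add[OF that] by (simp add: cauchy_ring_def)
  qed
  fix s t assume st: "s \<in> null_ideal K v" "t \<in> carrier (cauchy_ring K v)"
  show "t \<otimes>\<^bsub>cauchy_ring K v\<^esub> s \<in> null_ideal K v"
    using null_mult[OF st] by (simp add: cauchy_ring_def)
  show "s \<otimes>\<^bsub>cauchy_ring K v\<^esub> t \<in> null_ideal K v"
    using null_mult[OF st] by (simp add: cauchy_ring_def mult.commute)
qed

text \<open>Dimensions are transported only between rings, so the quotient of Cauchy by null
  sequences has to be known to be one.\<close>

lemma completion_ring: "ring (completion K v)"
  unfolding completion_def by (rule ideal.quotient_is_ring[OF null_ideal_ideal])

end

section \<open>Transport of absolute values and local degrees along an automorphism\<close>

definition conj_abs :: "('a \<Rightarrow> 'a) \<Rightarrow> 'a set \<Rightarrow> ('a \<Rightarrow> real) \<Rightarrow> 'a \<Rightarrow> real" where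
  "conj_abs \<sigma> K a = restrict (\<lambda>x. a (inv_into UNIV \<sigma> x)) (\<sigma> ` K)"

lemma conj_abs_apply: "bij \<sigma> \<Longrightarrow> x \<in> K \<Longrightarrow> conj_abs \<sigma> K a (\<sigma> x) = a x"
  by (simp add: conj_abs_def bij_is_inj)

lemma conj_absolute_value:
  assumes \<sigma>: "field_automorphism \<sigma>" and K: "subfield K (Rg :: 'a :: field_char_0 ring)"
    and a: "absolute_value K a"
  shows "absolute_value (\<sigma> ` K) (conj_abs \<sigma> K a)"
  using a unfolding absolute_value_def
  by (auto simp: conj_abs_apply[OF aut_bij[OF \<sigma>]] aut_eq_0[OF \<sigma>] sf_mult[OF K] sf_add[OF K]
      simp flip: aut_mult[OF \<sigma>] aut_add[OF \<sigma>]) (simp add: conj_abs_def)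

text \<open>Applying \<open>\<sigma>\<close> termwise is an isomorphism of the rings of Cauchy
  sequences that matches null sequences. It induces an isomorphism of completions carrying the
  closure of the rationals to itself, because \<open>\<sigma>\<close> fixes rational
  sequences.\<close>

lemma local_degree_conj:
  assumes \<sigma>: "field_automorphism \<sigma>" and K: "subfield K (Rg :: 'a :: field_char_0 ring)"
    and K': "subfield (\<sigma> ` K) Rg" and v: "\<And>a. a \<in> v \<Longrightarrow> absolute_value K a"
  shows "local_degree (\<sigma> ` K) (conj_abs \<sigma> K ` v) = local_degree K v"
proof -
  define K2 v2 where "K2 = \<sigma> ` K" and "v2 = conj_abs \<sigma> K ` v"
  define C C2 where "C = cauchy_ring K v" and "C2 = cauchy_ring K2 v2"
  define I I2 where "I = null_ideal K v" and "I2 = null_ideal K2 v2"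
  define h where "h = (\<lambda>s :: nat \<Rightarrow> 'a. \<sigma> \<circ> s)"
  have v2: "absolute_value K2 a" if "a \<in> v2" for a
    using that conj_absolute_value[OF \<sigma> K v] by (auto simp: v2_def K2_def)
  have bij: "bij \<sigma>" by (rule aut_bij[OF \<sigma>])
  have inj: "inj h" unfolding h_def using bij by (auto simp: inj_def fun_eq_iff bij_def)
  have hC: "h s \<in> carrier C2 \<longleftrightarrow> s \<in> carrier C" for s
  proof -
    have "h s n \<in> K2 \<longleftrightarrow> s n \<in> K" for n
      using bij by (auto simp: h_def K2_def bij_def inj_def)
    moreover have "conj_abs \<sigma> K a (h s m - h s n) = a (s m - s n)" if "\<forall>n. s n \<in> K" for a m n
      using that sf_diff[OF K] by (simp add: h_def conj_abs_apply[OF bij] flip: aut_diff[OF \<sigma>])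
    ultimately show ?thesis
      unfolding C_def C2_def cauchy_carrier v2_def by auto
  qed
  have surj: "\<exists>s. t = h s" for t
    using bij by (intro exI[of _ "inv_into UNIV \<sigma> \<circ> t"]) (simp add: h_def fun_eq_iff bij_is_surj surj_f_inv_f)
  have hI: "h s \<in> I2 \<longleftrightarrow> s \<in> I" for s
  proof -
    have "(\<lambda>n. conj_abs \<sigma> K a (h s n)) = (\<lambda>n. a (s n))" if "s \<in> carrier C" for a
      using that by (auto simp: fun_eq_iff h_def C_def cauchy_carrier conj_abs_apply[OF bij])
    then show ?thesis
      unfolding I_def I2_def null_ideal_iff using hC by (auto simp: C_def C2_def v2_def)
  qed
  have him: "h ` A = B" if AB: "\<And>s. h s \<in> B \<longleftrightarrow> s \<in> A" for A B
  proof
    show "B \<subseteq> h ` A"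
    proof
      fix t assume t: "t \<in> B"
      obtain s where "t = h s" using surj by blast
      with t AB show "t \<in> h ` A" by simp
    qed
  qed (use AB in auto)
  have hCim: "h ` carrier C = carrier C2" using hC by (rule him)
  have hIim: "h ` I = I2" using hI by (rule him)
  have hadd: "h (s \<oplus>\<^bsub>C\<^esub> t) = h s \<oplus>\<^bsub>C2\<^esub> h t" for s t
    by (simp add: C_def C2_def cauchy_ring_def h_def fun_eq_iff aut_add[OF \<sigma>])
  have hmult: "h (s \<otimes>\<^bsub>C\<^esub> t) = h s \<otimes>\<^bsub>C2\<^esub> h t" for s t
    by (simp add: C_def C2_def cauchy_ring_def h_def fun_eq_iff aut_mult[OF \<sigma>])
  have hone: "h \<one>\<^bsub>C\<^esub> = \<one>\<^bsub>C2\<^esub>"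
    by (simp add: C_def C2_def cauchy_ring_def h_def fun_eq_iff aut_1[OF \<sigma>])
  have coset: "h ` (I +>\<^bsub>C\<^esub> s) = I2 +>\<^bsub>C2\<^esub> h s" for s
    unfolding a_r_coset_def r_coset_def hIim[symmetric] by (simp add: image_UN hadd)
  let ?Q = "C Quot I" and ?Q2 = "C2 Quot I2"
  have carr: "image h ` carrier ?Q = carrier ?Q2"
  proof -
    have "carrier ?Q = (\<lambda>s. I +>\<^bsub>C\<^esub> s) ` carrier C" "carrier ?Q2 = (\<lambda>s. I2 +>\<^bsub>C2\<^esub> s) ` carrier C2"
      unfolding FactRing_def A_RCOSETS_def RCOSETS_def a_r_coset_def by auto
    then show ?thesis unfolding hCim[symmetric] by (auto simp: image_image coset)
  qed
  have injim: "inj_on (image h) A" for A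
    using inj by (auto simp: inj_on_def inj_image_eq_iff)
  have iso: "image h \<in> ring_iso ?Q ?Q2"
    unfolding ring_iso_def ring_hom_def
  proof (intro CollectI conjI ballI allI impI)
    show "image h \<in> carrier ?Q \<rightarrow> carrier ?Q2" using carr by blast
    show "bij_betw (image h) (carrier ?Q) (carrier ?Q2)" using carr injim by (simp add: bij_betw_def)
    show "h ` (A \<otimes>\<^bsub>?Q\<^esub> B) = h ` A \<otimes>\<^bsub>?Q2\<^esub> h ` B" for A B
      by (simp add: FactRing_def rcoset_mult_def image_UN coset hmult)
    show "h ` (A \<oplus>\<^bsub>?Q\<^esub> B) = h ` A \<oplus>\<^bsub>?Q2\<^esub> h ` B" for A B
      by (simp add: FactRing_def set_add_def set_mult_def image_UN hadd)
    show "h ` \<one>\<^bsub>?Q\<^esub> = \<one>\<^bsub>?Q2\<^esub>" by (simp add: FactRing_def coset hone)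
  qed
  have ratrange: "h s = s" if "range s \<subseteq> \<rat>" for s
    using that aut_Rats[OF \<sigma>] by (auto simp: h_def fun_eq_iff)
  have hrat: "range (h s) \<subseteq> \<rat> \<longleftrightarrow> range s \<subseteq> \<rat>" for s
  proof
    assume *: "range (h s) \<subseteq> \<rat>"
    have "s n = h s n" for n
    proof -
      have "\<sigma> (h s n) = h s n" using * by (intro aut_Rats[OF \<sigma>]) auto
      then show ?thesis using bij by (simp add: h_def bij_def inj_eq)
    qed
    then show "range s \<subseteq> \<rat>" using * by (auto simp: image_subset_iff)
  qed (use ratrange in auto)
  have rat: "image h ` rat_completion K v = rat_completion K2 v2"
  proof -
    have r: "rat_completion K v = (\<lambda>s. I +>\<^bsub>C\<^esub> s) ` {s \<in> carrier C. range s \<subseteq> \<rat>}"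
      "rat_completion K2 v2 = (\<lambda>s. I2 +>\<^bsub>C2\<^esub> s) ` {s \<in> carrier C2. range s \<subseteq> \<rat>}"
      by (auto simp: rat_completion_def C_def C2_def I_def I2_def)
    have "h ` {s \<in> carrier C. range s \<subseteq> \<rat>} = {s \<in> carrier C2. range s \<subseteq> \<rat>}"
      by (rule him) (simp add: hC hrat)
    then have "rat_completion K2 v2 = (\<lambda>s. I2 +>\<^bsub>C2\<^esub> s) ` h ` {s \<in> carrier C. range s \<subseteq> \<rat>}"
      using r(2) by simp
    then show ?thesis by (simp add: r(1) image_image coset)
  qed
  have Q: "completion K v = ?Q" "completion K2 v2 = ?Q2"
    by (auto simp: completion_def C_def C2_def I_def I2_def)
  have rings: "ring ?Q" "ring ?Q2"
    using completion_ring[OF K, of v] completion_ring[OF K'[folded K2_def], of v2] v v2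
    by (simp_all add: Q)
  have sub: "rat_completion K v \<subseteq> carrier ?Q"
    unfolding FactRing_def A_RCOSETS_def RCOSETS_def
    by (auto simp: rat_completion_def C_def I_def a_r_coset_def)
  have "ring.dimension ?Q2 n (rat_completion K2 v2) (carrier ?Q2)
      \<longleftrightarrow> ring.dimension ?Q n (rat_completion K v) (carrier ?Q)" for n
    using dimension_iso_image[OF rings iso sub, of "carrier ?Q" n] by (simp add: carr rat)
  then have "local_degree K2 v2 = local_degree K v"
    unfolding local_degree_def Q ring.dim_def[OF rings(1)] ring.dim_def[OF rings(2)] by simp
  then show ?thesis by (simp add: K2_def v2_def)
qed

section \<open>Places of the algebraic closure\<close>

lemma subfield_UNIV: "subfield UNIV (Rg :: 'a :: field_char_0 ring)"
  by (simp add: subfield_Rg_iff)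

section \<open>The action of automorphisms on places\<close>

text \<open>Precomposition reverses the order of composition. With this convention the function of
  \<open>\<alpha>\<close> composed with the action of \<open>\<sigma>\<close> is the function of
  \<open>\<sigma> \<alpha>\<close>, with no inverse. It is a permutation of the whole type, not only
  of the set of places.\<close>

definition place_act :: "('a \<Rightarrow> 'a) \<Rightarrow> 'a place \<Rightarrow> 'a place" where
  "place_act \<sigma> y = (\<lambda>a. a \<circ> \<sigma>) ` y"

definition place_maps :: "('a :: field place \<Rightarrow> 'a place) set" where
  "place_maps = place_act ` {\<sigma>. field_automorphism \<sigma>}"

lemma place_act_comp: "place_act \<sigma> \<circ> place_act \<tau> = place_act (\<tau> \<circ> \<sigma>)"
  by (auto simp: place_act_def fun_eq_iff image_image comp_assoc)

lemma place_act_id: "place_act id = id"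
  by (simp add: place_act_def fun_eq_iff)

context
  fixes \<sigma> :: "'a :: field_char_0 \<Rightarrow> 'a"
  assumes \<sigma>: "field_automorphism \<sigma>"
begin

lemma aut_inv_right: "\<sigma> (inv_into UNIV \<sigma> x) = x"
  using aut_bij[OF \<sigma>] by (simp add: bij_is_surj surj_f_inv_f)

lemma aut_inv_left: "inv_into UNIV \<sigma> (\<sigma> x) = x"
  using aut_bij[OF \<sigma>] by (simp add: bij_is_inj)

lemma aut_inv_comp: "\<sigma> \<circ> inv_into UNIV \<sigma> = id" "inv_into UNIV \<sigma> \<circ> \<sigma> = id"
  by (auto simp: fun_eq_iff aut_inv_right aut_inv_left)

lemma absolute_value_UNIV_comp: "absolute_value UNIV a \<Longrightarrow> absolute_value UNIV (a \<circ> \<sigma>)"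
  by (simp add: absolute_value_def aut_eq_0[OF \<sigma>] aut_mult[OF \<sigma>] aut_add[OF \<sigma>])

lemma normalized_UNIV_comp: "normalized UNIV b \<Longrightarrow> normalized UNIV (b \<circ> \<sigma>)"
  using absolute_value_UNIV_comp by (simp add: normalized_def extends_usual_abs_def aut_of_rat[OF \<sigma>])

end

lemma place_act_place_of:
  fixes \<sigma> :: "'a :: field_char_0 \<Rightarrow> 'a"
  assumes \<sigma>: "field_automorphism \<sigma>"
  shows "place_act \<sigma> (place_of UNIV b) = place_of UNIV (b \<circ> \<sigma>)"
proof
  show "place_act \<sigma> (place_of UNIV b) \<subseteq> place_of UNIV (b \<circ> \<sigma>)"
    using absolute_value_UNIV_comp[OF \<sigma>]
    by (auto simp: place_act_def place_of_def equivalent_absolute_values_def)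
  show "place_of UNIV (b \<circ> \<sigma>) \<subseteq> place_act \<sigma> (place_of UNIV b)"
  proof
    fix c assume "c \<in> place_of UNIV (b \<circ> \<sigma>)"
    then obtain s where c: "absolute_value UNIV c" "s > 0" "\<And>x. c x = b (\<sigma> x) powr s"
      by (auto simp: place_of_def equivalent_absolute_values_def)
    have "c \<circ> inv_into UNIV \<sigma> \<in> place_of UNIV b"
      using absolute_value_UNIV_comp[OF aut_inv[OF \<sigma>] c(1)] c(2,3)
      by (auto simp: place_of_def equivalent_absolute_values_def aut_inv_right[OF \<sigma>])
    moreover have "c = (c \<circ> inv_into UNIV \<sigma>) \<circ> \<sigma>"
      by (simp add: comp_assoc aut_inv_comp[OF \<sigma>])
    ultimately show "c \<in> place_act \<sigma> (place_of UNIV b)" unfolding place_act_def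
      by (intro image_eqI[of _ _ "c \<circ> inv_into UNIV \<sigma>"])
  qed
qed

lemma place_maps_id: "id \<in> place_maps"
  unfolding place_maps_def using aut_id place_act_id by (metis imageI mem_Collect_eq)

lemma place_maps_comp: "s \<in> place_maps \<Longrightarrow> t \<in> place_maps \<Longrightarrow> s \<circ> t \<in> place_maps"
  unfolding place_maps_def by (auto simp: place_act_comp intro!: imageI aut_comp)

lemma place_maps_inv:
  fixes s :: "'a :: field_char_0 place \<Rightarrow> 'a place"
  assumes "s \<in> place_maps" shows "\<exists>t\<in>place_maps. s \<circ> t = id \<and> t \<circ> s = id"
proof -
  obtain \<sigma> where \<sigma>: "field_automorphism \<sigma>" "s = place_act \<sigma>" using assms by (auto simp: place_maps_def)
  then show ?thesis
    using aut_inv[OF \<sigma>(1)]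
    by (intro bexI[of _ "place_act (inv_into UNIV \<sigma>)"])
      (auto simp: place_maps_def place_act_comp aut_inv_comp[OF \<sigma>(1)] place_act_id)
qed

lemma place_of_conj:
  fixes \<sigma> :: "'a :: field_char_0 \<Rightarrow> 'a"
  assumes \<sigma>: "field_automorphism \<sigma>" and K: "subfield K Rg" and K': "subfield (\<sigma> ` K) Rg"
  shows "place_of (\<sigma> ` K) (conj_abs \<sigma> K b) = conj_abs \<sigma> K ` place_of K b"
proof
  have bij: "bij \<sigma>" by (rule aut_bij[OF \<sigma>])
  show "conj_abs \<sigma> K ` place_of K b \<subseteq> place_of (\<sigma> ` K) (conj_abs \<sigma> K b)"
    using conj_absolute_value[OF \<sigma> K]
    by (auto simp: place_of_def equivalent_absolute_values_def conj_abs_apply[OF bij])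
  show "place_of (\<sigma> ` K) (conj_abs \<sigma> K b) \<subseteq> conj_abs \<sigma> K ` place_of K b"
  proof
    fix d assume "d \<in> place_of (\<sigma> ` K) (conj_abs \<sigma> K b)"
    then obtain s where d: "absolute_value (\<sigma> ` K) d" "s > 0" "\<And>x. x \<in> K \<Longrightarrow> d (\<sigma> x) = b x powr s"
      by (auto simp: place_of_def equivalent_absolute_values_def conj_abs_apply[OF bij])
    define e where "e = restrict (d \<circ> \<sigma>) K"
    have "absolute_value K e"
      using d(1) unfolding absolute_value_def e_def
      by (auto simp: aut_eq_0[OF \<sigma>] aut_mult[OF \<sigma>] aut_add[OF \<sigma>] sf_mult[OF K] sf_add[OF K])
    then have "e \<in> place_of K b"
      using d(2,3) by (auto simp: place_of_def equivalent_absolute_values_def e_def)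
    moreover have "d = conj_abs \<sigma> K e"
    proof (rule extensionalityI[of _ "\<sigma> ` K"])
      show "d \<in> extensional (\<sigma> ` K)" using d(1) by (simp add: absolute_value_def)
      show "conj_abs \<sigma> K e \<in> extensional (\<sigma> ` K)" by (simp add: conj_abs_def)
      show "d x = conj_abs \<sigma> K e x" if "x \<in> \<sigma> ` K" for x
        using that by (auto simp: conj_abs_apply[OF bij] e_def)
    qed
    ultimately show "d \<in> conj_abs \<sigma> K ` place_of K b" by blast
  qed
qed

text \<open>Supplies the reindexing between the sums over the absolute values of \<open>K\<close>
  and of its conjugate field.\<close>

lemma conj_normalized:
  fixes \<sigma> :: "'a :: field_char_0 \<Rightarrow> 'a"
  assumes \<sigma>: "field_automorphism \<sigma>" and K: "subfield K Rg"
  shows "bij_betw (conj_abs \<sigma> K) {c. normalized K c} {c. normalized (\<sigma> ` K) c}"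
proof (rule bij_betw_byWitness[where f' = "\<lambda>d. restrict (d \<circ> \<sigma>) K"])
  have bij: "bij \<sigma>" by (rule aut_bij[OF \<sigma>])
  show "\<forall>c\<in>{c. normalized K c}. restrict (conj_abs \<sigma> K c \<circ> \<sigma>) K = c"
    by (auto simp: normalized_def absolute_value_def conj_abs_apply[OF bij]
        intro!: extensionalityI[of _ K])
  show "\<forall>d\<in>{d. normalized (\<sigma> ` K) d}. conj_abs \<sigma> K (restrict (d \<circ> \<sigma>) K) = d"
  proof
    fix d assume "d \<in> {d. normalized (\<sigma> ` K) d}"
    then show "conj_abs \<sigma> K (restrict (d \<circ> \<sigma>) K) = d"
      by (intro extensionalityI[of _ "\<sigma> ` K"])
        (auto simp: conj_abs_apply[OF bij], auto simp: normalized_def absolute_value_def conj_abs_def)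
  qed
  have "conj_abs \<sigma> K c (of_rat r) = c (of_rat r)" for c r
    using conj_abs_apply[OF bij sf_of_rat[OF K], of c r] by (simp add: aut_of_rat[OF \<sigma>])
  then show "conj_abs \<sigma> K ` {c. normalized K c} \<subseteq> {c. normalized (\<sigma> ` K) c}"
    using conj_absolute_value[OF \<sigma> K] by (auto simp: normalized_def extends_usual_abs_def)
  show "(\<lambda>d. restrict (d \<circ> \<sigma>) K) ` {c. normalized (\<sigma> ` K) c} \<subseteq> {c. normalized K c}"
    by (auto simp: normalized_def extends_usual_abs_def absolute_value_def sf_of_rat[OF K]
        aut_of_rat[OF \<sigma>] aut_eq_0[OF \<sigma>] aut_mult[OF \<sigma>] aut_add[OF \<sigma>] sf_mult[OF K] sf_add[OF K])
qed

context
  assumes alg: "\<forall>x :: 'a :: {alg_closed_field, field_char_0}. algebraic x"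
begin

lemma place_abs_normalized:
  assumes "y \<in> (places_Qbar :: 'a place set)"
  shows "normalized UNIV (place_abs y)" "y = place_of UNIV (place_abs y)"
proof -
  obtain b where "normalized UNIV b" "y = place_of UNIV b"
    using place_has_normalized[OF alg subfield_UNIV assms] by blast
  then show "normalized UNIV (place_abs y)" "y = place_of UNIV (place_abs y)"
    using place_abs_place_of[of b] by simp_all
qed

lemma place_abs_pos: "y \<in> (places_Qbar :: 'a place set) \<Longrightarrow> \<alpha> \<noteq> 0 \<Longrightarrow> place_abs y \<alpha> > 0"
  using place_abs_normalized(1)[of y] by (auto simp: normalized_def intro: av_pos[OF subfield_UNIV])

lemma place_act_places:
  assumes \<sigma>: "field_automorphism (\<sigma> :: 'a \<Rightarrow> 'a)" and y: "y \<in> places_Qbar"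
  shows "place_act \<sigma> y \<in> places_Qbar" "place_abs (place_act \<sigma> y) = place_abs y \<circ> \<sigma>"
proof -
  note n = normalized_UNIV_comp[OF \<sigma> place_abs_normalized(1)[OF y]]
  have "place_act \<sigma> y = place_of UNIV (place_abs y \<circ> \<sigma>)"
    using place_act_place_of[OF \<sigma>] place_abs_normalized(2)[OF y] by metis
  with n show "place_act \<sigma> y \<in> places_Qbar" "place_abs (place_act \<sigma> y) = place_abs y \<circ> \<sigma>"
    using place_of_normalized_mem[OF subfield_UNIV] place_abs_place_of by auto
qed

lemma log_fun_act:
  assumes \<sigma>: "field_automorphism (\<sigma> :: 'a \<Rightarrow> 'a)"
  shows "log_fun \<alpha> \<circ> place_act \<sigma> = log_fun (\<sigma> \<alpha>)"
proof
  fix y :: "'a place"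
  show "(log_fun \<alpha> \<circ> place_act \<sigma>) y = log_fun (\<sigma> \<alpha>) y"
  proof (cases "y \<in> places_Qbar")
    case False
    \<comment> \<open>Non-places stay non-places, as the inverse automorphism would bring a place
      back to a place. Both sides then take the default value 0.\<close>
    have "place_act \<sigma> y \<notin> places_Qbar"
    proof
      assume "place_act \<sigma> y \<in> places_Qbar"
      then have "place_act (inv_into UNIV \<sigma>) (place_act \<sigma> y) \<in> places_Qbar"
        by (rule place_act_places(1)[OF aut_inv[OF \<sigma>]])
      moreover have "place_act (inv_into UNIV \<sigma>) (place_act \<sigma> y) = y"
        using place_act_comp[of "inv_into UNIV \<sigma>" \<sigma>] by (simp add: fun_eq_iff aut_inv_comp[OF \<sigma>] place_act_id)
      ultimately show False using False by simp
    qed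
    with False show ?thesis by (simp add: log_fun_def)
  qed (simp add: log_fun_def place_act_places[OF \<sigma>])
qed

section \<open>The rational vector space of logarithmic functions\<close>

lemma log_fun_mult: "\<alpha> \<noteq> 0 \<Longrightarrow> \<beta> \<noteq> 0 \<Longrightarrow> log_fun (\<alpha> * \<beta>) = log_fun \<alpha> + log_fun (\<beta> :: 'a)"
proof (rule ext)
  fix y :: "'a place" assume nz: "\<alpha> \<noteq> 0" "\<beta> \<noteq> 0"
  show "log_fun (\<alpha> * \<beta>) y = (log_fun \<alpha> + log_fun \<beta>) y"
  proof (cases "y \<in> places_Qbar")
    case True
    have "place_abs y (\<alpha> * \<beta>) = place_abs y \<alpha> * place_abs y \<beta>"
      using place_abs_normalized(1)[OF True] by (intro av_mult[OF subfield_UNIV]) (auto simp: normalized_def)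
    then show ?thesis using True place_abs_pos[OF True nz(1)] place_abs_pos[OF True nz(2)]
      by (simp add: log_fun_def ln_mult)
  qed (simp add: log_fun_def)
qed

lemma log_fun_one: "log_fun (1 :: 'a) = 0"
  using log_fun_mult[of 1 1] by (simp add: fun_eq_iff)

lemma log_fun_power: "\<alpha> \<noteq> 0 \<Longrightarrow> log_fun (\<alpha> ^ n) = rat_scale (of_nat n) (log_fun (\<alpha> :: 'a))"
  by (induction n) (simp_all add: log_fun_one log_fun_mult rat_scale_def fun_eq_iff of_rat_add algebra_simps)

lemma log_fun_inverse: "\<alpha> \<noteq> 0 \<Longrightarrow> log_fun (inverse \<alpha>) = - log_fun (\<alpha> :: 'a)"
  using log_fun_mult[of \<alpha> "inverse \<alpha>"] log_fun_one by (simp add: eq_neg_iff_add_eq_0 add.commute)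

lemma log_fun_prod:
  "finite A \<Longrightarrow> 0 \<notin> A \<Longrightarrow> log_fun (\<Prod>\<alpha>\<in>A. \<alpha>) = (\<Sum>\<alpha>\<in>A. log_fun (\<alpha> :: 'a))"
proof (induction A rule: finite_induct)
  case (insert \<alpha> A)
  then show ?case unfolding prod.insert[OF insert.hyps] sum.insert[OF insert.hyps]
    by (subst log_fun_mult) auto
qed (simp add: log_fun_one)

text \<open>Integer multiples come from powers and inverses, and division by \<open>n\<close> from
  an \<open>n\<close>-th root, which exists since the field is algebraically closed.\<close>

lemma rat_scale_log_fun:
  assumes "(\<alpha> :: 'a) \<noteq> 0" shows "\<exists>\<beta>. \<beta> \<noteq> 0 \<and> rat_scale q (log_fun \<alpha>) = log_fun \<beta>"
proof -
  have int: "\<exists>\<beta>. \<beta> \<noteq> 0 \<and> rat_scale (of_int k) (log_fun \<alpha>) = log_fun \<beta>" if \<alpha>: "(\<alpha> :: 'a) \<noteq> 0" for k \<alpha>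
  proof (cases k rule: int_cases2)
    case (nonneg n)
    then show ?thesis using log_fun_power[OF \<alpha>, of n] \<alpha> by (intro exI[of _ "\<alpha> ^ n"]) simp
  next
    case (nonpos n)
    then show ?thesis
      using log_fun_power[OF \<alpha>, of n] log_fun_inverse[of "\<alpha> ^ n"] \<alpha>
      by (intro exI[of _ "inverse (\<alpha> ^ n)"]) (simp add: rat_scale_def fun_eq_iff of_rat_minus)
  qed
  obtain a b where q: "q = of_int a / of_int b" "b > 0"
    using quotient_of_div[of q] quotient_of_denom_pos'[of q] by (metis prod.collapse)
  define n where "n = nat b"
  have n: "n > 0" "of_int b = (of_nat n :: rat)" using q(2) by (auto simp: n_def)
  obtain \<beta> where \<beta>: "\<beta> ^ n = \<alpha>"
  proof -
    have "coeff (monom 1 n - [:\<alpha>:]) n \<noteq> 0"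
      using n(1) by (cases n) simp_all
    then have "n \<le> degree (monom 1 n - [:\<alpha>:])" by (rule le_degree)
    then obtain x where "poly (monom 1 n - [:\<alpha>:]) x = 0"
      using alg_closed_imp_poly_has_root[of "monom 1 n - [:\<alpha>:]"] n(1) by auto
    then show ?thesis using that by (simp add: poly_monom)
  qed
  have \<beta>0: "\<beta> \<noteq> 0" using \<beta> assms n(1) by auto
  have "rat_scale (of_int a) (log_fun \<beta>) = rat_scale q (log_fun \<alpha>)"
    unfolding \<beta>[symmetric] log_fun_power[OF \<beta>0] using q n
    by (simp add: rat_scale_def fun_eq_iff of_rat_divide of_rat_mult[symmetric])
  then show ?thesis using int[OF \<beta>0, of a] by simp
qed

lemma log_space_subspace: "rat_fun.subspace (log_space :: ('a place \<Rightarrow> real) set)"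
proof (rule rat_fun.subspaceI)
  show "0 \<in> (log_space :: ('a place \<Rightarrow> real) set)"
    unfolding log_space_def using log_fun_one by (metis (mono_tags, lifting) mem_Collect_eq one_neq_zero)
  fix f g :: "'a place \<Rightarrow> real" and q assume f: "f \<in> log_space"
  show "f + g \<in> log_space" if "g \<in> log_space"
  proof -
    obtain \<alpha> \<beta> where "f = log_fun \<alpha>" "g = log_fun \<beta>" "\<alpha> \<noteq> 0" "\<beta> \<noteq> 0"
      using f \<open>g \<in> log_space\<close> by (auto simp: log_space_def)
    then have "f + g = log_fun (\<alpha> * \<beta>)" "\<alpha> * \<beta> \<noteq> 0" by (simp_all only: log_fun_mult mult_eq_0_iff simp_thms not_False_eq_True)
    then show ?thesis unfolding log_space_def by blast
  qed
  show "rat_scale q f \<in> log_space"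
    using f rat_scale_log_fun[of _ q] unfolding log_space_def by blast
qed

lemma permuted_log_space: "permuted_functions place_maps (log_space :: ('a place \<Rightarrow> real) set)"
proof
  fix f :: "'a place \<Rightarrow> real" assume "f \<in> log_space"
  then obtain \<alpha> where \<alpha>: "f = log_fun \<alpha>" "\<alpha> \<noteq> 0" by (auto simp: log_space_def)
  show "f \<circ> s \<in> log_space" if "s \<in> place_maps" for s
  proof -
    obtain \<sigma> where \<sigma>: "field_automorphism \<sigma>" "s = place_act \<sigma>"
      using \<open>s \<in> place_maps\<close> by (auto simp: place_maps_def)
    then have "f \<circ> s = log_fun (\<sigma> \<alpha>)" "\<sigma> \<alpha> \<noteq> 0"
      using \<alpha> by (simp_all add: log_fun_act aut_eq_0)
    then show ?thesis unfolding log_space_def by blast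
  qed
  have "(\<lambda>s. f \<circ> s) ` place_maps \<subseteq> log_fun ` conjugates \<alpha>"
    using \<alpha> unfolding place_maps_def conjugates_def by (auto simp: log_fun_act)
  then show "finite ((\<lambda>s. f \<circ> s) ` place_maps)"
    using conjugates_finite[of \<alpha>] alg finite_subset by blast
qed (use place_maps_id place_maps_comp place_maps_inv log_space_subspace in blast)+

text \<open>A function \<open>f\<^sub>\<alpha>\<close> may have fewer conjugates than \<open>\<alpha>\<close>. Multiplying the conjugates of \<open>\<alpha>\<close> under
  the stabilizer of \<open>f\<^sub>\<alpha>\<close> gives an element of small degree that represents a multiple of \<open>f\<^sub>\<alpha>\<close>.\<close>

lemma small_orbit_in_V_degree:
  assumes f: "f \<in> (log_space :: ('a place \<Rightarrow> real) set)"
    and n: "card ((\<lambda>s. f \<circ> s) ` place_maps) \<le> n"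
  shows "f \<in> V_degree n"
proof -
  obtain \<alpha> where \<alpha>: "f = log_fun \<alpha>" "\<alpha> \<noteq> 0" using f by (auto simp: log_space_def)
  let ?G = "{\<sigma> :: 'a \<Rightarrow> 'a. field_automorphism \<sigma>}"
  \<comment> \<open>The stabilizer of the function rather than of the number: it also contains
    automorphisms that move \<open>\<alpha>\<close> without changing its absolute values.\<close>
  define Hs where "Hs = {\<sigma> \<in> ?G. log_fun (\<sigma> \<alpha>) = log_fun \<alpha>}"
  define C where "C = (\<lambda>\<sigma>. \<sigma> \<alpha>) ` Hs"
  define \<beta> where "\<beta> = (\<Prod>\<gamma>\<in>C. \<gamma>)"
  have finC: "finite C"
    by (rule finite_subset[OF _ conjugates_finite[OF alg[rule_format], of \<alpha>]])
      (auto simp: C_def Hs_def conjugates_def)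
  have C0: "0 \<notin> C" using \<alpha>(2) by (auto simp: C_def Hs_def aut_eq_0)
  have \<beta>0: "\<beta> \<noteq> 0" using finC C0 by (auto simp: \<beta>_def)
  have "id \<in> Hs" using aut_id by (simp add: Hs_def)
  then have "C \<noteq> {}" by (auto simp: C_def)
  then have cardC: "card C > 0" using finC by (simp add: card_gt_0_iff)
  have "log_fun \<beta> = (\<Sum>\<gamma>\<in>C. f)"
    unfolding \<beta>_def log_fun_prod[OF finC C0] \<alpha>(1) by (rule sum.cong) (auto simp: C_def Hs_def)
  then have f\<beta>: "f = rat_scale (1 / of_nat (card C)) (log_fun \<beta>)"
    using cardC by (simp add: rat_scale_def fun_eq_iff sum_fun_apply of_rat_divide)
  \<comment> \<open>The stabilizer is closed under composition, so each of its elements permutes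
    \<open>C\<close> and fixes the product.\<close>
  have fix\<beta>: "\<rho> \<beta> = \<beta>" if \<rho>: "\<rho> \<in> Hs" for \<rho>
  proof -
    have aut: "field_automorphism \<rho>" using \<rho> by (simp add: Hs_def)
    have "\<rho> \<circ> \<sigma> \<in> Hs" if "\<sigma> \<in> Hs" for \<sigma>
    proof -
      have "log_fun (\<rho> (\<sigma> \<alpha>)) = log_fun (\<sigma> \<alpha>) \<circ> place_act \<rho>" by (simp add: log_fun_act[OF aut])
      also have "\<dots> = log_fun \<alpha> \<circ> place_act \<rho>" using that by (simp add: Hs_def)
      also have "\<dots> = log_fun \<alpha>" using \<rho> by (simp add: log_fun_act[OF aut] Hs_def)
      finally show ?thesis using that aut aut_comp by (auto simp: Hs_def)
    qed
    then have "\<rho> ` C \<subseteq> C" unfolding C_def by (auto simp: image_iff) (metis comp_apply)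
    moreover have inj: "inj_on \<rho> C" using aut_bij[OF aut] by (auto simp: bij_def intro: inj_on_subset)
    ultimately have "\<rho> ` C = C" using finC by (intro endo_inj_surj)
    then have "(\<Prod>\<gamma>\<in>C. \<rho> \<gamma>) = (\<Prod>\<gamma>\<in>C. \<gamma>)" using prod.reindex[OF inj, of "\<lambda>x. x"] by simp
    then show ?thesis by (simp add: \<beta>_def aut_prod[OF aut])
  qed
  have orb: "(\<lambda>s. f \<circ> s) ` place_maps = (\<lambda>\<sigma>. log_fun (\<sigma> \<alpha>)) ` ?G"
    unfolding place_maps_def \<alpha>(1) image_image by (rule image_cong) (auto simp: log_fun_act)
  have "finite ((\<lambda>\<sigma>. log_fun (\<sigma> \<alpha>)) ` ?G)"
    using permuted_functions.V_orbit[OF permuted_log_space f] by (simp add: orb)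
  then have "card ((\<lambda>\<sigma>. \<sigma> \<beta>) ` ?G) \<le> card ((\<lambda>\<sigma>. log_fun (\<sigma> \<alpha>)) ` ?G)"
  proof (rule card_image_le_if_factors)
    \<comment> \<open>Automorphisms with the same effect on the function of \<open>\<alpha>\<close>
      differ by an element of \<open>Hs\<close>, which fixes \<open>\<beta>\<close>. So
      \<open>\<beta>\<close> has no more conjugates than \<open>f\<close>.\<close>
    fix \<sigma> \<tau> assume st: "\<sigma> \<in> ?G" "\<tau> \<in> ?G" "log_fun (\<sigma> \<alpha>) = log_fun (\<tau> \<alpha>)"
    define \<rho> where "\<rho> = inv_into UNIV \<tau> \<circ> \<sigma>"
    have i: "field_automorphism (inv_into UNIV \<tau>)" using aut_inv st(2) by blast
    have "log_fun (\<rho> \<alpha>) = log_fun (\<sigma> \<alpha>) \<circ> place_act (inv_into UNIV \<tau>)"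
      by (simp add: \<rho>_def log_fun_act[OF i])
    also have "\<dots> = log_fun \<alpha>"
      using st(2,3) by (simp add: log_fun_act[OF i] aut_inv_left)
    finally have "\<rho> \<in> Hs" using aut_comp[OF i] st(1) by (simp add: Hs_def \<rho>_def)
    then have "inv_into UNIV \<tau> (\<sigma> \<beta>) = \<beta>" using fix\<beta> by (fastforce simp: \<rho>_def)
    then show "\<sigma> \<beta> = \<tau> \<beta>" using aut_inv_right[of \<tau> "\<sigma> \<beta>"] st(2) by simp
  qed
  also have "(\<lambda>\<sigma>. \<sigma> \<beta>) ` ?G = conjugates \<beta>" by (auto simp: conjugates_def)
  finally have card\<beta>: "card (conjugates \<beta>) \<le> n" using n orb by simp
  obtain p where p: "rational_poly p" "p \<noteq> 0" "degree p = card (conjugates \<beta>)" "poly p \<beta> = 0"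
    using rational_poly_of_conjugates[OF alg] by blast
  obtain K where K: "number_field K" "field_degree K \<le> degree p" "\<beta> \<in> K"
    using number_field_of_degree[OF p(1,2,4)] by blast
  have "log_fun \<beta> \<in> V_field K"
    unfolding V_field_def using K(3) \<beta>0 by (intro rat_fun.span_base) blast
  then have "log_fun \<beta> \<in> V_degree n"
    unfolding V_degree_def using K(1,2) p(3) card\<beta> by (intro rat_fun.span_base) auto
  then show ?thesis
    unfolding f\<beta> V_degree_def by (rule rat_fun.span_scale)
qed

section \<open>The inner product as a finite sum over absolute values of a number field\<close>

context
  fixes \<mu> :: "'a place measure"
  assumes \<mu>: "place_measure \<mu>"
begin

lemma places_above_measure:
  assumes K: "number_field K" and c: "normalized K c"
  shows "places_above K (place_of K c) \<in> sets \<mu>"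
    "emeasure \<mu> (places_above K (place_of K c)) < \<infinity>"
    "measure \<mu> (places_above K (place_of K c)) = local_degree K (place_of K c) / field_degree K"
proof -
  have v: "place_of K c \<in> places K" by (rule place_of_normalized_mem[OF number_field_subfield[OF K] c])
  have "openin place_topology (places_above K (place_of K c))"
    unfolding place_topology_def using K v by (intro topology_generated_by_Basis) blast
  then show "places_above K (place_of K c) \<in> sets \<mu>"
    using \<mu> by (simp add: place_measure_def sigma_sets.Basic)
  have "emeasure \<mu> (places_above K (place_of K c))
      = ennreal (real (local_degree K (place_of K c)) / real (field_degree K))"
    using \<mu> K v by (simp add: place_measure_def)
  then show "emeasure \<mu> (places_above K (place_of K c)) < \<infinity>"
    "measure \<mu> (places_above K (place_of K c)) = local_degree K (place_of K c) / field_degree K"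
    by (simp_all add: measure_def)
qed

text \<open>Both functions depend only on the restriction of the absolute value to \<open>K\<close>,
  and the first vanishes outside finitely many basic sets. The integrand is a finite combination of
  indicators whose measures are prescribed.\<close>

lemma log_fun_product:
  assumes K: "number_field K" and \<alpha>: "\<alpha> \<in> K" "\<alpha> \<noteq> 0" and \<beta>: "\<beta> \<in> K"
  defines "A \<equiv> {c. normalized K c \<and> c \<alpha> \<noteq> 1}"
  shows "integrable \<mu> (\<lambda>y. log_fun \<alpha> y * log_fun \<beta> y)"
    "place_inner \<mu> (log_fun \<alpha>) (log_fun \<beta>)
       = (\<Sum>c\<in>A. ln (c \<alpha>) * ln (c \<beta>) * (local_degree K (place_of K c) / field_degree K))"
proof -
  note K' = number_field_subfield[OF K]
  have finA: "finite A" unfolding A_def by (rule finite_nontrivial_normalized[OF alg K \<alpha>])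
  let ?Y = "\<lambda>c. places_above K (place_of K c)"
  have eq: "log_fun \<alpha> y * log_fun \<beta> y = (\<Sum>c\<in>A. ln (c \<alpha>) * ln (c \<beta>) * indicator (?Y c) y)"
    if y: "y \<in> space \<mu>" for y
  proof -
    have yQ: "y \<in> places_Qbar" using \<mu> y by (simp add: place_measure_def)
    define c0 where "c0 = restrict (place_abs y) K"
    have c0: "normalized K c0"
      unfolding c0_def by (rule normalized_restrict[OF place_abs_normalized(1)[OF yQ] K'])
    have lhs: "log_fun \<alpha> y * log_fun \<beta> y = ln (c0 \<alpha>) * ln (c0 \<beta>)"
      using yQ \<alpha>(1) \<beta> by (simp add: log_fun_def c0_def)
    have "(\<Sum>c\<in>A. ln (c \<alpha>) * ln (c \<beta>) * indicator (?Y c) y)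
        = (\<Sum>c\<in>A. if c = c0 then ln (c0 \<alpha>) * ln (c0 \<beta>) else 0)"
    proof (rule sum.cong[OF refl])
      fix c assume "c \<in> A"
      then have "?Y c = {y \<in> places_Qbar. restrict (place_abs y) K = c}"
        by (intro places_above_place_of[OF alg K']) (simp add: A_def)
      then show "ln (c \<alpha>) * ln (c \<beta>) * indicator (?Y c) y = (if c = c0 then ln (c0 \<alpha>) * ln (c0 \<beta>) else 0)"
        using yQ by (auto simp: c0_def)
    qed
    also have "\<dots> = (if c0 \<in> A then ln (c0 \<alpha>) * ln (c0 \<beta>) else 0)" using finA by simp
    \<comment> \<open>If \<open>c0\<close> is not in \<open>A\<close>, then
      \<open>c0 \<alpha> = 1\<close> and its logarithm is 0, so both sides vanish.\<close>
    also have "\<dots> = ln (c0 \<alpha>) * ln (c0 \<beta>)" using c0 by (auto simp: A_def)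
    finally show ?thesis using lhs by simp
  qed
  have Y: "?Y c \<in> sets \<mu>" "emeasure \<mu> (?Y c) < \<infinity>"
    "measure \<mu> (?Y c) = local_degree K (place_of K c) / field_degree K" if "c \<in> A" for c
    using places_above_measure[OF K, of c] that by (auto simp: A_def)
  have int: "integrable \<mu> (\<lambda>y. ln (c \<alpha>) * ln (c \<beta>) * indicator (?Y c) y)" if "c \<in> A" for c
    using Y[OF that] by (intro integrable_mult_right integrable_real_indicator)
  show "integrable \<mu> (\<lambda>y. log_fun \<alpha> y * log_fun \<beta> y)"
    by (rule iffD2[OF Bochner_Integration.integrable_cong[OF refl eq]
        Bochner_Integration.integrable_sum[OF int]])
  have "place_inner \<mu> (log_fun \<alpha>) (log_fun \<beta>)
      = (\<integral>y. (\<Sum>c\<in>A. ln (c \<alpha>) * ln (c \<beta>) * indicator (?Y c) y) \<partial>\<mu>)"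
    unfolding place_inner_def by (rule Bochner_Integration.integral_cong[OF refl eq])
  also have "\<dots> = (\<Sum>c\<in>A. \<integral>y. ln (c \<alpha>) * ln (c \<beta>) * indicator (?Y c) y \<partial>\<mu>)"
    by (rule Bochner_Integration.integral_sum[OF int])
  also have "\<dots> = (\<Sum>c\<in>A. ln (c \<alpha>) * ln (c \<beta>) * (local_degree K (place_of K c) / field_degree K))"
  proof (rule sum.cong[OF refl])
    fix c assume c: "c \<in> A"
    have "?Y c \<inter> space \<mu> = ?Y c" using sets.sets_into_space[OF Y(1)[OF c]] by blast
    then show "(\<integral>y. ln (c \<alpha>) * ln (c \<beta>) * indicator (?Y c) y \<partial>\<mu>)
        = ln (c \<alpha>) * ln (c \<beta>) * (local_degree K (place_of K c) / field_degree K)"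
      using Y[OF c] by simp
  qed
  finally show "place_inner \<mu> (log_fun \<alpha>) (log_fun \<beta>)
       = (\<Sum>c\<in>A. ln (c \<alpha>) * ln (c \<beta>) * (local_degree K (place_of K c) / field_degree K))" .
qed

lemma log_space_integrable:
  assumes "f \<in> log_space" "g \<in> log_space" shows "integrable \<mu> (\<lambda>y. f y * g y)"
proof -
  obtain \<alpha> \<beta> where ab: "f = log_fun \<alpha>" "g = log_fun \<beta>" "\<alpha> \<noteq> 0"
    using assms by (auto simp: log_space_def)
  obtain K where "number_field K" "\<alpha> \<in> K" "\<beta> \<in> K"
    using number_field_containing[OF alg[rule_format] alg[rule_format], of \<alpha> \<beta>] by blast
  from log_fun_product(1)[OF this(1,2) ab(3) this(3)] show ?thesis by (simp add: ab)
qed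

text \<open>The finite sums over \<open>K\<close> and over its image under \<open>\<sigma>\<close>
  agree term by term under \<open>conj_abs\<close>: logarithms are transported, and the local and
  global degrees are invariant.\<close>

lemma place_inner_aut:
  assumes \<sigma>: "field_automorphism \<sigma>" and \<alpha>: "\<alpha> \<noteq> 0"
  shows "place_inner \<mu> (log_fun (\<sigma> \<alpha>)) (log_fun (\<sigma> \<beta>)) = place_inner \<mu> (log_fun \<alpha>) (log_fun \<beta>)"
proof -
  obtain K where K: "number_field K" "\<alpha> \<in> K" "\<beta> \<in> K"
    using number_field_containing[OF alg[rule_format] alg[rule_format], of \<alpha> \<beta>] by blast
  note sK = aut_image_number_field[OF \<sigma> K(1)]
  note K' = number_field_subfield[OF K(1)] number_field_subfield[OF sK(1)]
  have bij: "bij \<sigma>" by (rule aut_bij[OF \<sigma>])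
  define A where "A = {c. normalized K c \<and> c \<alpha> \<noteq> 1}"
  have A2: "{c. normalized (\<sigma> ` K) c \<and> c (\<sigma> \<alpha>) \<noteq> 1} = conj_abs \<sigma> K ` A"
  proof -
    have "{c. normalized (\<sigma> ` K) c \<and> c (\<sigma> \<alpha>) \<noteq> 1}
        = {c \<in> conj_abs \<sigma> K ` {c. normalized K c}. c (\<sigma> \<alpha>) \<noteq> 1}"
      using conj_normalized[OF \<sigma> K'(1)] by (auto simp: bij_betw_def)
    also have "\<dots> = conj_abs \<sigma> K ` A"
      using K(2) by (auto simp: A_def conj_abs_apply[OF bij])
    finally show ?thesis .
  qed
  have inj: "inj_on (conj_abs \<sigma> K) A"
    using conj_normalized[OF \<sigma> K'(1)] by (auto simp: bij_betw_def A_def intro: inj_on_subset)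
  have ld: "local_degree (\<sigma> ` K) (place_of (\<sigma> ` K) (conj_abs \<sigma> K c)) = local_degree K (place_of K c)" for c
    unfolding place_of_conj[OF \<sigma> K'] by (rule local_degree_conj[OF \<sigma> K']) (simp add: place_of_def)
  have "place_inner \<mu> (log_fun (\<sigma> \<alpha>)) (log_fun (\<sigma> \<beta>))
      = (\<Sum>c\<in>conj_abs \<sigma> K ` A. ln (c (\<sigma> \<alpha>)) * ln (c (\<sigma> \<beta>)) *
          (local_degree (\<sigma> ` K) (place_of (\<sigma> ` K) c) / field_degree (\<sigma> ` K)))"
    unfolding A2[symmetric] using K \<alpha>
    by (intro log_fun_product(2) sK(1)) (auto simp: aut_eq_0[OF \<sigma>])
  also have "\<dots> = (\<Sum>c\<in>A. ln (c \<alpha>) * ln (c \<beta>) * (local_degree K (place_of K c) / field_degree K))"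
    unfolding sum.reindex[OF inj] using K
    by (simp add: conj_abs_apply[OF bij] ld sK(2))
  also have "\<dots> = place_inner \<mu> (log_fun \<alpha>) (log_fun \<beta>)"
    unfolding A_def by (rule log_fun_product(2)[OF K(1,2) \<alpha> K(3), symmetric])
  finally show ?thesis .
qed

lemma place_inner_invariant_form:
  "permuted_functions.invariant_form place_maps log_space (place_inner \<mu>)"
  unfolding permuted_functions.invariant_form_def[OF permuted_log_space]
proof (intro conjI ballI allI)
  fix f g h :: "'a place \<Rightarrow> real" assume V: "f \<in> log_space" "g \<in> log_space" "h \<in> log_space"
  show "place_inner \<mu> (f + g) h = place_inner \<mu> f h + place_inner \<mu> g h"
    unfolding place_inner_def
    using Bochner_Integration.integral_add[OF log_space_integrable[OF V(1,3)] log_space_integrable[OF V(2,3)]]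
    by (simp add: distrib_right)
next
  fix q and f h :: "'a place \<Rightarrow> real"
  show "place_inner \<mu> (rat_scale q f) h = of_rat q * place_inner \<mu> f h"
    by (simp add: place_inner_def rat_scale_def mult.assoc)
next
  fix s :: "'a place \<Rightarrow> 'a place" and f h :: "'a place \<Rightarrow> real" assume s: "s \<in> place_maps" and V: "f \<in> log_space" "h \<in> log_space"
  obtain \<sigma> \<alpha> \<beta> where *: "field_automorphism \<sigma>" "s = place_act \<sigma>" "f = log_fun \<alpha>" "h = log_fun \<beta>" "\<alpha> \<noteq> 0"
    using s V by (auto simp: place_maps_def log_space_def)
  show "place_inner \<mu> (f \<circ> s) (h \<circ> s) = place_inner \<mu> f h"
    unfolding *(2-4) log_fun_act[OF *(1)] by (rule place_inner_aut[OF *(1,5)])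
qed (simp add: place_inner_def mult.commute)

end

end

section \<open>Orthogonal decomposition of the algebraic numbers modulo torsion\<close>

theorem theorem1p2:
  fixes \<mu> :: "'a :: {alg_closed_field, field_char_0} place measure"
  assumes algebraic_closure: "\<forall>x :: 'a. algebraic x"
    and \<mu>: "place_measure \<mu>"
  shows "\<exists>T :: nat \<Rightarrow> ('a place \<Rightarrow> real) \<Rightarrow> ('a place \<Rightarrow> real).
    (\<forall>n\<ge>1. T n ` log_space \<subseteq> log_space \<and>
            rat_linear_on log_space (T n) \<and>
            (\<forall>f\<in>log_space. T n (T n f) = T n f) \<and>
            T n ` log_space \<subseteq> V_degree n) \<and>
    (\<forall>m\<ge>1. \<forall>n\<ge>1. m \<noteq> n \<longrightarrow>
       (\<forall>f \<in> T m ` log_space. \<forall>g \<in> T n ` log_space. place_inner \<mu> f g = 0)) \<and>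
    internal_direct_sum log_space {1..} (\<lambda>n. T n ` log_space)"
proof -
  \<comment> \<open>\<open>small_orbit_in_V_degree\<close> handles the generators, and
    \<open>V_degree n\<close> is a subspace because it is itself a span.\<close>
  have span: "rat_fun.span {f \<in> log_space. card ((\<lambda>s. f \<circ> s) ` place_maps) \<le> n}
      \<subseteq> (V_degree n :: ('a place \<Rightarrow> real) set)" for n
    by (rule rat_fun.span_minimal)
      (use small_orbit_in_V_degree[OF algebraic_closure] in \<open>auto simp: V_degree_def\<close>)
  from permuted_functions.orthogonal_layers[OF permuted_log_space[OF algebraic_closure]]
  obtain T :: "nat \<Rightarrow> ('a place \<Rightarrow> real) \<Rightarrow> ('a place \<Rightarrow> real)" where
    T: "\<forall>n\<ge>1. T n ` log_space \<subseteq> log_space \<and> rat_linear_on log_space (T n) \<and>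
        (\<forall>f\<in>log_space. T n (T n f) = T n f) \<and>
        T n ` log_space \<subseteq> rat_fun.span {f \<in> log_space. card ((\<lambda>s. f \<circ> s) ` place_maps) \<le> n}"
    and orth: "\<forall>m\<ge>1. \<forall>n\<ge>1. m \<noteq> n \<longrightarrow> (\<forall>f \<in> T m ` log_space. \<forall>g \<in> T n ` log_space.
        \<forall>B. permuted_functions.invariant_form place_maps log_space B \<longrightarrow> B f g = 0)"
    and sum: "internal_direct_sum log_space {1..} (\<lambda>n. T n ` log_space)"
    by (elim exE conjE) (rule that)
  show ?thesis
  proof (intro exI[of _ T] conjI allI impI sum)
    fix n :: nat assume n: "1 \<le> n"
    show "T n ` log_space \<subseteq> log_space" "rat_linear_on log_space (T n)"
      "\<forall>f\<in>log_space. T n (T n f) = T n f"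
      using T[rule_format, OF n] by simp_all
    show "T n ` log_space \<subseteq> V_degree n"
      using T[rule_format, OF n] span[of n] by (meson subset_trans)
  next
    fix m n :: nat assume "1 \<le> m" "1 \<le> n" "m \<noteq> n"
    from orth[rule_format, OF this]
    show "\<forall>f\<in>T m ` log_space. \<forall>g\<in>T n ` log_space. place_inner \<mu> f g = 0"
      using place_inner_invariant_form[OF algebraic_closure \<mu>] by simp
  qed
qed

end
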